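(* Let $K$ be a number field that is either a totally real cubic field or a real biquadratic field (i.e. $K=\mathbb{Q}(\sqrt{p},\sqrt{q})$ with $p,q>1$ distinct squarefree integers), and let $\mathcal{O}_K$ be its ring of integers. If $K\neq \mathbb{Q}(\zeta_7+\zeta_7^{-1})$, then there does not exist a $\mathbb{Z}$-form that is universal over $\mathcal{O}_K$.
   Context: A $\mathbb{Z}$-form is a positive definite quadratic form $Q(x_1,\dots,x_r)=\sum_{1\le i\le j\le r}a_{ij}x_ix_j$ with all $a_{ij}\in\mathbb{Z}$. For a totally real number field $K$, an element $\alpha\in\mathcal{O}_K$ is totally positive if its image under every real embedding of $K$ is positive. A $\mathbb{Z}$-form $Q$ is universal over $\mathcal{O}_K$ if for every totally positive $\alpha\in\mathcal{O}_K$ there is $v\in\mathcal{O}_K^r$ with $Q(v)=\alpha$. Here $\zeta_7$ denotes a primitive $7$th root of unity. *)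

theory Defs
  imports "HOL-Analysis.Analysis" "HOL-Computational_Algebra.Polynomial" "HOL-Computational_Algebra.Squarefree"
begin

text \<open>Number fields are modelled as subfields of the complex numbers (sets of complex numbers).\<close>

definition rat_adjoin :: "complex \<Rightarrow> complex set" where
  "rat_adjoin \<alpha> = {poly (map_poly of_rat f) \<alpha> | f :: rat poly. True}"

definition number_field_of_degree :: "nat \<Rightarrow> complex set \<Rightarrow> bool" where
  "number_field_of_degree n K \<longleftrightarrow>
     (\<exists>\<alpha> (p :: rat poly). irreducible p \<and> degree p = n \<and>
        poly (map_poly of_rat p) \<alpha> = 0 \<and> K = rat_adjoin \<alpha>)"

text \<open>Field embeddings of K into C (only the values on K matter).\<close>
definition embedding :: "complex set \<Rightarrow> (complex \<Rightarrow> complex) \<Rightarrow> bool" where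
  "embedding K \<sigma> \<longleftrightarrow> \<sigma> 1 = 1 \<and>
     (\<forall>x\<in>K. \<forall>y\<in>K. \<sigma> (x + y) = \<sigma> x + \<sigma> y \<and> \<sigma> (x * y) = \<sigma> x * \<sigma> y)"

definition totally_real :: "complex set \<Rightarrow> bool" where
  "totally_real K \<longleftrightarrow> (\<forall>\<sigma>. embedding K \<sigma> \<longrightarrow> (\<forall>x\<in>K. \<sigma> x \<in> \<real>))"

definition totally_real_cubic_field :: "complex set \<Rightarrow> bool" where
  "totally_real_cubic_field K \<longleftrightarrow> number_field_of_degree 3 K \<and> totally_real K"

definition real_biquadratic_field :: "complex set \<Rightarrow> bool" where
  "real_biquadratic_field K \<longleftrightarrow>
     (\<exists>p q :: int. p > 1 \<and> q > 1 \<and> p \<noteq> q \<and> squarefree p \<and> squarefree q \<and>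
        K = {of_rat a + of_rat b * complex_of_real (sqrt (of_int p))
             + of_rat c * complex_of_real (sqrt (of_int q))
             + of_rat d * complex_of_real (sqrt (of_int (p * q))) | a b c d. True})"

definition Q_zeta7_plus :: "complex set" where
  "Q_zeta7_plus = rat_adjoin (cis (2 * pi / 7) + inverse (cis (2 * pi / 7)))"

definition ring_of_integers :: "complex set \<Rightarrow> complex set" where
  "ring_of_integers K = {x \<in> K. algebraic_int x}"

definition totally_positive :: "complex set \<Rightarrow> complex \<Rightarrow> bool" where
  "totally_positive K \<alpha> \<longleftrightarrow> \<alpha> \<in> ring_of_integers K \<and>
     (\<forall>\<sigma>. embedding K \<sigma> \<longrightarrow> \<sigma> \<alpha> \<in> \<real> \<and> Re (\<sigma> \<alpha>) > 0)"

definition qf_eval :: "nat \<Rightarrow> (nat \<Rightarrow> nat \<Rightarrow> int) \<Rightarrow> (nat \<Rightarrow> 'a::comm_ring_1) \<Rightarrow> 'a" where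
  "qf_eval r a x = (\<Sum>i<r. \<Sum>j\<in>{i..<r}. of_int (a i j) * x i * x j)"

definition Z_form :: "nat \<Rightarrow> (nat \<Rightarrow> nat \<Rightarrow> int) \<Rightarrow> bool" where
  "Z_form r a \<longleftrightarrow> (\<forall>x :: nat \<Rightarrow> real. (\<exists>i<r. x i \<noteq> 0) \<longrightarrow> qf_eval r a x > 0)"

definition universal_over :: "complex set \<Rightarrow> nat \<Rightarrow> (nat \<Rightarrow> nat \<Rightarrow> int) \<Rightarrow> bool" where
  "universal_over K r a \<longleftrightarrow>
     (\<forall>\<alpha>. totally_positive K \<alpha> \<longrightarrow>
        (\<exists>v :: nat \<Rightarrow> complex. (\<forall>i<r. v i \<in> ring_of_integers K) \<and> qf_eval r a v = \<alpha>))"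

end

theory Submission
  imports Defs "Jordan_Normal_Form.Char_Poly"
    "HOL-Computational_Algebra.Polynomial_Factorial" "HOL-Computational_Algebra.Field_as_Ring"
begin

text \<open>
  Writing \<open>v\<close> in coordinates turns \<open>Q(v) = \<alpha>\<close> into an expression for the trace of \<open>\<alpha>\<close> in terms of
  values of \<open>Q\<close> at integer vectors. As nonzero values of \<open>Q\<close> are at least 1, any totally positive
  \<open>\<alpha>\<close> outside \<open>\<rat>\<close> has trace at least about that of the smallest nonrational square \<open>x\<^sup>2\<close>, which
  grows quadratically in \<open>x\<close>. On the other hand shifting \<open>x\<close> by an integer produces a totally
  positive element whose trace is only linear in \<open>x\<close>. So \<open>x\<close> is small.

  In a biquadratic field the numbers \<open>1, \<surd>p, \<surd>q, \<surd>r\<close> are orthogonal for the trace form, and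
  \<open>\<alpha> = k + \<surd>m\<close> or \<open>\<alpha> = (k + \<surd>m)/2\<close> has too small a trace if \<open>k\<close> is chosen minimal; here \<open>m\<close> is
  the smallest radicand, or the second smallest one if the smallest is 5.

  In a cubic field take \<open>x\<close> with minimal spread \<open>\<Sum>(x\<^sub>i - x\<^sub>j)\<^sup>2\<close> over pairs of conjugates. The
  inequalities leave only three fields, of discriminants 49, 81 and 148. In the last two, \<open>2 \<plusminus> x\<close>
  has so small a trace that it would have to be a square, but its norm is 3 or 5.
\<close>

section \<open>Algebraic integers form a ring\<close>

text \<open>The trace separates Q(v): the rational coordinates of v contribute a nonnegative term
  that may be dropped, the others contribute values of Q at integer vectors, weighted by lengths in
  the trace form. From Q only the value 1 at nonzero integer vectors and the Cauchy-Schwarz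
  inequality are needed, so the number of variables never matters.

  The obstacle is the ring of integers. The integral bases of a biquadratic field fall into several
  types modulo 4, and none is computed: traces into the quadratic subfields show that 4 times each
  coordinate is an integer and that these four integers have equal parity, which is nearly all the
  bounds require. A cubic field comes with no coordinates, so they are taken from a reduced basis
  modulo the integers, where cross terms are small.

  The cubic argument does not end in a contradiction: it produces a root of
  \<open>x\<^sup>3 - x\<^sup>2 - 2 * x + 1\<close> in K, and the root identifies K.\<close>

lemma algebraic_int_eigenvalue:
  fixes v :: "nat \<Rightarrow> 'a::field_char_0" and M :: "nat \<Rightarrow> nat \<Rightarrow> int"
  assumes ev: "\<And>k. k < n \<Longrightarrow> x * v k = (\<Sum>l<n. of_int (M k l) * v l)"
    and nz: "k0 < n" "v k0 \<noteq> 0"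
  shows "algebraic_int x"
proof -
  define A where "A = mat n n (\<lambda>(k, l). M k l)"
  have A: "A \<in> carrier_mat n n" by (simp add: A_def)
  have "eigenvector (map_mat of_int A) (vec n v) x"
    unfolding eigenvector_def
  proof (intro conjI)
    show "vec n v \<noteq> 0\<^sub>v (dim_row (map_mat of_int A))"
      using nz by (auto simp: A_def vec_eq_iff)
    show "map_mat of_int A *\<^sub>v vec n v = x \<cdot>\<^sub>v vec n v"
      by (rule eq_vecI)
         (auto simp: A_def ev scalar_prod_def atLeast0LessThan intro!: sum.cong)
  qed (simp add: A_def)
  then have "eigenvalue (map_mat of_int A) x"
    by (auto simp: eigenvalue_def)
  then have "poly (char_poly (map_mat of_int A)) x = 0"
    using eigenvalue_root_char_poly[of "map_mat of_int A" n x] A by simp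
  then have "poly (map_poly of_int (char_poly A)) x = 0"
    using of_int_hom.char_poly_hom[OF A] by metis
  moreover have "lead_coeff (char_poly A) = 1"
    using degree_monic_char_poly[OF A] by simp
  ultimately show ?thesis
    unfolding algebraic_int_altdef_ipoly by blast
qed

definition int_span :: "nat \<Rightarrow> (nat \<Rightarrow> 'a::comm_ring_1) \<Rightarrow> 'a set" where
  "int_span n v = range (\<lambda>c. \<Sum>l<n. of_int (c l) * v l)"

lemma int_spanI: "x = (\<Sum>l<n. of_int (c l) * v l) \<Longrightarrow> x \<in> int_span n v"
  by (auto simp: int_span_def)

lemma int_span_add: "x \<in> int_span n v \<Longrightarrow> y \<in> int_span n v \<Longrightarrow> x + y \<in> int_span n v"
proof -
  assume "x \<in> int_span n v" "y \<in> int_span n v"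
  then obtain c d where "x = (\<Sum>l<n. of_int (c l) * v l)" "y = (\<Sum>l<n. of_int (d l) * v l)"
    by (auto simp: int_span_def)
  then show ?thesis
    by (intro int_spanI[where c = "\<lambda>l. c l + d l"]) (simp add: sum.distrib algebra_simps)
qed

lemma int_span_scale: "x \<in> int_span n v \<Longrightarrow> of_int k * x \<in> int_span n v"
proof -
  assume "x \<in> int_span n v"
  then obtain c where "x = (\<Sum>l<n. of_int (c l) * v l)"
    by (auto simp: int_span_def)
  then show ?thesis
    by (intro int_spanI[where c = "\<lambda>l. k * c l"]) (simp add: sum_distrib_left algebra_simps)
qed

lemma int_span_base: "l < n \<Longrightarrow> v l \<in> int_span n v"
proof (rule int_spanI[where c = "\<lambda>i. if i = l then 1 else 0"])
  assume "l < n"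
  have "(\<Sum>i<n. of_int (if i = l then 1 else 0) * v i) = (\<Sum>i<n. if i = l then v i else 0)"
    by (intro sum.cong) auto
  also have "\<dots> = v l" using \<open>l < n\<close> by (simp add: sum.delta)
  finally show "v l = (\<Sum>i<n. of_int (if i = l then 1 else 0) * v i)" ..
qed

lemma int_span_sum: "(\<And>i. i \<in> S \<Longrightarrow> f i \<in> int_span n v) \<Longrightarrow> sum f S \<in> int_span n v"
proof (induction S rule: infinite_finite_induct)
  case (insert i S) then show ?case by (auto intro: int_span_add)
qed (use int_spanI[where c = "\<lambda>_. 0"] in auto)

text \<open>Preserving a finitely generated group is visibly inherited by sums and products, unlike
  the existence of a monic equation. Once the group contains a nonzero element, this property
  implies integrality.\<close>

definition stabilizes :: "'a::comm_ring_1 \<Rightarrow> nat \<Rightarrow> (nat \<Rightarrow> 'a) \<Rightarrow> bool" where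
  "stabilizes x n v \<longleftrightarrow> (\<forall>k<n. x * v k \<in> int_span n v)"

lemma stabilizes_span:
  assumes "stabilizes x n v" "y \<in> int_span n v" shows "x * y \<in> int_span n v"
proof -
  obtain c where "y = (\<Sum>l<n. of_int (c l) * v l)"
    using assms(2) by (auto simp: int_span_def)
  then have "x * y = (\<Sum>l<n. of_int (c l) * (x * v l))"
    by (simp add: sum_distrib_left algebra_simps)
  then show ?thesis
    using assms(1) by (auto simp: stabilizes_def intro!: int_span_sum int_span_scale)
qed

lemma stabilizes_add: "stabilizes x n v \<Longrightarrow> stabilizes y n v \<Longrightarrow> stabilizes (x + y) n v"
  by (auto simp: stabilizes_def algebra_simps intro: int_span_add)

lemma stabilizes_mult: "stabilizes x n v \<Longrightarrow> stabilizes y n v \<Longrightarrow> stabilizes (x * y) n v"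
  using stabilizes_span[of x n v] by (auto simp: stabilizes_def mult.assoc)

lemma stabilizes_imp_algebraic_int:
  fixes x :: "'a::field_char_0"
  assumes "stabilizes x n v" "k0 < n" "v k0 \<noteq> 0"
  shows "algebraic_int x"
proof -
  have "\<forall>k. \<exists>c. k < n \<longrightarrow> x * v k = (\<Sum>l<n. of_int (c l) * v l)"
    using assms(1) by (auto simp: stabilizes_def int_span_def)
  then obtain M where "\<And>k. k < n \<Longrightarrow> x * v k = (\<Sum>l<n. of_int (M k l) * v l)"
    by metis
  then show ?thesis using algebraic_int_eigenvalue assms by blast
qed

lemma algebraic_int_power_reduce:
  fixes a :: "'a::field_char_0"
  assumes "algebraic_int a"
  obtains m c where "m > 0" "a ^ m = (\<Sum>i<m. of_int (c i) * a ^ i)"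
proof -
  obtain p where p: "poly (map_poly of_int p) a = 0" "lead_coeff p = 1"
    using assms by (auto simp: algebraic_int_altdef_ipoly)
  let ?m = "degree p"
  have "?m > 0" using p by (auto intro!: Nat.gr0I elim!: degree_eq_zeroE)
  moreover have "(\<Sum>i\<le>?m. of_int (coeff p i) * a ^ i) = 0"
    using p(1) by (simp add: poly_altdef degree_map_poly coeff_map_poly)
  then have "(\<Sum>i<?m. of_int (coeff p i) * a ^ i) + a ^ ?m = 0"
    using p(2) by (simp add: lessThan_Suc_atMost[symmetric])
  then have "a ^ ?m = (\<Sum>i<?m. of_int (- coeff p i) * a ^ i)"
    by (simp add: sum_negf eq_neg_iff_add_eq_0 add.commute)
  ultimately show ?thesis by (rule that)
qed

text \<open>The monomials a^i b^j with exponents below the degrees of monic equations of a and b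
  span a group preserved by both: a product with a or b is again such a monomial or is rewritten by
  the equation. The pair (i, j) is stored at the index \<open>i * n + j\<close>.\<close>

lemma algebraic_int_common_lattice:
  fixes a b :: "'a::field_char_0"
  assumes "algebraic_int a" "algebraic_int b"
  obtains n v where "stabilizes a n v" "stabilizes b n v" "0 < n" "v 0 \<noteq> 0"
proof -
  obtain m c where m: "m > 0" and am: "a ^ m = (\<Sum>i<m. of_int (c i) * a ^ i)"
    using algebraic_int_power_reduce[OF assms(1)] .
  obtain n d where n: "n > 0" and bn: "b ^ n = (\<Sum>i<n. of_int (d i) * b ^ i)"
    using algebraic_int_power_reduce[OF assms(2)] .
  define v where "v k = a ^ (k div n) * b ^ (k mod n)" for k
  have base: "a ^ i * b ^ j \<in> int_span (m * n) v" if "i < m" "j < n" for i j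
  proof -
    have "i * n + j < m * n"
      using mult_le_mono1[of "Suc i" m n] that by simp
    then show ?thesis
      using int_span_base[of "i * n + j" "m * n" v] that by (simp add: v_def)
  qed
  have "stabilizes a (m * n) v" unfolding stabilizes_def
  proof (intro allI impI)
    fix k assume k: "k < m * n"
    define i j where "i = k div n" and "j = k mod n"
    have ij: "i < m" "j < n"
      using k n by (auto simp: i_def j_def less_mult_imp_div_less)
    have "a * v k = a ^ Suc i * b ^ j" by (simp add: v_def i_def j_def)
    also have "\<dots> \<in> int_span (m * n) v"
    proof (cases "Suc i = m")
      case True
      have "a ^ Suc i * b ^ j = (\<Sum>i<m. of_int (c i) * (a ^ i * b ^ j))"
        unfolding True am by (simp add: sum_distrib_right mult.assoc)
      then show ?thesis using ij by (auto intro!: int_span_sum int_span_scale base)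
    qed (use base[of "Suc i" j] ij in simp)
    finally show "a * v k \<in> int_span (m * n) v" .
  qed
  moreover have "stabilizes b (m * n) v" unfolding stabilizes_def
  proof (intro allI impI)
    fix k assume k: "k < m * n"
    define i j where "i = k div n" and "j = k mod n"
    have ij: "i < m" "j < n"
      using k n by (auto simp: i_def j_def less_mult_imp_div_less)
    have "b * v k = a ^ i * b ^ Suc j" by (simp add: v_def i_def j_def)
    also have "\<dots> \<in> int_span (m * n) v"
    proof (cases "Suc j = n")
      case True
      have "a ^ i * b ^ Suc j = (\<Sum>j<n. of_int (d j) * (a ^ i * b ^ j))"
        unfolding True bn by (simp add: sum_distrib_left mult.left_commute)
      then show ?thesis using ij by (auto intro!: int_span_sum int_span_scale base)
    qed (use base[of i "Suc j"] ij in simp)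
    finally show "b * v k \<in> int_span (m * n) v" .
  qed
  ultimately show ?thesis
    using m n by (intro that[of "m * n" v]) (auto simp: v_def)
qed

lemma algebraic_int_add:
  "algebraic_int a \<Longrightarrow> algebraic_int b \<Longrightarrow> algebraic_int (a + b :: 'a::field_char_0)"
  by (erule (1) algebraic_int_common_lattice)
     (rule stabilizes_imp_algebraic_int, rule stabilizes_add)

lemma algebraic_int_mult:
  "algebraic_int a \<Longrightarrow> algebraic_int b \<Longrightarrow> algebraic_int (a * b :: 'a::field_char_0)"
  by (erule (1) algebraic_int_common_lattice)
     (rule stabilizes_imp_algebraic_int, rule stabilizes_mult)

lemma algebraic_int_of_rat_Ints:
  assumes "algebraic_int (of_rat x :: complex)" obtains k where "x = of_int k"
proof -
  have "of_rat x \<in> (\<int> :: complex set)"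
    by (rule rational_algebraic_int_is_int[OF assms]) (simp add: Rats_def)
  then obtain k where "of_rat x = (of_int k :: complex)" by (auto elim: Ints_cases)
  then have "of_rat x = (of_rat (of_int k) :: complex)" by simp
  then have "x = of_int k" by (simp only: of_rat_eq_iff)
  then show ?thesis by (rule that)
qed

section \<open>Quadratic forms\<close>

text \<open>The polar form without the factor 1/2, so that it stays integral on integer vectors;
  hence the 4 in its Cauchy-Schwarz inequality.\<close>

definition qf_polar :: "nat \<Rightarrow> (nat \<Rightarrow> nat \<Rightarrow> int) \<Rightarrow> (nat \<Rightarrow> 'a::comm_ring_1) \<Rightarrow> (nat \<Rightarrow> 'a) \<Rightarrow> 'a" where
  "qf_polar r a x y = (\<Sum>i<r. \<Sum>j\<in>{i..<r}. of_int (a i j) * (x i * y j + y i * x j))"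

lemma qf_eval_add:
  "qf_eval r a (\<lambda>i. x i + y i) = qf_eval r a x + qf_polar r a x y + qf_eval r a y"
  unfolding qf_eval_def qf_polar_def sum.distrib[symmetric]
  by (intro sum.cong refl) (simp add: algebra_simps)

lemma qf_eval_scale: "qf_eval r a (\<lambda>i. s * x i) = s\<^sup>2 * qf_eval r a x"
  unfolding qf_eval_def sum_distrib_left
  by (intro sum.cong refl) (simp add: power2_eq_square algebra_simps)

lemma qf_polar_scale:
  "qf_polar r a (\<lambda>i. s * x i) (\<lambda>i. t * y i) = s * t * qf_polar r a x y"
  unfolding qf_polar_def sum_distrib_left
  by (intro sum.cong refl) (simp add: algebra_simps)

lemma qf_polar_commute: "qf_polar r a x y = qf_polar r a y x"
  unfolding qf_polar_def by (intro sum.cong refl) (simp add: algebra_simps)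

lemma qf_eval_of_int: "qf_eval r a (\<lambda>i. of_int (x i)) = of_int (qf_eval r a x)"
  by (simp add: qf_eval_def)

lemma qf_polar_of_int:
  "qf_polar r a (\<lambda>i. of_int (x i)) (\<lambda>i. of_int (y i)) = of_int (qf_polar r a x y)"
  by (simp add: qf_polar_def)

lemma qf_eval_cong: "(\<And>i. i < r \<Longrightarrow> x i = y i) \<Longrightarrow> qf_eval r a x = qf_eval r a y"
  by (auto simp: qf_eval_def intro!: sum.cong)

lemma qf_polar_zero: "(\<And>i. i < r \<Longrightarrow> x i = 0) \<Longrightarrow> qf_polar r a x y = 0"
  by (auto simp: qf_polar_def intro!: sum.neutral)

lemma qf_eval_zero: "(\<And>i. i < r \<Longrightarrow> x i = 0) \<Longrightarrow> qf_eval r a x = 0"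
  by (auto simp: qf_eval_def intro!: sum.neutral)

lemma qf_eval_nonneg:
  assumes "Z_form r a" shows "qf_eval r a (x :: nat \<Rightarrow> real) \<ge> 0"
  using assms qf_eval_zero[of r x a] unfolding Z_form_def by (metis less_eq_real_def)

lemma qf_eval_int_nonneg:
  assumes "Z_form r a" shows "qf_eval r a (x :: nat \<Rightarrow> int) \<ge> 0"
  using qf_eval_nonneg[OF assms, of "\<lambda>i. of_int (x i)"] by (simp add: qf_eval_of_int)

lemma qf_eval_int_pos:
  assumes "Z_form r a" "i < r" "x i \<noteq> 0" shows "qf_eval r a (x :: nat \<Rightarrow> int) \<ge> 1"
proof -
  have "qf_eval r a (\<lambda>i. of_int (x i) :: real) > 0"
    using assms unfolding Z_form_def by (metis of_int_eq_0_iff)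
  thus ?thesis by (simp add: qf_eval_of_int)
qed

lemma qf_eval_int_eq_0:
  assumes "Z_form r a" "qf_eval r a (x :: nat \<Rightarrow> int) = 0" "i < r" shows "x i = 0"
  using qf_eval_int_pos[OF assms(1,3), of x] assms(2) by auto

lemma qf_eval_lincomb2:
  "qf_eval r a (\<lambda>i. s * x i + t * y i) =
     s\<^sup>2 * qf_eval r a x + s * t * qf_polar r a x y + t\<^sup>2 * qf_eval r a y"
  by (simp add: qf_eval_add qf_eval_scale qf_polar_scale)

text \<open>Cauchy-Schwarz. The vector \<open>- B * x + 2 * X * y\<close> is a multiple of the
  component of \<open>y\<close> orthogonal to \<open>x\<close>, and Q takes there the value
  \<open>X * (4 * X * Y - B\<^sup>2)\<close>.\<close>

lemma qf_polar_square_le: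
  assumes "Z_form r a"
  shows "(qf_polar r a x y)\<^sup>2 \<le> 4 * qf_eval r a x * qf_eval r a (y :: nat \<Rightarrow> int)"
proof (cases "qf_eval r a x = 0")
  case True
  then have "qf_polar r a x y = 0"
    using qf_eval_int_eq_0[OF assms] by (intro qf_polar_zero) blast
  then show ?thesis using True by simp
next
  case False
  define X Y B where "X = qf_eval r a x" and "Y = qf_eval r a y" and "B = qf_polar r a x y"
  have X: "X > 0" using False qf_eval_int_nonneg[OF assms, of x] by (simp add: X_def)
  have "0 \<le> qf_eval r a (\<lambda>i. - B * x i + 2 * X * y i)"
    by (rule qf_eval_int_nonneg[OF assms])
  also have "\<dots> = X * (4 * X * Y - B\<^sup>2)"
    unfolding qf_eval_lincomb2 X_def[symmetric] Y_def[symmetric] B_def[symmetric]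
    by (simp add: power2_eq_square algebra_simps)
  finally show ?thesis using X by (simp add: zero_le_mult_iff X_def Y_def B_def)
qed


section \<open>Embeddings fix the integers\<close>

lemma embedding_0:
  assumes "embedding K \<sigma>" "0 \<in> K" shows "\<sigma> 0 = 0"
  using assms unfolding embedding_def by (metis add_cancel_right_right)

lemma embedding_of_int:
  assumes \<sigma>: "embedding K \<sigma>" and K: "\<And>k. of_int k \<in> K"
  shows "\<sigma> (of_int k) = of_int k"
proof -
  have zero: "\<sigma> 0 = 0" using embedding_0[OF \<sigma>] K[of 0] by simp
  have add: "\<sigma> (of_int a + of_int b) = \<sigma> (of_int a) + \<sigma> (of_int b)" for a b
    using \<sigma> K unfolding embedding_def by blast
  have one: "\<sigma> 1 = 1" using \<sigma> unfolding embedding_def by blast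
  have nat: "\<sigma> (of_nat n) = of_nat n" for n
  proof (induction n)
    case (Suc n)
    then show ?case using add[of 1 "int n"] one by simp
  qed (simp add: zero)
  show ?thesis
  proof (cases k)
    case (nonneg n) then show ?thesis using nat by simp
  next
    case (neg n)
    have "\<sigma> (of_int k) + \<sigma> (of_nat (Suc n)) = 0"
      using add[of k "int (Suc n)"] zero unfolding neg by simp
    then have "\<sigma> (of_int k) = - of_nat (Suc n)"
      unfolding nat by (simp only: eq_neg_iff_add_eq_0)
    then show ?thesis unfolding neg by simp
  qed
qed

section \<open>Biquadratic fields\<close>

text \<open>In lowest terms the square of the denominator would have to divide
  \<open>m\<close>.\<close>

lemma squarefree_times_rat_square_Ints:
  fixes x :: rat and m :: int
  assumes "squarefree m" "of_int m * x\<^sup>2 \<in> \<int>"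
  shows "x \<in> \<int>"
proof -
  obtain n d where x: "x = of_int n / of_int d" and d: "d > 0" and cop: "coprime n d"
    by (cases x) (auto simp: Fract_of_int_quotient)
  obtain k where k: "of_int m * x\<^sup>2 = of_int k"
    using assms(2) by (auto elim: Ints_cases)
  have "of_int (m * n\<^sup>2) = (of_int (k * d\<^sup>2) :: rat)"
    using k d by (simp add: x field_simps)
  then have "m * n\<^sup>2 = k * d\<^sup>2" by (simp only: of_int_eq_iff)
  then have "d\<^sup>2 dvd m * n\<^sup>2" by simp
  moreover have "coprime (d\<^sup>2) (n\<^sup>2)" using cop by (simp add: coprime_commute)
  ultimately have "d\<^sup>2 dvd m" by (simp add: coprime_dvd_mult_left_iff)
  then have "d dvd 1" using squarefreeD[OF assms(1)] by blast
  then have "d = 1" using d by simp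
  then show ?thesis by (simp add: x)
qed

lemma squarefree_not_rat_square:
  fixes x :: rat and m :: int
  assumes "squarefree m" "m > 1" shows "x\<^sup>2 \<noteq> of_int m"
proof
  assume x: "x\<^sup>2 = of_int m"
  then have "of_int m * x\<^sup>2 \<in> \<int>" by simp
  then have "x \<in> \<int>" by (rule squarefree_times_rat_square_Ints[OF assms(1)])
  then obtain k where "x = of_int k" by (auto elim: Ints_cases)
  then have "of_int (k\<^sup>2) = (of_int m :: rat)" using x by simp
  then have "k\<^sup>2 = m" by (simp only: of_int_eq_iff)
  then have "k dvd 1" using squarefreeD[OF assms(1), of k] by simp
  then have "k\<^sup>2 = 1" by (auto simp: zdvd1_eq power2_eq_square abs_if split: if_splits)
  then show False using \<open>k\<^sup>2 = m\<close> assms(2) by simp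
qed

text \<open>The trace 2 E and the norm E^2 - m F^2 are rational algebraic integers. They give
  \<open>m * f\<^sup>2 = e\<^sup>2 - 4 * n\<close>, and reading this modulo 4 decides the parities.
  Integrality of the conjugate is a hypothesis because the element is met inside a larger field,
  whose conjugations supply it.\<close>

lemma quadratic_integer_coordinates:
  fixes s :: complex and E F :: rat and m :: int
  assumes m: "squarefree m" and ss: "s\<^sup>2 = of_int m"
    and int: "algebraic_int (of_rat E + of_rat F * s)" "algebraic_int (of_rat E - of_rat F * s)"
  obtains e f :: int where "2 * E = of_int e" "2 * F = of_int f" "even e = even f"
    "m mod 4 \<noteq> 1 \<Longrightarrow> even e \<and> even f"
proof -
  have "of_rat (2 * E) = (of_rat E + of_rat F * s) + (of_rat E - of_rat F * s)"
    by (simp add: of_rat_mult)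
  then have "algebraic_int (of_rat (2 * E) :: complex)"
    using algebraic_int_add[OF int] by metis
  then obtain e where e: "2 * E = of_int e" by (rule algebraic_int_of_rat_Ints)
  have "(of_rat E + of_rat F * s) * (of_rat E - of_rat F * s) = (of_rat E)\<^sup>2 - (of_rat F)\<^sup>2 * s\<^sup>2"
    by (simp add: power2_eq_square algebra_simps)
  also have "\<dots> = of_rat (E\<^sup>2 - F\<^sup>2 * of_int m)"
    by (simp add: ss of_rat_mult of_rat_diff of_rat_power)
  finally have "algebraic_int (of_rat (E\<^sup>2 - F\<^sup>2 * of_int m) :: complex)"
    using algebraic_int_mult[OF int] by metis
  then obtain n where n: "E\<^sup>2 - F\<^sup>2 * of_int m = of_int n" by (rule algebraic_int_of_rat_Ints)
  have "of_int m * (2 * F)\<^sup>2 = (2 * E)\<^sup>2 - 4 * (E\<^sup>2 - F\<^sup>2 * of_int m)"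
    by (simp add: power2_eq_square algebra_simps)
  also have "\<dots> = of_int (e\<^sup>2 - 4 * n)" unfolding e n by simp
  finally have mF: "of_int m * (2 * F)\<^sup>2 = of_int (e\<^sup>2 - 4 * n)" .
  have "2 * F \<in> \<int>" by (rule squarefree_times_rat_square_Ints[OF m, of "2 * F", unfolded mF, OF Ints_of_int])
  then obtain f where f: "2 * F = of_int f" by (auto elim: Ints_cases)
  have "of_int (m * f\<^sup>2) = (of_int (e\<^sup>2 - 4 * n) :: rat)" using mF unfolding f by simp
  then have eq: "m * f\<^sup>2 = e\<^sup>2 - 4 * n" by (simp only: of_int_eq_iff)
  have m4: "m mod 4 \<noteq> 0" using squarefreeD[OF m, of 2] by auto
  have sq: "odd k \<Longrightarrow> \<exists>j. k\<^sup>2 = 4 * j + 1" "even k \<Longrightarrow> \<exists>j. k\<^sup>2 = 4 * j" for k :: int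
  proof -
    assume "odd k"
    then obtain j where "k = 2 * j + 1" by (elim oddE)
    then have "k\<^sup>2 = 4 * (j\<^sup>2 + j) + 1" by (simp add: power2_eq_square algebra_simps)
    then show "\<exists>j. k\<^sup>2 = 4 * j + 1" by blast
  next
    assume "even k"
    then obtain j where "k = 2 * j" by (elim evenE)
    then have "k\<^sup>2 = 4 * j\<^sup>2" by (simp add: power2_eq_square)
    then show "\<exists>j. k\<^sup>2 = 4 * j" by blast
  qed
  have par: "even e = even f \<and> (m mod 4 \<noteq> 1 \<longrightarrow> even e \<and> even f)"
  proof (cases "even f")
    case True
    then obtain j where "f\<^sup>2 = 4 * j" using sq by blast
    then have e2: "e\<^sup>2 = 4 * (m * j + n)" using eq by (simp add: algebra_simps)
    have "even (e\<^sup>2)" unfolding e2 by simp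
    then show ?thesis using True by simp
  next
    case False
    then obtain j where "f\<^sup>2 = 4 * j + 1" using sq by blast
    then have e2: "m = e\<^sup>2 + 4 * (- n - m * j)" using eq by (simp add: algebra_simps)
    then have m1: "m mod 4 = e\<^sup>2 mod 4" by (metis mod_mult_self2)
    show ?thesis
    proof (cases "even e")
      case True then show ?thesis using sq(2)[of e] m1 m4 by auto
    next
      case False
      then obtain i where "e\<^sup>2 = 4 * i + 1" using sq by blast
      then have "m mod 4 = 1" using m1 by (simp only:) presburger
      then show ?thesis using False \<open>odd f\<close> by simp
    qed
  qed
  show ?thesis using that[OF e f] par by blast
qed

section \<open>Coordinates in a biquadratic field\<close>

lemma qf_eval_lincomb4:
  "qf_eval r F (\<lambda>i. a i + s * b i + t * c i + z * d i) =
     qf_eval r F a + s\<^sup>2 * qf_eval r F b + t\<^sup>2 * qf_eval r F c + z\<^sup>2 * qf_eval r F d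
     + s * qf_polar r F a b + t * qf_polar r F a c + z * qf_polar r F a d
     + (s * t) * qf_polar r F b c + (s * z) * qf_polar r F b d + (t * z) * qf_polar r F c d"
  unfolding qf_eval_def qf_polar_def sum_distrib_left sum.distrib[symmetric]
  by (intro sum.cong refl) (simp add: power2_eq_square algebra_simps)

text \<open>The square roots are arguments because conjugation is modelled by changing their signs
  while the rational coordinates stay.\<close>

definition bq_elem :: "complex \<Rightarrow> complex \<Rightarrow> complex \<Rightarrow> rat \<Rightarrow> rat \<Rightarrow> rat \<Rightarrow> rat \<Rightarrow> complex" where
  "bq_elem s t z A B C D = of_rat A + of_rat B * s + of_rat C * t + of_rat D * z"

text \<open>The three quadratic subfields of a biquadratic field have radicands of the form \<open>u v\<close>, \<open>u w\<close>, \<open>v w\<close>;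
  this makes the situation symmetric in \<open>u\<close>, \<open>v\<close>, \<open>w\<close>. Squarefreeness forces pairwise coprimality.\<close>

locale biquadratic =
  fixes u v w :: int and s t z :: complex
  assumes pos: "u > 0" "v > 0" "w > 0"
    and gt1: "u * v > 1" "u * w > 1" "v * w > 1"
    and sqf: "squarefree (u * v)" "squarefree (u * w)" "squarefree (v * w)"
    and squares: "s\<^sup>2 = of_int (u * v)" "t\<^sup>2 = of_int (u * w)" "z\<^sup>2 = of_int (v * w)"
    and products: "s * t = of_int u * z" "s * z = of_int v * t" "t * z = of_int w * s"

lemma biquadratic_swap12: "biquadratic u v w s t z \<Longrightarrow> biquadratic v u w s z t"
  by (auto simp: biquadratic_def mult.commute)

lemma biquadratic_swap23: "biquadratic u v w s t z \<Longrightarrow> biquadratic u w v t s z"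
  by (auto simp: biquadratic_def mult.commute)

text \<open>The sign choices are the four elements of the Galois group. They act on the parameters
  of the locale, so no automorphism has to be constructed.\<close>

lemma biquadratic_signs:
  assumes "biquadratic u v w s t z" "\<epsilon> \<in> {1, -1}" "\<delta> \<in> {1, -1}"
  shows "biquadratic u v w (\<epsilon> * s) (\<delta> * t) (\<epsilon> * \<delta> * z)"
  using assms by (auto simp: biquadratic_def)

context biquadratic
begin

abbreviation elem :: "rat \<Rightarrow> rat \<Rightarrow> rat \<Rightarrow> rat \<Rightarrow> complex" where
  "elem \<equiv> bq_elem s t z"

lemma irrational:
  "s \<noteq> of_rat x" "t \<noteq> of_rat x" "z \<noteq> of_rat x"
proof -
  have *: False if "y = of_rat x" "y\<^sup>2 = of_int m" "squarefree m" "m > 1" for y :: complex and m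
  proof -
    have "of_rat (x\<^sup>2) = (of_rat (of_int m) :: complex)"
      using that(1,2) by (simp add: of_rat_power)
    then have "x\<^sup>2 = of_int m" by (simp only: of_rat_eq_iff)
    then show False using squarefree_not_rat_square that by blast
  qed
  show "s \<noteq> of_rat x" "t \<noteq> of_rat x" "z \<noteq> of_rat x"
    using * squares sqf gt1 by blast+
qed

lemma linear_independent2:
  assumes "of_rat A + of_rat B * s = 0" shows "A = 0 \<and> B = 0"
proof (cases "B = 0")
  case False
  then have "s = of_rat (- A / B)"
    using assms by (simp add: of_rat_divide of_rat_minus field_simps add_eq_0_iff)
  then show ?thesis using irrational by blast
qed (use assms in simp)

text \<open>Since z = s t / u, a relation has the form (A + B s) + t (C + G s) = 0 over Q(s). If C +
  G s is nonzero, then t = e + f s, and squaring forces e f = 0; so t is rational, or s t and with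
  it z is.\<close>

lemma linear_independent:
  assumes "elem A B C D = 0" shows "A = 0 \<and> B = 0 \<and> C = 0 \<and> D = 0"
proof -
  define G where "G = D / of_int u"
  have u: "of_int u \<noteq> (0::complex)" using pos by simp
  have z: "z = s * t / of_int u" using products(1) u by simp
  have eq: "(of_rat A + of_rat B * s) + t * (of_rat C + of_rat G * s) = 0"
    using assms unfolding bq_elem_def z G_def
    by (simp add: of_rat_divide algebra_simps)
  show ?thesis
  proof (cases "C = 0 \<and> G = 0")
    case True
    then have "D = 0" using pos by (simp add: G_def)
    then show ?thesis using True eq linear_independent2[of A B] by simp
  next
    case False
    define N where "N = C\<^sup>2 - G\<^sup>2 * of_int (u * v)"
    have conj: "(of_rat C + of_rat G * s) * (of_rat C - of_rat G * s) = of_rat N"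
    proof -
      have "(of_rat C + of_rat G * s) * (of_rat C - of_rat G * s)
        = (of_rat C)\<^sup>2 - (of_rat G)\<^sup>2 * s\<^sup>2" by (simp add: power2_eq_square algebra_simps)
      then show ?thesis unfolding squares N_def by (simp add: of_rat_diff of_rat_mult of_rat_power)
    qed
    have "N \<noteq> 0"
    proof
      assume "N = 0"
      then have "(of_rat C + of_rat G * s) = 0 \<or> (of_rat C + of_rat (- G) * s) = 0"
        using conj by (simp add: of_rat_minus)
      then show False using linear_independent2[of C G] linear_independent2[of C "- G"] False by auto
    qed
    \<comment> \<open>The coordinates of -(A + B s) / (C + G s), after multiplying numerator and
      denominator by the conjugate C - G s.\<close>
    define e f where "e = - (A * C - B * G * of_int (u * v)) / N" and "f = - (B * C - A * G) / N"
    have eN: "e * N = - (A * C - B * G * of_int (u * v))" and fN: "f * N = - (B * C - A * G)"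
      using \<open>N \<noteq> 0\<close> by (simp_all add: e_def f_def)
    have "t * of_rat N = - ((of_rat A + of_rat B * s) * (of_rat C - of_rat G * s))"
      using eq unfolding conj[symmetric]
      by (metis (no_types, lifting) eq_neg_iff_add_eq_0 add.commute mult.assoc minus_mult_left)
    also have "\<dots> = - (of_rat A * of_rat C - of_rat B * of_rat G * s\<^sup>2)
                     - (of_rat B * of_rat C - of_rat A * of_rat G) * s"
      by (simp add: power2_eq_square algebra_simps)
    also have "\<dots> = of_rat (e * N) + of_rat (f * N) * s"
      unfolding squares eN fN
      by (simp add: of_rat_diff of_rat_mult of_rat_minus algebra_simps)
    finally have "t * of_rat N = (of_rat e + of_rat f * s) * of_rat N"
      by (simp add: of_rat_mult algebra_simps)
    then have t: "t = of_rat e + of_rat f * s" using \<open>N \<noteq> 0\<close> by simp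
    have "t\<^sup>2 = (of_rat e)\<^sup>2 + (of_rat f)\<^sup>2 * s\<^sup>2 + 2 * of_rat e * of_rat f * s"
      unfolding t by (simp add: power2_eq_square algebra_simps)
    then have "of_rat (e\<^sup>2 + f\<^sup>2 * of_int (u * v) - of_int (u * w)) + of_rat (2 * e * f) * s = 0"
      unfolding squares by (simp add: of_rat_diff of_rat_add of_rat_mult of_rat_power)
    then have "2 * e * f = 0" using linear_independent2 by blast
    then consider "f = 0" | "e = 0" by auto
    then show ?thesis
    proof cases
      case 1
      then show ?thesis using t irrational(2)[of e] by simp
    next
      case 2
      then have "of_int u * z = of_rat f * s\<^sup>2"
        using t products(1) by (simp add: power2_eq_square algebra_simps)
      then have "of_int u * z = of_rat (f * of_int (u * v))"
        unfolding squares by (simp add: of_rat_mult)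
      then have "z = of_rat (f * of_int (u * v)) / of_int u"
        using u by (metis nonzero_mult_div_cancel_left)
      then have "z = of_rat (f * of_int (u * v) / of_int u)"
        by (simp only: of_rat_divide of_rat_of_int_eq)
      then show ?thesis using irrational(3) by blast
    qed
  qed
qed

lemma elem_eq_iff:
  "elem A B C D = elem A' B' C' D' \<longleftrightarrow> A = A' \<and> B = B' \<and> C = C' \<and> D = D'"
proof
  assume "elem A B C D = elem A' B' C' D'"
  then have "elem (A - A') (B - B') (C - C') (D - D') = 0"
    by (simp add: bq_elem_def of_rat_diff algebra_simps)
  from linear_independent[OF this] show "A = A' \<and> B = B' \<and> C = C' \<and> D = D'" by simp
qed auto

lemma elem_mult:
  "elem A B C D * elem A' B' C' D' =
     elem (A * A' + of_int (u * v) * B * B' + of_int (u * w) * C * C' + of_int (v * w) * D * D')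
          (A * B' + B * A' + of_int w * (C * D' + D * C'))
          (A * C' + C * A' + of_int v * (B * D' + D * B'))
          (A * D' + D * A' + of_int u * (B * C' + C * B'))"
proof -
  have "elem A B C D * elem A' B' C' D' =
     of_rat A * of_rat A' + of_rat B * of_rat B' * s\<^sup>2 + of_rat C * of_rat C' * t\<^sup>2 + of_rat D * of_rat D' * z\<^sup>2
     + (of_rat A * of_rat B' + of_rat B * of_rat A') * s
     + (of_rat A * of_rat C' + of_rat C * of_rat A') * t
     + (of_rat A * of_rat D' + of_rat D * of_rat A') * z
     + (of_rat B * of_rat C' + of_rat C * of_rat B') * (s * t)
     + (of_rat B * of_rat D' + of_rat D * of_rat B') * (s * z)
     + (of_rat C * of_rat D' + of_rat D * of_rat C') * (t * z)"
    unfolding bq_elem_def by (simp add: power2_eq_square algebra_simps)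
  then show ?thesis
    unfolding squares products by (simp add: bq_elem_def of_rat_add of_rat_mult algebra_simps)
qed

end

text \<open>The product rule \<open>elem_mult\<close> sees only \<open>u\<close>, \<open>v\<close>,
  \<open>w\<close>, so a computation repeated with conjugate square roots yields the same rational
  coordinates. By linear independence, a polynomial that vanishes at an element then vanishes at its
  conjugates.\<close>

lemma (in biquadratic) poly_elem:
  fixes f :: "int poly"
  assumes bq: "biquadratic u v w s' t' z'"
  shows "\<exists>A' B' C' D'. poly (map_poly of_int f) (elem A B C D) = elem A' B' C' D' \<and>
           poly (map_poly of_int f) (bq_elem s' t' z' A B C D)
             = bq_elem s' t' z' A' B' C' D'"
proof (induction f)
  case 0
  have "elem 0 0 0 0 = 0" "bq_elem s' t' z' 0 0 0 0 = 0"
    by (simp_all add: bq_elem_def)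
  then show ?case by (metis map_poly_0 poly_0)
next
  case (pCons k f)
  then obtain A' B' C' D' where
    IH: "poly (map_poly of_int f) (elem A B C D) = elem A' B' C' D'"
        "poly (map_poly of_int f) (bq_elem s' t' z' A B C D)
           = bq_elem s' t' z' A' B' C' D'" by blast
  have k: "of_int k + elem P Q R S = elem (of_int k + P) Q R S"
          "of_int k + bq_elem s' t' z' P Q R S = bq_elem s' t' z' (of_int k + P) Q R S"
    for P Q R S by (simp_all add: bq_elem_def of_rat_add)
  show ?case
    unfolding map_poly_pCons[OF pCons(1)] poly_pCons IH elem_mult biquadratic.elem_mult[OF bq] k
    by blast
qed

lemma (in biquadratic) algebraic_int_conj:
  assumes "biquadratic u v w s' t' z'" "algebraic_int (elem A B C D)"
  shows "algebraic_int (bq_elem s' t' z' A B C D)"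
proof -
  obtain f where f: "poly (map_poly of_int f) (elem A B C D) = 0" "lead_coeff f = 1"
    using assms(2) by (auto simp: algebraic_int_altdef_ipoly)
  obtain A' B' C' D' where *: "poly (map_poly of_int f) (elem A B C D) = elem A' B' C' D'"
    "poly (map_poly of_int f) (bq_elem s' t' z' A B C D) = bq_elem s' t' z' A' B' C' D'"
    using poly_elem[OF assms(1)] by blast
  have "A' = 0 \<and> B' = 0 \<and> C' = 0 \<and> D' = 0" using linear_independent * f by simp
  then have "poly (map_poly of_int f) (bq_elem s' t' z' A B C D) = 0"
    using * by (simp add: bq_elem_def)
  then show ?thesis using f(2) unfolding algebraic_int_altdef_ipoly by blast
qed


text \<open>Adding the conjugate with t and z negated gives the trace 2 A + 2 B s into the quadratic
  subfield Q(s). The factor 2 from this trace and the denominator 2 of quadratic integers make up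
  the 4.\<close>

lemma (in biquadratic) integer_coordinates_first:
  assumes "algebraic_int (elem A B C D)"
  obtains e f :: int where "4 * A = of_int e" "4 * B = of_int f" "even e = even f"
    "(u * v) mod 4 \<noteq> 1 \<Longrightarrow> even e \<and> even f"
proof -
  have conj: "algebraic_int (bq_elem (\<epsilon> * s) (\<delta> * t) (\<epsilon> * \<delta> * z) A B C D)"
    if "\<epsilon> \<in> {1, -1}" "\<delta> \<in> {1, -1}" for \<epsilon> \<delta>
    using algebraic_int_conj[OF biquadratic_signs[OF biquadratic_axioms that] assms] .
  have "of_rat (2 * A) + of_rat (2 * B) * s
      = bq_elem (1 * s) (1 * t) (1 * 1 * z) A B C D + bq_elem (1 * s) (-1 * t) (1 * -1 * z) A B C D"
    by (simp add: bq_elem_def of_rat_mult algebra_simps)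
  then have 1: "algebraic_int (of_rat (2 * A) + of_rat (2 * B) * s)"
    using algebraic_int_add[OF conj[of 1 1] conj[of 1 "-1"]] by simp
  have "of_rat (2 * A) - of_rat (2 * B) * s
      = bq_elem (-1 * s) (1 * t) (-1 * 1 * z) A B C D + bq_elem (-1 * s) (-1 * t) (-1 * -1 * z) A B C D"
    by (simp add: bq_elem_def of_rat_mult algebra_simps)
  then have 2: "algebraic_int (of_rat (2 * A) - of_rat (2 * B) * s)"
    using algebraic_int_add[OF conj[of "-1" 1] conj[of "-1" "-1"]] by simp
  show ?thesis
    by (rule quadratic_integer_coordinates[OF sqf(1) squares(1) 1 2], rule that) auto
qed

text \<open>The three quadratic subfields share the rational coordinate A, and its parity ties the
  others together.\<close>

lemma (in biquadratic) integer_coordinates: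
  assumes "algebraic_int (elem A B C D)"
  obtains a b c d :: int where
    "4 * A = of_int a" "4 * B = of_int b" "4 * C = of_int c" "4 * D = of_int d"
    "even b = even a" "even c = even a" "even d = even a" "(u * v) mod 4 \<noteq> 1 \<Longrightarrow> even a"
proof -
  obtain a b where ab: "4 * A = of_int a" "4 * B = of_int b" "even a = even b"
      "(u * v) mod 4 \<noteq> 1 \<Longrightarrow> even a \<and> even b"
    by (rule integer_coordinates_first[OF assms]) blast
  have "bq_elem t s z A C B D = elem A B C D" by (simp add: bq_elem_def)
  then obtain a' c where ac: "4 * A = of_int a'" "4 * C = of_int c" "even a' = even c"
    using biquadratic.integer_coordinates_first[OF biquadratic_swap23[OF biquadratic_axioms], of A C B D] assms
    by metis
  have "bq_elem z t s A D C B = elem A B C D" by (simp add: bq_elem_def)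
  moreover have "biquadratic w v u z t s"
    using biquadratic_swap12[OF biquadratic_swap23[OF biquadratic_swap12[OF biquadratic_axioms]]] .
  ultimately obtain a'' d where ad: "4 * A = of_int a''" "4 * D = of_int d" "even a'' = even d"
    using biquadratic.integer_coordinates_first[of w v u z t s A D C B] assms by metis
  have "a' = a" "a'' = a" using ab(1) ac(1) ad(1) by simp_all
  then show ?thesis using ab ac ad that by blast
qed

text \<open>The coordinates of 1 and \<open>s\<close> in Q(4 V) turn the representation into integer
  equations. If some entry of V has odd numerators over 4, then \<open>a\<close>, \<open>b\<close>,
  \<open>c\<close>, \<open>d\<close> are all nonzero and each value of Q is at least 1; this can
  happen only for \<open>u * v\<close> congruent to 1 modulo 4. Otherwise the four vectors can be
  halved, which leaves the factor 4 in \<open>4 * e\<close>. The final implication records that, for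
  other residues, entries lying in Q(s) have integer coordinates.\<close>

lemma (in biquadratic) Z_form_representation:
  fixes F :: "nat \<Rightarrow> nat \<Rightarrow> int" and V :: "nat \<Rightarrow> complex"
  assumes Z: "Z_form r F"
    and V: "\<And>i. i < r \<Longrightarrow> algebraic_int (V i) \<and> (\<exists>A B C D. V i = elem A B C D)"
    and rep: "qf_eval r F V = of_rat e + of_rat f * s"
  shows "(u * v) mod 4 = 1 \<and> 16 * e \<ge> of_int (1 + u * v + u * w + v * w) \<or>
    (\<exists>a b c d. 4 * e = of_int (qf_eval r F a + u * v * qf_eval r F b + u * w * qf_eval r F c + v * w * qf_eval r F d)
       \<and> 4 * f = of_int (qf_polar r F a b + w * qf_polar r F c d)
       \<and> ((u * v) mod 4 \<noteq> 1 \<and> (\<forall>i<r. c i = 0 \<and> d i = 0) \<longrightarrow> (\<forall>i<r. even (a i) \<and> even (b i))))"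
proof -
  have "\<forall>i. \<exists>A B C D. i < r \<longrightarrow> V i = elem A B C D" using V by blast
  then obtain A B C D where Velem: "\<And>i. i < r \<Longrightarrow> V i = elem (A i) (B i) (C i) (D i)" by metis
  define a b c d where "a i = \<lfloor>4 * A i\<rfloor>" and "b i = \<lfloor>4 * B i\<rfloor>"
    and "c i = \<lfloor>4 * C i\<rfloor>" and "d i = \<lfloor>4 * D i\<rfloor>" for i
  have abcd_par: "(4 * A i = of_int (a i) \<and> 4 * B i = of_int (b i) \<and> 4 * C i = of_int (c i) \<and> 4 * D i = of_int (d i))
    \<and> (even (b i) = even (a i) \<and> even (c i) = even (a i) \<and> even (d i) = even (a i))
    \<and> ((u * v) mod 4 \<noteq> 1 \<longrightarrow> even (a i))" if "i < r" for i
  proof -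
    have "algebraic_int (elem (A i) (B i) (C i) (D i))" using V Velem that by metis
    then show ?thesis by (rule integer_coordinates) (simp add: a_def b_def c_def d_def)
  qed
  then have abcd: "\<And>i. i < r \<Longrightarrow> 4 * A i = of_int (a i) \<and> 4 * B i = of_int (b i) \<and> 4 * C i = of_int (c i) \<and> 4 * D i = of_int (d i)"
    and par: "\<And>i. i < r \<Longrightarrow> even (b i) = even (a i) \<and> even (c i) = even (a i) \<and> even (d i) = even (a i)"
    and par1: "\<And>i. i < r \<Longrightarrow> (u * v) mod 4 \<noteq> 1 \<Longrightarrow> even (a i)"
    by blast+
  have V4: "4 * V i = of_int (a i) + s * of_int (b i) + t * of_int (c i) + z * of_int (d i)" if "i < r" for i
  proof -
    have "4 * V i = of_rat (4 * A i) + s * of_rat (4 * B i) + t * of_rat (4 * C i) + z * of_rat (4 * D i)"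
      using Velem[OF that] by (simp add: bq_elem_def of_rat_mult algebra_simps)
    then show ?thesis using abcd[OF that] by simp
  qed
  let ?Q = "qf_eval r F" and ?P = "qf_polar r F"
  let ?E = "?Q a + u * v * ?Q b + u * w * ?Q c + v * w * ?Q d"
  have "elem (16 * e) (16 * f) 0 0 = 4\<^sup>2 * qf_eval r F V"
    unfolding rep by (simp add: bq_elem_def of_rat_mult algebra_simps)
  also have "\<dots> = qf_eval r F (\<lambda>i. 4 * V i)" by (simp add: qf_eval_scale)
  also have "\<dots> = qf_eval r F (\<lambda>i. of_int (a i) + s * of_int (b i) + t * of_int (c i) + z * of_int (d i))"
    by (rule qf_eval_cong) (rule V4)
  also have "\<dots> = elem (of_int ?E) (of_int (?P a b + w * ?P c d))
      (of_int (?P a c + v * ?P b d)) (of_int (?P a d + u * ?P b c))"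
    unfolding qf_eval_lincomb4 qf_eval_of_int qf_polar_of_int squares products bq_elem_def of_rat_of_int_eq
    by (simp add: algebra_simps)
  finally have ef: "16 * e = of_int ?E" "16 * f = of_int (?P a b + w * ?P c d)"
    unfolding elem_eq_iff by auto
  show ?thesis
  proof (cases "\<exists>i<r. odd (a i)")
    case True
    then obtain i where i: "i < r" "odd (a i)" by blast
    then have nz: "a i \<noteq> 0" "b i \<noteq> 0" "c i \<noteq> 0" "d i \<noteq> 0" using par[OF i(1)] by auto
    have "1 + u * v + u * w + v * w \<le> ?E"
      using qf_eval_int_pos[OF Z i(1), of a] mult_left_mono[of 1 "?Q b" "u * v"]
        mult_left_mono[of 1 "?Q c" "u * w"] mult_left_mono[of 1 "?Q d" "v * w"]
        qf_eval_int_pos[OF Z i(1), of b] qf_eval_int_pos[OF Z i(1), of c]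
        qf_eval_int_pos[OF Z i(1), of d] nz gt1 by simp
    then have "16 * e \<ge> of_int (1 + u * v + u * w + v * w)" unfolding ef(1) of_int_le_iff .
    then show ?thesis using par1 i by blast
  next
    case False
    define half where "half x i = x i div (2 :: int)" for x :: "nat \<Rightarrow> int" and i
    have two: "x i = 2 * half x i" if "x \<in> {a, b, c, d}" "i < r" for x i
      using False par[OF that(2)] that by (auto simp: half_def)
    have Qh: "?Q x = 4 * ?Q (half x)" if "x \<in> {a, b, c, d}" for x
    proof -
      have "?Q x = ?Q (\<lambda>i. 2 * half x i)" using two[OF that] by (rule qf_eval_cong)
      then show ?thesis by (simp add: qf_eval_scale)
    qed
    have Ph: "?P x y = 4 * ?P (half x) (half y)" if "x \<in> {a, b, c, d}" "y \<in> {a, b, c, d}" for x y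
    proof -
      have "?P x y = ?P (\<lambda>i. 2 * half x i) (\<lambda>i. 2 * half y i)"
        using two[OF that(1)] two[OF that(2)] unfolding qf_polar_def by (auto intro!: sum.cong)
      then show ?thesis by (simp add: qf_polar_scale)
    qed
    have "4 * e = of_int (?Q (half a) + u * v * ?Q (half b) + u * w * ?Q (half c) + v * w * ?Q (half d))"
      using ef(1) Qh[of a] Qh[of b] Qh[of c] Qh[of d] by (simp add: algebra_simps)
    moreover have "4 * f = of_int (?P (half a) (half b) + w * ?P (half c) (half d))"
      using ef(2) Ph[of a b] Ph[of c d] by (simp add: algebra_simps)
    moreover have "even (half a i) \<and> even (half b i)"
      if m: "(u * v) mod 4 \<noteq> 1" and cd: "\<forall>i<r. half c i = 0 \<and> half d i = 0" and i: "i < r" for i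
    proof -
      have "c i = 0" "d i = 0" using two[of c i] two[of d i] cd i by auto
      then have CD: "C i = 0" "D i = 0" using abcd[OF i] by auto
      have int: "algebraic_int (elem (A i) (B i) 0 0)" using V[OF i] Velem[OF i] CD by metis
      have "biquadratic u v w (-1 * s) (1 * t) (-1 * 1 * z)"
        by (rule biquadratic_signs[OF biquadratic_axioms]) auto
      from algebraic_int_conj[OF this int]
      have "algebraic_int (of_rat (A i) - of_rat (B i) * s)" by (simp add: bq_elem_def)
      moreover have "algebraic_int (of_rat (A i) + of_rat (B i) * s)"
        using int by (simp add: bq_elem_def)
      ultimately obtain e' f' where *: "2 * A i = of_int e'" "2 * B i = of_int f'" "even e' \<and> even f'"
        using quadratic_integer_coordinates[OF sqf(1) squares(1)] m by metis
      have "4 * A i = of_int (2 * half a i)" "4 * B i = of_int (2 * half b i)"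
        using abcd[OF i] two[of a i] two[of b i] i by auto
      then have "of_int (half a i) = (of_int e' :: rat)" "of_int (half b i) = (of_int f' :: rat)"
        using *(1,2) by auto
      then show ?thesis using *(3) by simp
    qed
    ultimately show ?thesis by blast
  qed
qed


section \<open>Bounds that universality imposes on a biquadratic field\<close>

definition bq_field :: "complex \<Rightarrow> complex \<Rightarrow> complex \<Rightarrow> complex set" where
  "bq_field s t z = {bq_elem s t z A B C D | A B C D. True}"

lemma bq_field_swap:
  shows "bq_field t s z = bq_field s t z" "bq_field s z t = bq_field s t z"
proof -
  have *: "bq_elem t s z A C B D = bq_elem s t z A B C D"
       "bq_elem s z t A B D C = bq_elem s t z A B C D" for A B C D s t z
    by (simp_all add: bq_elem_def)
  show "bq_field t s z = bq_field s t z" "bq_field s z t = bq_field s t z"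
    unfolding bq_field_def using * by (metis (no_types, lifting))+
qed

context biquadratic
begin

text \<open>Every embedding sends \<open>s\<close> to a real number of absolute value sqrt(u v),
  which is below \<open>k\<close>. Writing \<open>of_int n * \<alpha>\<close> covers k + s and (k +
  s)/2 at once.\<close>

lemma totally_positive_shift:
  assumes k: "k > 0" "k\<^sup>2 > u * v" and n: "n > 0"
    and \<alpha>: "of_int n * \<alpha> = of_int k + s" and int: "algebraic_int \<alpha>"
  shows "totally_positive (bq_field s t z) \<alpha>"
    and "\<alpha> = of_rat (of_int k / of_int n) + of_rat (1 / of_int n) * s"
proof -
  show \<alpha>': "\<alpha> = of_rat (of_int k / of_int n) + of_rat (1 / of_int n) * s"
    using \<alpha> n by (simp add: of_rat_divide field_simps)
  let ?K = "bq_field s t z"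
  have elemI: "elem A B C D \<in> ?K" for A B C D by (auto simp: bq_field_def)
  have ints: "of_int j \<in> ?K" for j using elemI[of "of_int j" 0 0 0] by (simp add: bq_elem_def)
  have s: "s \<in> ?K" using elemI[of 0 1 0 0] by (simp add: bq_elem_def)
  have \<alpha>K: "\<alpha> \<in> ?K"
    using elemI[of "of_int k / of_int n" "1 / of_int n" 0 0] \<alpha>' by (simp add: bq_elem_def)
  have "\<sigma> \<alpha> \<in> \<real> \<and> Re (\<sigma> \<alpha>) > 0" if \<sigma>: "embedding ?K \<sigma>" for \<sigma>
  proof -
    have hom: "\<And>x y. x \<in> ?K \<Longrightarrow> y \<in> ?K \<Longrightarrow> \<sigma> (x + y) = \<sigma> x + \<sigma> y \<and> \<sigma> (x * y) = \<sigma> x * \<sigma> y"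
      using \<sigma> unfolding embedding_def by blast
    have int: "\<sigma> (of_int j) = of_int j" for j by (rule embedding_of_int[OF \<sigma> ints])
    define y :: real where "y = sqrt (of_int (u * v))"
    have "real_of_int (u * v) \<ge> 0" using gt1(1) by (simp only: of_int_0_le_iff)
    then have y2: "y\<^sup>2 = of_int (u * v)" and y0: "y \<ge> 0"
      unfolding y_def by (rule real_sqrt_pow2, simp only: real_sqrt_ge_0_iff)
    have "(\<sigma> s)\<^sup>2 = \<sigma> (s\<^sup>2)" using hom[OF s s] by (simp add: power2_eq_square)
    also have "\<dots> = of_int (u * v)" unfolding squares by (rule int)
    also have "\<dots> = (of_real y)\<^sup>2" unfolding of_real_power[symmetric] y2 by simp
    finally have "\<sigma> s = of_real y \<or> \<sigma> s = of_real (- y)"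
      by (simp add: power2_eq_iff)
    then obtain y' where y': "\<sigma> s = of_real y'" "\<bar>y'\<bar> = y"
      using y0 by (metis abs_minus_cancel abs_of_nonneg)
    have "y < of_int k" unfolding y_def
      using k by (intro real_less_lsqrt) (auto simp flip: of_int_power of_int_mult)
    then have pos: "of_int k + y' > 0" using y'(2) by linarith
    have "of_int n * \<sigma> \<alpha> = of_int k + \<sigma> s"
      using hom[OF ints \<alpha>K, of n] hom[OF ints s, of k] \<alpha> int by simp
    then have "\<sigma> \<alpha> = of_real ((of_int k + y') / of_int n)"
      using n y'(1) by (simp add: field_simps)
    then show ?thesis using pos n by simp
  qed
  then show "totally_positive ?K \<alpha>"
    unfolding totally_positive_def ring_of_integers_def using \<alpha>K int by blast
qed

lemma universal_representation:
  assumes Z: "Z_form r F" and univ: "universal_over (bq_field s t z) r F"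
    and k: "k > 0" "k\<^sup>2 > u * v" and n: "n > 0"
    and \<alpha>: "of_int n * \<alpha> = of_int k + s" and int: "algebraic_int \<alpha>"
  shows "(u * v) mod 4 = 1 \<and> 16 * (of_int k / of_int n :: rat) \<ge> of_int (1 + u * v + u * w + v * w) \<or>
    (\<exists>a b c d. 4 * (of_int k / of_int n :: rat)
         = of_int (qf_eval r F a + u * v * qf_eval r F b + u * w * qf_eval r F c + v * w * qf_eval r F d)
       \<and> 4 * (1 / of_int n :: rat) = of_int (qf_polar r F a b + w * qf_polar r F c d)
       \<and> ((u * v) mod 4 \<noteq> 1 \<and> (\<forall>i<r. c i = 0 \<and> d i = 0) \<longrightarrow> (\<forall>i<r. even (a i) \<and> even (b i))))"
proof -
  obtain V where V: "\<forall>i<r. V i \<in> ring_of_integers (bq_field s t z)" and rep: "qf_eval r F V = \<alpha>"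
    using univ totally_positive_shift(1)[OF k n \<alpha> int] unfolding universal_over_def by blast
  show ?thesis
  proof (rule Z_form_representation[OF Z])
    show "algebraic_int (V i) \<and> (\<exists>A B C D. V i = elem A B C D)" if "i < r" for i
      using V that by (auto simp: ring_of_integers_def bq_field_def)
    show "qf_eval r F V = of_rat (of_int k / of_int n) + of_rat (1 / of_int n) * s"
      using rep totally_positive_shift(2)[OF k n \<alpha> int] by simp
  qed
qed

text \<open>The \<open>s\<close>-coordinate 1 of k + s becomes
  \<open>4 = ?P a b + w * ?P c d\<close>. If \<open>c\<close> and \<open>d\<close> both vanish,
  \<open>a\<close> and \<open>b\<close> are even and nonzero, so Q is at least 4 on each. If exactly
  one vanishes, \<open>?P a b = 4\<close> and Cauchy-Schwarz bound the share of \<open>a\<close> and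
  \<open>b\<close>. If neither does, \<open>c\<close> and \<open>d\<close> alone give the
  bound.\<close>

lemma universal_bound_not_1_mod_4:
  assumes Z: "Z_form r F" and univ: "universal_over (bq_field s t z) r F"
    and k: "k > 0" "k\<^sup>2 > u * v" and m: "(u * v) mod 4 \<noteq> 1"
  shows "4 * k \<ge> 4 + 4 * (u * v) \<or> 4 * k \<ge> 4 + u * v + min (u * w) (v * w) \<or> 4 * k \<ge> u * w + v * w"
proof -
  let ?Q = "qf_eval r F" and ?P = "qf_polar r F"
  have "s\<^sup>2 = of_int (u * v)" by (rule squares)
  then have "poly [:- of_int (u * v), 0, 1:] s = 0" by (simp add: power2_eq_square)
  then have "algebraic_int s"
    by (rule algebraic_int.intros[rotated 2]) (auto simp: coeff_pCons split: nat.splits)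
  then have int: "algebraic_int (of_int k + s)" by (intro algebraic_int_add) auto
  have "(1 :: int) > 0" "of_int 1 * (of_int k + s) = of_int k + s" by simp_all
  from universal_representation[OF Z univ k this int] obtain a b c d where
    1: "4 * (of_int k / of_int 1 :: rat) = of_int (?Q a + u * v * ?Q b + u * w * ?Q c + v * w * ?Q d)"
    and 2: "4 * (1 / of_int 1 :: rat) = of_int (?P a b + w * ?P c d)"
    and ev: "\<forall>i<r. c i = 0 \<and> d i = 0 \<Longrightarrow> \<forall>i<r. even (a i) \<and> even (b i)"
    using m by blast
  have "of_int (4 * k) = (of_int (?Q a + u * v * ?Q b + u * w * ?Q c + v * w * ?Q d) :: rat)"
    using 1 by simp
  then have k4: "4 * k = ?Q a + u * v * ?Q b + u * w * ?Q c + v * w * ?Q d" by (simp only: of_int_eq_iff)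
  have "of_int 4 = (of_int (?P a b + w * ?P c d) :: rat)" using 2 by simp
  then have P4: "4 = ?P a b + w * ?P c d" by (simp only: of_int_eq_iff)
  have nn: "?Q a \<ge> 0" "?Q b \<ge> 0" "?Q c \<ge> 0" "?Q d \<ge> 0" by (rule qf_eval_int_nonneg[OF Z])+
  have nn': "u * v * ?Q b \<ge> 0" "u * w * ?Q c \<ge> 0" "v * w * ?Q d \<ge> 0"
    using nn gt1 by simp_all
  have c: "u * w * ?Q c \<ge> u * w" if "i < r" "c i \<noteq> 0" for i
    using mult_left_mono[of 1 "?Q c" "u * w"] qf_eval_int_pos[OF Z that(1), of c] that(2) gt1 by simp
  have d: "v * w * ?Q d \<ge> v * w" if "i < r" "d i \<noteq> 0" for i
    using mult_left_mono[of 1 "?Q d" "v * w"] qf_eval_int_pos[OF Z that(1), of d] that(2) gt1 by simp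
  have ab: "?Q a + u * v * ?Q b \<ge> 4 + u * v" if "?P c d = 0"
  proof -
    have "4 \<le> ?Q a * ?Q b" using qf_polar_square_le[OF Z, of a b] P4 that by simp
    define X Y where "X = ?Q a" and "Y = ?Q b"
    have XY: "X \<ge> 0" "Y \<ge> 0" "4 \<le> X * Y" using nn \<open>4 \<le> ?Q a * ?Q b\<close> by (auto simp: X_def Y_def)
    have "X \<noteq> 0" "Y \<noteq> 0" using XY by auto
    then have "X \<ge> 1" "Y \<ge> 1" using XY by auto
    \<comment> \<open>The claim is this inequality plus
      \<open>(u * v - 2) * (Y - 1) \<ge> 0\<close>, that is, the extremal case
      \<open>u * v = 2\<close> followed by monotonicity.\<close>
    have "X + 2 * Y \<ge> 6"
    proof (cases "Y \<ge> 3")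
      case True
      show ?thesis
      proof (cases "X = 1")
        case True then show ?thesis using XY by simp
      qed (use \<open>X \<ge> 1\<close> \<open>Y \<ge> 3\<close> in simp)
    next
      case False
      then have "Y = 1 \<or> Y = 2" using \<open>Y \<ge> 1\<close> by auto
      then show ?thesis using XY by auto
    qed
    moreover have "(u * v - 2) * (Y - 1) \<ge> 0" using gt1(1) \<open>Y \<ge> 1\<close> by simp
    ultimately show ?thesis unfolding X_def[symmetric] Y_def[symmetric] by (simp add: algebra_simps)
  qed
  consider (none) "\<forall>i<r. c i = 0 \<and> d i = 0" | (c) i where "i < r" "c i \<noteq> 0" "\<forall>i<r. d i = 0"
    | (d) i where "i < r" "d i \<noteq> 0" "\<forall>i<r. c i = 0" | (cd) i j where "i < r" "c i \<noteq> 0" "j < r" "d j \<noteq> 0"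
    by blast
  then show ?thesis
  proof cases
    case none
    then have "?P c d = 0" by (intro qf_polar_zero) blast
    then have "?P a b \<noteq> 0" "?P b a \<noteq> 0" using P4 by (auto simp: qf_polar_commute)
    then obtain i j where ij: "i < r" "a i \<noteq> 0" "j < r" "b j \<noteq> 0"
      using qf_polar_zero[of r a F b] qf_polar_zero[of r b F a] by blast
    have four: "?Q x \<ge> 4" if "\<forall>i<r. even (x i)" "i < r" "x i \<noteq> 0" for x :: "nat \<Rightarrow> int" and i
    proof -
      have "?Q x = ?Q (\<lambda>i. 2 * (x i div 2))" using that(1) by (intro qf_eval_cong) simp
      moreover have "?Q (\<lambda>i. x i div 2) \<ge> 1"
        using that dvd_div_eq_0_iff[of 2 "x i"] by (intro qf_eval_int_pos[OF Z that(2)]) auto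
      ultimately show ?thesis by (simp add: qf_eval_scale)
    qed
    have "?Q a \<ge> 4" "?Q b \<ge> 4" using four ev[OF none] ij by blast+
    then show ?thesis using mult_left_mono[of 4 "?Q b" "u * v"] gt1(1) k4 nn' by simp
  next
    case c
    then have "?P c d = 0" using qf_polar_zero[of r d F c] by (simp add: qf_polar_commute)
    then show ?thesis using ab c(1,2) \<open>\<And>i. i < r \<Longrightarrow> c i \<noteq> 0 \<Longrightarrow> u * w * ?Q c \<ge> u * w\<close> k4 nn' by fastforce
  next
    case d
    then have "?P c d = 0" by (intro qf_polar_zero) blast
    then show ?thesis using ab d(1,2) \<open>\<And>i. i < r \<Longrightarrow> d i \<noteq> 0 \<Longrightarrow> v * w * ?Q d \<ge> v * w\<close> k4 nn' by fastforce
  next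
    case cd
    then show ?thesis
      using \<open>\<And>i. i < r \<Longrightarrow> c i \<noteq> 0 \<Longrightarrow> u * w * ?Q c \<ge> u * w\<close>
        \<open>\<And>i. i < r \<Longrightarrow> d i \<noteq> 0 \<Longrightarrow> v * w * ?Q d \<ge> v * w\<close> k4 nn nn' by fastforce
  qed
qed

text \<open>For these residues and odd \<open>k\<close> already (k + s)/2 is integral, with half the
  trace. The first bound is the case of odd numerators; otherwise
  \<open>2 = ?P a b + w * ?P c d\<close>, so \<open>a\<close>, \<open>b\<close> are both nonzero or
  \<open>c\<close>, \<open>d\<close> are.\<close>

lemma universal_bound_1_mod_4:
  assumes Z: "Z_form r F" and univ: "universal_over (bq_field s t z) r F"
    and k: "k > 0" "k\<^sup>2 > u * v" "odd k" and m: "(u * v) mod 4 = 1"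
  shows "8 * k \<ge> 1 + u * v + u * w + v * w \<or> 2 * k \<ge> 1 + u * v \<or> 2 * k \<ge> u * w + v * w"
proof -
  let ?Q = "qf_eval r F" and ?P = "qf_polar r F"
  obtain j where j: "k = 2 * j + 1" using k(3) by (elim oddE)
  obtain l where l: "u * v = 4 * l + 1" using m by (metis mult_div_mod_eq)
  define \<alpha> where "\<alpha> = (of_int k + s) / 2"
  \<comment> \<open>The constant term \<open>j\<^sup>2 + j - l\<close> is the norm
    \<open>(k\<^sup>2 - u * v) / 4\<close> of \<open>\<alpha>\<close>.\<close>
  have "\<alpha>\<^sup>2 - of_int k * \<alpha> + of_int (j\<^sup>2 + j - l) = (s\<^sup>2 - of_int (k\<^sup>2) + 4 * of_int (j\<^sup>2 + j - l)) / 4"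
    by (simp add: \<alpha>_def field_simps power2_eq_square)
  also have "\<dots> = of_int (u * v - k\<^sup>2 + 4 * (j\<^sup>2 + j - l)) / 4" unfolding squares by simp
  also have "u * v - k\<^sup>2 + 4 * (j\<^sup>2 + j - l) = 0" unfolding j l by (simp add: power2_eq_square algebra_simps)
  finally have "poly [:of_int (j\<^sup>2 + j - l), - of_int k, 1:] \<alpha> = 0"
    by (simp add: power2_eq_square algebra_simps)
  then have int: "algebraic_int \<alpha>"
    by (rule algebraic_int.intros[rotated 2]) (auto simp: coeff_pCons split: nat.splits)
  have \<alpha>: "of_int 2 * \<alpha> = of_int k + s" by (simp add: \<alpha>_def)
  have two: "2 > (0::int)" by simp
  from universal_representation[OF Z univ k(1,2) two \<alpha> int] show ?thesis
  proof (elim disjE conjE exE)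
    assume "of_int (1 + u * v + u * w + v * w) \<le> 16 * (of_int k / of_int 2 :: rat)"
    then have "of_int (1 + u * v + u * w + v * w) \<le> (of_int (8 * k) :: rat)" by simp
    then have "1 + u * v + u * w + v * w \<le> 8 * k" by (simp only: of_int_le_iff)
    then show ?thesis by blast
  next
    fix a b c d
    assume 1: "4 * (of_int k / of_int 2 :: rat) = of_int (?Q a + u * v * ?Q b + u * w * ?Q c + v * w * ?Q d)"
      and 2: "4 * (1 / of_int 2 :: rat) = of_int (?P a b + w * ?P c d)"
    have "of_int (2 * k) = (of_int (?Q a + u * v * ?Q b + u * w * ?Q c + v * w * ?Q d) :: rat)"
      using 1 by simp
    then have k2: "2 * k = ?Q a + u * v * ?Q b + u * w * ?Q c + v * w * ?Q d" by (simp only: of_int_eq_iff)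
    have "of_int 2 = (of_int (?P a b + w * ?P c d) :: rat)" using 2 by simp
    then have P2: "2 = ?P a b + w * ?P c d" by (simp only: of_int_eq_iff)
    have nn: "?Q a \<ge> 0" "?Q b \<ge> 0" "?Q c \<ge> 0" "?Q d \<ge> 0" by (rule qf_eval_int_nonneg[OF Z])+
    have nn': "u * v * ?Q b \<ge> 0" "u * w * ?Q c \<ge> 0" "v * w * ?Q d \<ge> 0"
      using nn gt1 by simp_all
    have pos: "?Q x \<ge> 1 \<and> ?Q y \<ge> 1" if "?P x y \<noteq> 0" for x y :: "nat \<Rightarrow> int"
    proof -
      have "(?P x y)\<^sup>2 > 0" using that by simp
      then have "?Q x * ?Q y > 0" using qf_polar_square_le[OF Z, of x y] by linarith
      then have "?Q x > 0 \<and> ?Q y > 0"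
        using qf_eval_int_nonneg[OF Z, of x] by (auto simp: zero_less_mult_iff)
      then show ?thesis by simp
    qed
    have "?P a b \<noteq> 0 \<or> ?P c d \<noteq> 0" using P2 by auto
    then show ?thesis
    proof
      assume "?P a b \<noteq> 0"
      then have 1: "1 \<le> ?Q a" "1 \<le> ?Q b" using pos[of a b] by simp_all
      have "u * v * 1 \<le> u * v * ?Q b" by (rule mult_left_mono) (use 1 gt1 in simp_all)
      then show ?thesis using 1 k2 nn nn' by linarith
    next
      assume "?P c d \<noteq> 0"
      then have 1: "1 \<le> ?Q c" "1 \<le> ?Q d" using pos[of c d] by simp_all
      have "u * w * 1 \<le> u * w * ?Q c" "v * w * 1 \<le> v * w * ?Q d"
        by (rule mult_left_mono; use 1 gt1 in simp)+
      then show ?thesis using k2 nn nn' by linarith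
    qed
  qed
qed

end


section \<open>Minimal shifts and the contradiction in biquadratic fields\<close>

lemma ceiling_sqrt:
  fixes m :: int assumes "m > 0"
  obtains k where "k > 0" "k\<^sup>2 > m" "(k - 1)\<^sup>2 \<le> m"
proof -
  define y where "y = sqrt (of_int m)"
  define k where "k = \<lfloor>y\<rfloor> + 1"
  have y: "y \<ge> 0" "y\<^sup>2 = of_int m" using assms by (auto simp: y_def)
  have k: "of_int (k - 1) \<le> y" "y < of_int k" "k \<ge> 1" using y(1) by (auto simp: k_def)
  have "y\<^sup>2 < (of_int k)\<^sup>2" using k y by (intro power_strict_mono) auto
  then have "of_int m < (of_int (k\<^sup>2) :: real)" using y(2) by simp
  then have "m < k\<^sup>2" by (simp only: of_int_less_iff)
  moreover have "(of_int (k - 1))\<^sup>2 \<le> y\<^sup>2" using k y by (intro power_mono) auto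
  then have "of_int ((k - 1)\<^sup>2) \<le> (of_int m :: real)" using y(2) by simp
  then have "(k - 1)\<^sup>2 \<le> m" by (simp only: of_int_le_iff)
  ultimately show ?thesis using that[of k] k(3) by simp
qed

lemma odd_ceiling_sqrt:
  fixes m :: int assumes "m > 0"
  obtains k where "k > 0" "k\<^sup>2 > m" "odd k" "(k - 2)\<^sup>2 \<le> m"
proof -
  obtain k where k: "k > 0" "k\<^sup>2 > m" "(k - 1)\<^sup>2 \<le> m" using ceiling_sqrt[OF assms] .
  show ?thesis
  proof (cases "odd k")
    case True
    have "(k - 2)\<^sup>2 \<le> m"
    proof (cases "k = 1")
      case False
      then have "(k - 2)\<^sup>2 \<le> (k - 1)\<^sup>2" using True k(1) by (intro power_mono) (auto elim: oddE)
      then show ?thesis using k(3) by simp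
    qed (use assms in simp)
    then show ?thesis using that True k by blast
  next
    case False
    have "k\<^sup>2 \<le> (k + 1)\<^sup>2" using k(1) by (intro power_mono) auto
    then have "m < (k + 1)\<^sup>2" using k(2) by linarith
    then show ?thesis using False k by (intro that[of "k + 1"]) auto
  qed
qed

lemma squarefree_ne_9: "squarefree (m :: int) \<Longrightarrow> m \<noteq> 9"
  using squarefreeD[of m 3] by auto

text \<open>Sorting makes \<open>p = u * v\<close> the smallest radicand. The bounds demand a
  \<open>k\<close> of the order of \<open>p\<close>, whereas \<open>k\<close> can be taken within 2
  of the square root of \<open>p\<close>. This leaves a few small values, which are excluded by
  hand; 9, for instance, is not squarefree.\<close>

lemma (in biquadratic) not_universal_sorted:
  assumes Z: "Z_form r F" and less: "u < v" "v < w"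
  shows "\<not> universal_over (bq_field s t z) r F"
proof
  assume univ: "universal_over (bq_field s t z) r F"
  define p q m where "p = u * v" and "q = u * w" and "m = v * w"
  have "u * (v + 1) \<le> u * w" "(u + 1) * w \<le> v * w" using less pos by simp_all
  then have pqm: "q \<ge> p + 1" "m \<ge> q + 1" using pos by (auto simp: p_def q_def m_def algebra_simps)
  have p1: "p > 1" using gt1 by (simp add: p_def)
  show False
  proof (cases "p = 5")
    case False
    show False
    proof (cases "p mod 4 = 1")
      case True
      then have p6: "p \<ge> 6" using p1 False by presburger
      obtain k where k: "k > 0" "k\<^sup>2 > p" "odd k" "(k - 2)\<^sup>2 \<le> p" using odd_ceiling_sqrt[of p] p1 by auto
      define j where "j = k - 2"
      have jj: "j * j \<le> p" using k(4) by (simp add: j_def power2_eq_square)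
      have j4: "j \<ge> 4 \<Longrightarrow> 4 * j \<le> j * j" by simp
      have "8 * k \<ge> 1 + p + q + m \<or> 2 * k \<ge> 1 + p \<or> 2 * k \<ge> q + m"
        using universal_bound_1_mod_4[OF Z univ, of k] k True unfolding p_def q_def m_def by simp
      then have "8 * j + 12 \<ge> 3 * p \<or> 2 * j + 3 \<ge> p" using pqm p1 by (auto simp: j_def)
      moreover from this have "j \<le> 3" using j4 jj by linarith
      ultimately have "p \<le> 12" by linarith
      then have "p = 9" using p6 True by presburger
      then show False using squarefree_ne_9[OF sqf(1)] by (simp add: p_def)
    next
      case m: False
      obtain k where k: "k > 0" "k\<^sup>2 > p" "(k - 1)\<^sup>2 \<le> p" using ceiling_sqrt[of p] p1 by auto
      define j where "j = k - 1"
      have jj: "j * j \<le> p" using k(3) by (simp add: j_def power2_eq_square)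
      have j0: "j \<ge> 0" using k(1) by (simp add: j_def)
      have j3: "j \<ge> 3 \<Longrightarrow> 3 * j \<le> j * j" by simp
      have "4 * k \<ge> 4 + 4 * p \<or> 4 * k \<ge> 4 + p + min q m \<or> 4 * k \<ge> q + m"
        using universal_bound_not_1_mod_4[OF Z univ, of k] k m unfolding p_def q_def m_def by simp
      then have bounds: "j \<ge> p \<or> 4 * j \<ge> 2 * p + 1 \<or> (4 * j + 4 \<ge> q + m \<and> 4 * j + 1 \<ge> 2 * p)"
        using pqm by (auto simp: j_def)
      then have "4 * j + 1 \<ge> 2 * p" using p1 by linarith
      then have "j \<le> 2" using j3 jj by linarith
      then have "j = 1 \<or> j = 2" using j0 \<open>4 * j + 1 \<ge> 2 * p\<close> p1 by auto
      then have small: "p \<le> 4" "4 * j + 4 \<ge> q + m" using bounds jj \<open>4 * j + 1 \<ge> 2 * p\<close> p1 by auto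
      have "u = 1"
      proof (rule ccontr)
        assume "u \<noteq> 1"
        then have "2 * 3 \<le> u * v" using pos less by (intro mult_mono) auto
        then show False using small(1) by (simp add: p_def)
      qed
      have "q + m = (1 + v) * w" by (simp add: q_def m_def \<open>u = 1\<close> algebra_simps)
      moreover have "(1 + v) * (v + 1) \<le> (1 + v) * w" using less pos by (intro mult_left_mono) auto
      moreover have "p = v" by (simp add: p_def \<open>u = 1\<close>)
      moreover have "(1 + v) * 3 \<le> (1 + v) * (v + 1)" using \<open>p = v\<close> p1 by (intro mult_left_mono) auto
      ultimately have "3 * p + 3 \<le> 4 * j + 4" using small(2) by simp
      then have "j = 2" "p \<le> 3" using \<open>j = 1 \<or> j = 2\<close> p1 by auto
      then show False using jj by simp
    qed
  next
    case True
    \<comment> \<open>For p = 5 the least odd \<open>k\<close> is 3 and 2 * 3 = 1 + 5 meets the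
      bound: (3 + sqrt 5)/2 is the square of (1 + sqrt 5)/2. The argument is therefore run with the
      next radicand \<open>u * w = w\<close>.\<close>
    have "u = 1"
    proof (rule ccontr)
      assume "u \<noteq> 1"
      then have "2 * 3 \<le> u * v" using pos less by (intro mult_mono) auto
      then show False using True by (simp add: p_def)
    qed
    then have uv: "u = 1" "v = 5" using True by (auto simp: p_def)
    have w6: "w \<ge> 6" using less uv by simp
    interpret swapped: biquadratic u w v t s z by (rule biquadratic_swap23[OF biquadratic_axioms])
    have univ': "universal_over (bq_field t s z) r F" using univ bq_field_swap(1) by metis
    show False
    proof (cases "w mod 4 = 1")
      case True
      obtain k where k: "k > 0" "k\<^sup>2 > w" "odd k" "(k - 2)\<^sup>2 \<le> w" using odd_ceiling_sqrt[of w] w6 by auto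
      define j where "j = k - 2"
      have jj: "j * j \<le> w" using k(4) by (simp add: j_def power2_eq_square)
      have j4: "j \<ge> 4 \<Longrightarrow> 4 * j \<le> j * j" by simp
      have "8 * k \<ge> 6 + 6 * w \<or> 2 * k \<ge> 1 + w \<or> 2 * k \<ge> 5 + 5 * w"
        using swapped.universal_bound_1_mod_4[OF Z univ', of k] k True uv by (simp add: algebra_simps)
      then have "2 * j + 3 \<ge> w \<or> 8 * j + 10 \<ge> 6 * w" using w6 by (auto simp: j_def)
      moreover from this have "j \<le> 3" using j4 jj by linarith
      ultimately have "w \<le> 9" by linarith
      then have "w = 9" using w6 True by presburger
      then show False using squarefree_ne_9[OF sqf(2)] uv by simp
    next
      case m: False
      obtain k where k: "k > 0" "k\<^sup>2 > w" "(k - 1)\<^sup>2 \<le> w" using ceiling_sqrt[of w] w6 by auto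
      define j where "j = k - 1"
      have jj: "j * j \<le> w" using k(3) by (simp add: j_def power2_eq_square)
      \<comment> \<open>The middle bound reads \<open>4 * j \<ge> w + 5\<close>, which
        \<open>w \<ge> j * j\<close> and this square contradict by a margin of 1.\<close>
      have "(j - 2) * (j - 2) \<ge> 0" by simp
      then have j2: "j * j \<ge> 4 * j - 4" by (simp add: algebra_simps)
      have "4 * k \<ge> 4 + 4 * w \<or> 4 * k \<ge> 4 + w + min 5 (5 * w) \<or> 4 * k \<ge> 5 + 5 * w"
        using swapped.universal_bound_not_1_mod_4[OF Z univ', of k] k m uv by (simp add: mult.commute)
      then show False using jj j2 w6 by (auto simp: j_def)
    qed
  qed
qed

text \<open>With u = gcd p q the radicand p q equals u^2 v w, so its square root is u times that of
  v w. The latter is squarefree because v and w are coprime, and exceeds 1 because p and q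
  differ.\<close>

lemma biquadratic_parameters:
  assumes "real_biquadratic_field K"
  obtains u v w s t z where "biquadratic u v w s t z" "K = bq_field s t z"
proof -
  obtain p q :: int where pq: "p > 1" "q > 1" "p \<noteq> q" "squarefree p" "squarefree q"
    and K: "K = {of_rat a + of_rat b * complex_of_real (sqrt (of_int p))
             + of_rat c * complex_of_real (sqrt (of_int q))
             + of_rat d * complex_of_real (sqrt (of_int (p * q))) | a b c d. True}"
    using assms unfolding real_biquadratic_field_def by blast
  define u v w where "u = gcd p q" and "v = p div u" and "w = q div u"
  have u: "u > 0" using pq by (simp add: u_def)
  have p: "p = u * v" and q: "q = u * w" by (simp_all add: u_def v_def w_def)
  have "v > 0 \<and> w > 0"
    using zero_less_mult_pos[of u v] zero_less_mult_pos[of u w] pq(1,2) u p q by linarith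
  then have vw: "v > 0" "w > 0" by simp_all
  have cop: "coprime v w" using pq(1) by (simp add: u_def v_def w_def div_gcd_coprime)
  have "v \<noteq> w" using pq(3) p q by auto
  have "v * w \<noteq> 1"
    using \<open>v \<noteq> w\<close> vw by (auto simp: zmult_eq_1_iff)
  moreover have "v * w > 0" using vw by simp
  ultimately have vw1: "v * w > 1" by linarith
  have sqvw: "squarefree (v * w)"
    using pq(4,5) cop unfolding p q by (auto intro!: squarefree_mult_coprime dest: squarefree_multD)
  define s t z :: complex where "s = of_real (sqrt (of_int (u * v)))"
    and "t = of_real (sqrt (of_int (u * w)))" and "z = of_real (sqrt (of_int (v * w)))"
  have sqr: "(complex_of_real (sqrt (of_int n)))\<^sup>2 = of_int n" if "n > 0" for n
    using that by (simp flip: of_real_power)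
  have "u * v > 0" "u * w > 0" "v * w > 0" using u vw by simp_all
  note squares = this[THEN sqr]
  have prod: "complex_of_real (sqrt (of_int (a * b))) * complex_of_real (sqrt (of_int (a * c)))
      = of_int a * complex_of_real (sqrt (of_int (b * c)))" if "a > 0" for a b c
  proof -
    have "sqrt (of_int (a * b)) * sqrt (of_int (a * c))
        = (sqrt (of_int a) * sqrt (of_int a)) * sqrt (of_int (b * c))"
      by (simp only: of_int_mult real_sqrt_mult mult_ac)
    also have "\<dots> = of_int a * sqrt (of_int (b * c))" using that by simp
    finally show ?thesis by (metis of_real_mult of_real_of_int_eq)
  qed
  have bq: "biquadratic u v w s t z"
  proof
    show "s * t = of_int u * z" unfolding s_def t_def z_def by (rule prod[OF u])
    show "s * z = of_int v * t"
      using prod[OF vw(1), of u w] unfolding s_def t_def z_def by (simp only: mult.commute[of v u])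
    show "t * z = of_int w * s"
      using prod[OF vw(2), of u v] unfolding s_def t_def z_def
      by (simp only: mult.commute[of w u] mult.commute[of w v])
  qed (use u vw vw1 sqvw pq p q squares in \<open>auto simp: s_def t_def z_def\<close>)
  have pq': "complex_of_real (sqrt (of_int (p * q))) = of_int u * z"
  proof -
    have "p * q = u\<^sup>2 * (v * w)" unfolding p q by (simp add: power2_eq_square algebra_simps)
    then show ?thesis using u by (simp add: z_def real_sqrt_mult)
  qed
  have K': "K = {of_rat a + of_rat b * s + of_rat c * t + of_rat d * (of_int u * z) | a b c d. True}"
    unfolding K s_def t_def p[symmetric] q[symmetric] pq' by (rule refl)
  have "K = bq_field s t z"
  proof (intro equalityI subsetI)
    fix x assume "x \<in> K"
    then obtain a b c d where "x = of_rat a + of_rat b * s + of_rat c * t + of_rat d * (of_int u * z)"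
      unfolding K' by blast
    then have "x = bq_elem s t z a b c (d * of_int u)"
      by (simp add: bq_elem_def of_rat_mult)
    then show "x \<in> bq_field s t z" by (auto simp: bq_field_def)
  next
    fix x assume "x \<in> bq_field s t z"
    then obtain a b c d where "x = bq_elem s t z a b c d" by (auto simp: bq_field_def)
    then have "x = of_rat a + of_rat b * s + of_rat c * t + of_rat (d / of_int u) * (of_int u * z)"
      using u by (simp add: bq_elem_def of_rat_divide)
    then show "x \<in> K" unfolding K' by blast
  qed
  then show ?thesis using bq that by blast
qed

lemma biquadratic_distinct:
  assumes "biquadratic u v w s t z" shows "u \<noteq> v"
proof
  assume "u = v"
  then have "squarefree (u\<^sup>2)" "u\<^sup>2 > 1" "u > 0" using assms by (auto simp: biquadratic_def power2_eq_square)
  then have "u dvd 1" using squarefreeD[of "u\<^sup>2" u] by (metis dvd_refl)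
  then show False using \<open>u > 0\<close> \<open>u\<^sup>2 > 1\<close> by simp
qed

theorem biquadratic_not_universal:
  assumes "real_biquadratic_field K" "Z_form r F"
  shows "\<not> universal_over K r F"
proof -
  \<comment> \<open>Hiding \<open>s\<close>, \<open>t\<close>, \<open>z\<close> lets the two
    transpositions act on the triple alone, so that they can sort it.\<close>
  define good where "good u v w \<longleftrightarrow> (\<exists>s t z. biquadratic u v w s t z \<and> K = bq_field s t z)" for u v w
  have swap: "good v u w" "good u w v" if "good u v w" for u v w
    using that bq_field_swap biquadratic_swap12 biquadratic_swap23 unfolding good_def by metis+
  have distinct: "u \<noteq> v" if "good u v w" for u v w
    using that biquadratic_distinct unfolding good_def by metis
  obtain u v w where g: "good u v w"
    using biquadratic_parameters[OF assms(1)] unfolding good_def by metis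
  have "\<exists>u v w. good u v w \<and> u < v \<and> v < w"
    using g swap distinct by (smt (verit) linorder_cases)
  then obtain u v w s t z where "biquadratic u v w s t z" "K = bq_field s t z" "u < v" "v < w"
    unfolding good_def by blast
  then show ?thesis using biquadratic.not_universal_sorted[OF _ assms(2)] by blast
qed

section \<open>Trace bounds in totally real cubic fields\<close>

text \<open>A parallelogram law for three vectors. At the three conjugates of a vector the sum is
  the vector of traces, while in the differences all rational parts cancel.\<close>

lemma qf_eval_three_points:
  fixes x y z :: "nat \<Rightarrow> 'a::comm_ring_1"
  shows "3 * (qf_eval r F x + qf_eval r F y + qf_eval r F z) =
     qf_eval r F (\<lambda>i. x i + y i + z i) + qf_eval r F (\<lambda>i. x i - y i)
     + qf_eval r F (\<lambda>i. x i - z i) + qf_eval r F (\<lambda>i. y i - z i)"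
  unfolding qf_eval_def sum.distrib[symmetric] sum_distrib_left
  by (intro sum.cong refl) (simp add: algebra_simps)

lemma qf_eval_diff_le:
  assumes "Z_form r F"
  shows "qf_eval r F (\<lambda>i. x i - y i :: int) \<le> 2 * qf_eval r F x + 2 * qf_eval r F y"
proof -
  have "qf_eval r F (\<lambda>i. 1 * x i + 1 * y i) \<ge> 0" by (rule qf_eval_int_nonneg[OF assms])
  then show ?thesis
    using qf_eval_lincomb2[of r F 1 x 1 y] qf_eval_lincomb2[of r F 1 x "-1" y] by simp
qed

lemma of_rat_abs_le_half:
  assumes "\<bar>c\<bar> \<le> 1 / 2" shows "\<bar>of_rat c :: real\<bar> \<le> 1 / 2"
proof -
  have "of_rat c \<le> (of_rat (1 / 2) :: real)" "of_rat (- (1 / 2)) \<le> (of_rat c :: real)"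
    using assms unfolding of_rat_less_eq by auto
  then show ?thesis unfolding abs_le_iff by (simp add: of_rat_divide of_rat_minus)
qed

text \<open>Here \<open>X, Y, Z\<close> are the roots of \<open>T\<^sup>3 - a T\<^sup>2 - B T - c\<close>, and \<open>2 a\<^sup>2 + 6 B\<close> is their spread. The last two
  assumptions put roots below \<open>- k\<close> and above \<open>l\<close> with \<open>k, l\<close> about \<open>2 B / 3\<close>, whereas the roots have sum of squares
  \<open>a\<^sup>2 + 2 B\<close>; this bounds \<open>B\<close>, and then the discriminant bounds \<open>c\<close>.\<close>

lemma cubic_coefficients:
  fixes X Y Z :: real and a B c :: int
  assumes a: "a = 0 \<or> a = 1" and sum: "X + Y + Z = of_int a"
    and e2: "X * Y + X * Z + Y * Z = - of_int B" and e3: "X * Y * Z = of_int c"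
    and no_root: "\<And>n. n * n * n - a * (n * n) - B * n - c \<noteq> 0"
    and pos: "2 * a\<^sup>2 + 6 * B > 0"
    and lo: "\<And>k. X + of_int k > 0 \<Longrightarrow> Y + of_int k > 0 \<Longrightarrow> Z + of_int k > 0 \<Longrightarrow> 2 * a\<^sup>2 + 6 * B \<le> 3 * (a + 3 * k)"
    and hi: "\<And>k. of_int k - X > 0 \<Longrightarrow> of_int k - Y > 0 \<Longrightarrow> of_int k - Z > 0 \<Longrightarrow> 2 * a\<^sup>2 + 6 * B \<le> 3 * (3 * k - a)"
  shows "(a, B, c) \<in> {(0, 3, 1), (0, 3, -1), (1, 2, -1), (1, 3, -1)}"
proof -
  have irr: "X \<noteq> of_int n \<and> Y \<noteq> of_int n \<and> Z \<noteq> of_int n" for n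
  proof (rule ccontr)
    assume "\<not> ?thesis"
    then have "0 = (of_int n - X) * (of_int n - Y) * (of_int n - Z)" by auto
    also have "\<dots> = of_int n * of_int n * of_int n - (X + Y + Z) * (of_int n * of_int n)
        + (X * Y + X * Z + Y * Z) * of_int n - X * Y * Z" by (simp add: algebra_simps)
    also have "\<dots> = of_int (n * n * n - a * (n * n) - B * n - c)" unfolding sum e2 e3 by simp
    finally show False using no_root[of n] by (simp only: of_int_0_eq_iff[symmetric])
  qed
  have "B \<le> 3"
  proof (rule ccontr)
    assume "\<not> B \<le> 3"
    then have B: "B \<ge> 4" by simp
    \<comment> \<open>\<open>k\<close> and \<open>l\<close> are the largest integers at which the
      conclusions of \<open>lo\<close> and \<open>hi\<close> fail, given that \<open>a\<close> is 0
      or 1.\<close>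
    define k where "k = (2 * B - 1) div 3"
    define l where "l = (2 * B - 1 + 2 * a) div 3"
    have k: "3 * k \<le> 2 * B - 1" "3 * k \<ge> 2 * B - 3" unfolding k_def by presburger+
    have l: "3 * l \<le> 2 * B - 1 + 2 * a" "3 * l \<ge> 2 * B - 3 + 2 * a" unfolding l_def by presburger+
    have kl: "k \<ge> 2" "l \<ge> 2" using k l B a by auto
    have "\<not> 2 * a\<^sup>2 + 6 * B \<le> 3 * (a + 3 * k)" using k a by auto
    then have "X \<le> - of_int k \<or> Y \<le> - of_int k \<or> Z \<le> - of_int k" using lo[of k] by force
    then have low: "X < - of_int k \<or> Y < - of_int k \<or> Z < - of_int k"
      using irr[of "- k"] by auto
    have "\<not> 2 * a\<^sup>2 + 6 * B \<le> 3 * (3 * l - a)" using l a by auto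
    then have "X \<ge> of_int l \<or> Y \<ge> of_int l \<or> Z \<ge> of_int l" using hi[of l] by force
    then have high: "X > of_int l \<or> Y > of_int l \<or> Z > of_int l"
      using irr[of l] by auto
    have kl': "0 \<le> real_of_int k" "0 \<le> real_of_int l" using kl by simp_all
    have sqk: "U < - of_int k \<Longrightarrow> U\<^sup>2 > (of_int k)\<^sup>2" for U :: real
      using kl' power_strict_mono[of "of_int k" "- U" 2] by simp
    have sql: "U > of_int l \<Longrightarrow> U\<^sup>2 > (of_int l)\<^sup>2" for U :: real
      using kl' power_strict_mono[of "of_int l" U 2] by simp
    have sq0: "X\<^sup>2 \<ge> 0" "Y\<^sup>2 \<ge> 0" "Z\<^sup>2 \<ge> 0" by simp_all
    have "X\<^sup>2 + Y\<^sup>2 + Z\<^sup>2 > (of_int k)\<^sup>2 + (of_int l)\<^sup>2"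
      using low high sqk sql sq0 kl' by (smt (verit))
    also have "X\<^sup>2 + Y\<^sup>2 + Z\<^sup>2 = (X + Y + Z)\<^sup>2 - 2 * (X * Y + X * Z + Y * Z)"
      by (simp add: power2_eq_square algebra_simps)
    also have "\<dots> = of_int (a\<^sup>2 + 2 * B)" unfolding sum e2 by simp
    finally have "of_int (k\<^sup>2 + l\<^sup>2) < (of_int (a\<^sup>2 + 2 * B) :: real)" by simp
    then have less: "k * k + l * l < a\<^sup>2 + 2 * B" unfolding of_int_less_iff by (simp add: power2_eq_square)
    \<comment> \<open>Tangents at 3 make the comparison of squares linear. They are not sharp at 2,
      so B = 4 is settled with the exact values of \<open>k\<close> and \<open>l\<close>.\<close>
    have "(k - 3) * (k - 3) \<ge> 0" "(l - 3) * (l - 3) \<ge> 0" by simp_all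
    then have tangent: "k * k \<ge> 6 * k - 9" "l * l \<ge> 6 * l - 9" by (simp_all add: algebra_simps)
    show False
    proof (cases "B = 4")
      case True
      then have "k = 2" "l = 2 + a" using a unfolding k_def l_def by auto
      then show False using less True a by auto
    next
      case False
      then show False using less tangent k l B a by auto
    qed
  qed
  moreover have "B \<ge> 0" using pos a by auto
  ultimately have B: "B \<in> {0, 1, 2, 3}" by auto
  \<comment> \<open>The discriminant of the cubic, nonnegative because the roots are real.\<close>
  have "0 \<le> ((X - Y) * (X - Z) * (Y - Z))\<^sup>2" by simp
  also have "\<dots> = (X + Y + Z)\<^sup>2 * (X * Y + X * Z + Y * Z)\<^sup>2 - 4 * (X * Y + X * Z + Y * Z) ^ 3
      - 4 * (X + Y + Z) ^ 3 * (X * Y * Z)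
      + 18 * (X + Y + Z) * (X * Y + X * Z + Y * Z) * (X * Y * Z) - 27 * (X * Y * Z)\<^sup>2"
    by (simp add: power2_eq_square power3_eq_cube algebra_simps)
  also have "\<dots> = of_int (a\<^sup>2 * B\<^sup>2 + 4 * B ^ 3 - 4 * a ^ 3 * c - 18 * a * B * c - 27 * c\<^sup>2)"
    unfolding sum e2 e3 by simp
  finally have disc: "0 \<le> a\<^sup>2 * B\<^sup>2 + 4 * B ^ 3 - 4 * a ^ 3 * c - 18 * a * B * c - 27 * (c * c)"
    by (simp only: of_int_0_le_iff power2_eq_square)
  have "c \<le> 2"
  proof (rule ccontr)
    assume "\<not> c \<le> 2"
    then have "c \<ge> 3" by simp
    then have "3 * 3 \<le> c * c" by (intro mult_mono) auto
    then show False using disc a B \<open>c \<ge> 3\<close> by auto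
  qed
  moreover have "c \<ge> - 3"
  proof (rule ccontr)
    assume "\<not> c \<ge> - 3"
    then have "c \<le> - 4" by simp
    then have "c * c \<ge> - 4 * c" using mult_right_mono_neg[of c "- 4" c] by simp
    then show False using disc a B \<open>c \<le> - 4\<close> by auto
  qed
  ultimately have "c \<ge> - 3 \<and> c \<le> 2" by blast
  then have "c \<in> {-3, -2, -1, 0, 1, 2}" by auto
  \<comment> \<open>A finite search: each of the other triples has a negative discriminant, an
    integer root or spread 0.\<close>
  from this a B disc pos no_root[of "-2"] no_root[of "-1"] no_root[of 0] no_root[of 1] no_root[of 2]
  show ?thesis by (elim disjE insertE emptyE; hypsubst; simp)
qed

text \<open>What the trace argument needs to know about K. \<open>dim\<close> bounds the degree by
  3, in the form in which coordinates are extracted; \<open>embeddings\<close> reduces total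
  positivity to three signs; \<open>irrational_integer\<close> provides a candidate for an element
  of minimal spread.\<close>

locale cubic_field =
  fixes K :: "complex set" and \<sigma>1 \<sigma>2 \<sigma>3 :: "complex \<Rightarrow> real"
  assumes rat_in: "of_rat q \<in> K"
    and add_in: "x \<in> K \<Longrightarrow> y \<in> K \<Longrightarrow> x + y \<in> K"
    and mult_in: "x \<in> K \<Longrightarrow> y \<in> K \<Longrightarrow> x * y \<in> K"
    and hom_add: "\<sigma> \<in> {\<sigma>1, \<sigma>2, \<sigma>3} \<Longrightarrow> x \<in> K \<Longrightarrow> y \<in> K \<Longrightarrow> \<sigma> (x + y) = \<sigma> x + \<sigma> y"
    and hom_mult: "\<sigma> \<in> {\<sigma>1, \<sigma>2, \<sigma>3} \<Longrightarrow> x \<in> K \<Longrightarrow> y \<in> K \<Longrightarrow> \<sigma> (x * y) = \<sigma> x * \<sigma> y"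
    and hom_rat: "\<sigma> \<in> {\<sigma>1, \<sigma>2, \<sigma>3} \<Longrightarrow> \<sigma> (of_rat q) = of_rat q"
    and inj: "\<sigma> \<in> {\<sigma>1, \<sigma>2, \<sigma>3} \<Longrightarrow> x \<in> K \<Longrightarrow> \<sigma> x = 0 \<Longrightarrow> x = 0"
    and trace_rat: "x \<in> K \<Longrightarrow> \<sigma>1 x + \<sigma>2 x + \<sigma>3 x \<in> \<rat>"
    and dim: "x0 \<in> K \<Longrightarrow> x1 \<in> K \<Longrightarrow> x2 \<in> K \<Longrightarrow> x3 \<in> K \<Longrightarrow>
        \<exists>c0 c1 c2 c3. (c0 \<noteq> 0 \<or> c1 \<noteq> 0 \<or> c2 \<noteq> 0 \<or> c3 \<noteq> 0) \<and>
          of_rat c0 * x0 + of_rat c1 * x1 + of_rat c2 * x2 + of_rat c3 * x3 = 0"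
    and embeddings: "embedding K \<tau> \<Longrightarrow> x \<in> K \<Longrightarrow> \<tau> x \<in> {of_real (\<sigma>1 x), of_real (\<sigma>2 x), of_real (\<sigma>3 x)}"
    and irrational_integer: "\<exists>x\<in>K. algebraic_int x \<and> x \<notin> \<rat>"
begin

abbreviation \<O> :: "complex set" where "\<O> \<equiv> ring_of_integers K"

definition Tr :: "complex \<Rightarrow> real" where "Tr x = \<sigma>1 x + \<sigma>2 x + \<sigma>3 x"

text \<open>This is \<open>3 * Tr (x * x) - (Tr x)\<^sup>2\<close>, three times the trace form on
  the part of \<open>x\<close> orthogonal to the rationals: unchanged by rational shifts and
  positive definite modulo them.\<close>

definition spread :: "complex \<Rightarrow> real" where
  "spread x = (\<sigma>1 x - \<sigma>2 x)\<^sup>2 + (\<sigma>1 x - \<sigma>3 x)\<^sup>2 + (\<sigma>2 x - \<sigma>3 x)\<^sup>2"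

definition cospread :: "complex \<Rightarrow> complex \<Rightarrow> real" where
  "cospread x y = (\<sigma>1 x - \<sigma>2 x) * (\<sigma>1 y - \<sigma>2 y) + (\<sigma>1 x - \<sigma>3 x) * (\<sigma>1 y - \<sigma>3 y)
     + (\<sigma>2 x - \<sigma>3 x) * (\<sigma>2 y - \<sigma>3 y)"

lemma int_in: "of_int k \<in> K"
  using rat_in[of "of_int k"] by simp

lemma hom_int: "\<sigma> \<in> {\<sigma>1, \<sigma>2, \<sigma>3} \<Longrightarrow> \<sigma> (of_int k) = of_int k"
  using hom_rat[of \<sigma> "of_int k"] by simp

lemma uminus_in: "x \<in> K \<Longrightarrow> - x \<in> K"
  using mult_in[OF int_in[of "-1"]] by fastforce

lemma diff_in: "x \<in> K \<Longrightarrow> y \<in> K \<Longrightarrow> x - y \<in> K"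
  using add_in[OF _ uminus_in] by fastforce

lemma hom_uminus: "\<sigma> \<in> {\<sigma>1, \<sigma>2, \<sigma>3} \<Longrightarrow> x \<in> K \<Longrightarrow> \<sigma> (- x) = - \<sigma> x"
  using hom_mult[OF _ int_in[of "-1"], of \<sigma> x] hom_int[of \<sigma> "-1"] by simp

lemma hom_diff: "\<sigma> \<in> {\<sigma>1, \<sigma>2, \<sigma>3} \<Longrightarrow> x \<in> K \<Longrightarrow> y \<in> K \<Longrightarrow> \<sigma> (x - y) = \<sigma> x - \<sigma> y"
  using hom_add[OF _ _ uminus_in, of \<sigma> x y] hom_uminus[of \<sigma> y] by simp

lemma hom_sum:
  assumes "\<sigma> \<in> {\<sigma>1, \<sigma>2, \<sigma>3}" "\<And>i. i \<in> S \<Longrightarrow> f i \<in> K"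
  shows "sum f S \<in> K \<and> \<sigma> (sum f S) = (\<Sum>i\<in>S. \<sigma> (f i))"
  using assms(2)
proof (induction S rule: infinite_finite_induct)
  case (insert i S)
  then show ?case using hom_add[OF assms(1)] add_in by simp
qed (use hom_int[OF assms(1), of 0] int_in[of 0] in auto)

lemma hom_qf_eval:
  assumes \<sigma>: "\<sigma> \<in> {\<sigma>1, \<sigma>2, \<sigma>3}" and V: "\<And>i. i < r \<Longrightarrow> V i \<in> K"
  shows "\<sigma> (qf_eval r F V) = qf_eval r F (\<lambda>i. \<sigma> (V i))"
proof -
  have t: "of_int (F i j) * V i * V j \<in> K \<and>
      \<sigma> (of_int (F i j) * V i * V j) = of_int (F i j) * \<sigma> (V i) * \<sigma> (V j)" if "i < r" "j < r" for i j
    using V that hom_mult[OF \<sigma>] mult_in int_in hom_int[OF \<sigma>] by simp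
  have s: "(\<Sum>j\<in>{i..<r}. of_int (F i j) * V i * V j) \<in> K \<and>
      \<sigma> (\<Sum>j\<in>{i..<r}. of_int (F i j) * V i * V j) = (\<Sum>j\<in>{i..<r}. of_int (F i j) * \<sigma> (V i) * \<sigma> (V j))"
    if "i < r" for i
    using hom_sum[OF \<sigma>, of "{i..<r}" "\<lambda>j. of_int (F i j) * V i * V j"] t[OF that] by simp
  show ?thesis
    unfolding qf_eval_def
    using hom_sum[OF \<sigma>, of "{..<r}" "\<lambda>i. \<Sum>j\<in>{i..<r}. of_int (F i j) * V i * V j"] s by simp
qed

lemma \<O>_I: "x \<in> K \<Longrightarrow> algebraic_int x \<Longrightarrow> x \<in> \<O>"
  and \<O>_K: "x \<in> \<O> \<Longrightarrow> x \<in> K"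
  and \<O>_int: "x \<in> \<O> \<Longrightarrow> algebraic_int x"
  by (auto simp: ring_of_integers_def)

lemma \<O>_of_int: "of_int k \<in> \<O>"
  by (auto intro: \<O>_I int_in)

lemma \<O>_add: "x \<in> \<O> \<Longrightarrow> y \<in> \<O> \<Longrightarrow> x + y \<in> \<O>"
  and \<O>_mult: "x \<in> \<O> \<Longrightarrow> y \<in> \<O> \<Longrightarrow> x * y \<in> \<O>"
  by (auto simp: ring_of_integers_def add_in mult_in algebraic_int_add algebraic_int_mult)

lemma \<O>_uminus: "x \<in> \<O> \<Longrightarrow> - x \<in> \<O>"
  by (auto simp: ring_of_integers_def uminus_in)

lemma \<O>_diff: "x \<in> \<O> \<Longrightarrow> y \<in> \<O> \<Longrightarrow> x - y \<in> \<O>"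
  using \<O>_add[OF _ \<O>_uminus] by fastforce

lemma \<O>_Rats: "x \<in> \<O> \<Longrightarrow> x \<in> \<rat> \<Longrightarrow> \<exists>k. x = of_int k"
  using rational_algebraic_int_is_int[of x] by (auto simp: ring_of_integers_def elim!: Ints_cases)

lemma hom_poly:
  assumes \<sigma>: "\<sigma> \<in> {\<sigma>1, \<sigma>2, \<sigma>3}" and x: "x \<in> K"
  shows "poly (map_poly of_int p) x \<in> K \<and> \<sigma> (poly (map_poly of_int p) x) = poly (map_poly of_int p) (\<sigma> x)"
proof (induction p)
  case 0
  show ?case using int_in[of 0] hom_int[OF \<sigma>, of 0] by simp
next
  case (pCons a p)
  then show ?case
    unfolding map_poly_pCons[OF pCons(1)] poly_pCons
    using hom_add[OF \<sigma>] hom_mult[OF \<sigma>] x mult_in add_in int_in hom_int[OF \<sigma>] by simp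
qed

lemma hom_algebraic_int:
  assumes \<sigma>: "\<sigma> \<in> {\<sigma>1, \<sigma>2, \<sigma>3}" and x: "x \<in> \<O>"
  shows "algebraic_int (\<sigma> x)"
proof -
  obtain p where p: "poly (map_poly of_int p) x = 0" "lead_coeff p = 1"
    using \<O>_int[OF x] by (auto simp: algebraic_int_altdef_ipoly)
  have "poly (map_poly of_int p) (\<sigma> x) = 0"
    using hom_poly[OF \<sigma> \<O>_K[OF x], of p] p(1) hom_int[OF \<sigma>, of 0] by simp
  then show ?thesis using p(2) unfolding algebraic_int_altdef_ipoly by blast
qed

lemma Tr_rat: "x \<in> K \<Longrightarrow> Tr x \<in> \<rat>"
  unfolding Tr_def by (rule trace_rat)

lemma Tr_int: assumes "x \<in> \<O>" obtains k where "Tr x = of_int k"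
proof -
  have "algebraic_int (Tr x)"
    unfolding Tr_def using assms by (intro algebraic_int_add hom_algebraic_int) auto
  then have "Tr x \<in> \<int>"
    by (rule rational_algebraic_int_is_int) (intro Tr_rat \<O>_K assms)
  then show ?thesis using that by (auto elim: Ints_cases)
qed

lemma homs: "\<sigma>1 \<in> {\<sigma>1, \<sigma>2, \<sigma>3}" "\<sigma>2 \<in> {\<sigma>1, \<sigma>2, \<sigma>3}" "\<sigma>3 \<in> {\<sigma>1, \<sigma>2, \<sigma>3}"
  by auto

lemmas hom_simps = homs[THEN hom_add] homs[THEN hom_mult] homs[THEN hom_int] homs[THEN hom_rat]
  homs[THEN hom_diff] homs[THEN hom_uminus]

lemma spread_nonneg: "spread x \<ge> 0"
  by (simp add: spread_def)

lemma spread_eq: "x \<in> K \<Longrightarrow> spread x = 3 * Tr (x * x) - (Tr x)\<^sup>2"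
  by (simp add: spread_def Tr_def hom_simps mult_in power2_eq_square algebra_simps)

lemma spread_nat: assumes "x \<in> \<O>" obtains n :: nat where "spread x = of_nat n"
proof -
  obtain a b where "Tr x = of_int a" "Tr (x * x) = of_int b"
    using Tr_int[OF assms] Tr_int[OF \<O>_mult[OF assms assms]] by metis
  then have *: "spread x = of_int (3 * b - a\<^sup>2)" using spread_eq[OF \<O>_K[OF assms]] by simp
  then have "0 \<le> (of_int (3 * b - a\<^sup>2) :: real)" using spread_nonneg[of x] by simp
  then have "0 \<le> 3 * b - a\<^sup>2" by (simp only: of_int_0_le_iff)
  then show ?thesis using that[of "nat (3 * b - a\<^sup>2)"] * by simp
qed

lemma spread_zero: assumes "x \<in> K" "spread x = 0" shows "x \<in> \<rat>"
proof -
  have "\<sigma>1 x = \<sigma>2 x" "\<sigma>1 x = \<sigma>3 x"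
    using assms(2) unfolding spread_def by (auto simp: add_nonneg_eq_0_iff)
  moreover obtain q where "Tr x = of_rat q" using Tr_rat[OF assms(1)] by (auto elim: Rats_cases)
  ultimately have "\<sigma>1 x = of_rat (q / 3)" by (simp add: Tr_def of_rat_divide)
  then have "\<sigma>1 (x - of_rat (q / 3)) = 0" using assms rat_in by (simp add: hom_simps)
  then have "x - of_rat (q / 3) = 0"
    by (rule inj[OF homs(1) diff_in[OF assms(1) rat_in]])
  then show ?thesis by (metis Rats_of_rat right_minus_eq)
qed

lemma spread_pos: "x \<in> K \<Longrightarrow> x \<notin> \<rat> \<Longrightarrow> spread x > 0"
  using spread_zero spread_nonneg by (metis less_eq_real_def)

lemma spread_lincomb:
  assumes "x \<in> K" "y \<in> K"
  shows "spread (of_rat a + of_rat b * x + of_rat c * y) =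
     (of_rat b)\<^sup>2 * spread x + 2 * of_rat b * of_rat c * cospread x y + (of_rat c)\<^sup>2 * spread y"
  using assms by (simp add: spread_def cospread_def hom_simps rat_in add_in mult_in power2_eq_square algebra_simps)

lemma spread_shift: "x \<in> K \<Longrightarrow> spread (x + of_int k) = spread x" "x \<in> K \<Longrightarrow> spread (- x) = spread x"
  by (simp_all add: spread_def hom_simps int_in power2_eq_square algebra_simps)

lemma minimal_spread:
  assumes "S \<subseteq> \<O>" "S \<noteq> {}"
  obtains x where "x \<in> S" "\<And>y. y \<in> S \<Longrightarrow> spread x \<le> spread y"
proof -
  define f where "f x = nat \<lfloor>spread x\<rfloor>" for x
  have f: "spread x = of_nat (f x)" if xS: "x \<in> S" for x
  proof -
    obtain n :: nat where "spread x = of_nat n"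
      by (rule spread_nat[of x]) (use xS assms(1) in auto)
    then show ?thesis by (simp add: f_def)
  qed
  obtain x where "x \<in> S" "\<And>y. y \<in> S \<Longrightarrow> f x \<le> f y"
    using assms(2) ex_has_least_nat[of "\<lambda>x. x \<in> S" _ f] by blast
  then show ?thesis using that f by (metis of_nat_mono)
qed

section \<open>Minimal elements and reduced coordinates\<close>

definition minimal :: "complex \<Rightarrow> bool" where
  "minimal x \<longleftrightarrow> x \<in> \<O> \<and> x \<notin> \<rat> \<and> (\<forall>y\<in>\<O>. y \<notin> \<rat> \<longrightarrow> spread x \<le> spread y)"

lemma minimal_exists: obtains x where "minimal x"
proof -
  have "{x \<in> \<O>. x \<notin> \<rat>} \<noteq> {}" using irrational_integer by (auto simp: ring_of_integers_def)
  from minimal_spread[OF _ this] show ?thesis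
    using that unfolding minimal_def by (metis (no_types, lifting) mem_Collect_eq subsetI)
qed

definition line :: "complex \<Rightarrow> complex set" where
  "line x = {of_rat a + of_rat b * x | a b. True}"

lemma rat_round: fixes b :: rat obtains k :: int where "\<bar>b - of_int k\<bar> \<le> 1 / 2"
  using that[of "round b"] of_int_round_abs_le[of b] by (simp add: abs_minus_commute)

lemma Rats_cancel: "x \<notin> \<rat> \<Longrightarrow> of_rat a + of_rat b * x \<in> \<rat> \<Longrightarrow> b = 0"
proof (rule ccontr)
  assume x: "x \<notin> \<rat>" and r: "of_rat a + of_rat b * x \<in> \<rat>" and b: "b \<noteq> 0"
  have "x = ((of_rat a + of_rat b * x) - of_rat a) / of_rat b" using b by simp
  also have "\<dots> \<in> \<rat>" using r by (intro Rats_divide Rats_diff Rats_of_rat)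
  finally show False using x by simp
qed

text \<open>Rounding the coefficient \<open>b\<close> leaves a remainder whose spread is at most a
  quarter of the minimal one, so the remainder is rational.\<close>

lemma line_integral:
  assumes x: "minimal x" and y: "y \<in> \<O>" "y \<in> line x"
  obtains a b :: int where "y = of_int a + of_int b * x"
proof -
  have xO: "x \<in> \<O>" "x \<notin> \<rat>" using x by (auto simp: minimal_def)
  obtain a b where ab: "y = of_rat a + of_rat b * x" using y(2) by (auto simp: line_def)
  obtain k where k: "\<bar>b - of_int k\<bar> \<le> 1 / 2" by (rule rat_round)
  define c where "c = b - of_int k"
  have y': "y - of_int k * x = of_rat a + of_rat c * x" by (simp add: ab c_def of_rat_diff algebra_simps)
  have O: "y - of_int k * x \<in> \<O>" by (intro \<O>_diff \<O>_mult \<O>_of_int xO y)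
  have "spread (y - of_int k * x) = (of_rat c)\<^sup>2 * spread x"
    unfolding y' using spread_lincomb[of x x a c 0] \<O>_K[OF xO(1)] by simp
  also have "\<dots> \<le> (1 / 4) * spread x"
  proof (intro mult_right_mono spread_nonneg)
    have "\<bar>of_rat c :: real\<bar> \<le> \<bar>1 / 2\<bar>" using of_rat_abs_le_half k unfolding c_def by simp
    then have "(of_rat c :: real)\<^sup>2 \<le> (1 / 2)\<^sup>2" by (simp only: abs_le_square_iff)
    then show "(of_rat c :: real)\<^sup>2 \<le> 1 / 4" by (simp add: power2_eq_square)
  qed
  also have "\<dots> < spread x" using spread_pos[OF \<O>_K[OF xO(1)] xO(2)] by simp
  finally have r: "y - of_int k * x \<in> \<rat>" using x O unfolding minimal_def by force
  then have "c = 0" using Rats_cancel[OF xO(2)] y' by metis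
  obtain j where "y - of_int k * x = of_int j" using \<O>_Rats[OF O r] by blast
  then have "y = of_int j + of_int k * x" by (simp add: algebra_simps)
  then show ?thesis by (rule that)
qed


text \<open>Gauss reduction: vectors attaining the two successive minima of a planar lattice, here \<open>\<O>/\<int>\<close> with
  the quadratic form \<open>spread\<close>, are a basis of it.\<close>

lemma lattice_integral:
  assumes x: "minimal x" and y: "y \<in> \<O>" "y \<notin> line x"
    and ymin: "\<And>y'. y' \<in> \<O> \<Longrightarrow> y' \<notin> line x \<Longrightarrow> spread y \<le> spread y'"
  shows "spread x \<le> spread y" "2 * \<bar>cospread x y\<bar> \<le> spread x"
    and "v \<in> \<O> \<Longrightarrow> \<exists>a b c :: int. v = of_int a + of_int b * x + of_int c * y"
proof -
  have xO: "x \<in> \<O>" "x \<notin> \<rat>" using x by (auto simp: minimal_def)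
  note xK = \<O>_K[OF xO(1)] and yK = \<O>_K[OF y(1)]
  have lineI: "of_rat a + of_rat b * x \<in> line x" for a b by (auto simp: line_def)
  have "y \<notin> \<rat>"
  proof
    assume "y \<in> \<rat>"
    then obtain q where "y = of_rat q + of_rat 0 * x" by (auto elim: Rats_cases)
    then show False using y(2) lineI by metis
  qed
  then show le: "spread x \<le> spread y" using x y(1) by (auto simp: minimal_def)
  \<comment> \<open>Both y + x and y - x are competitors for y; expanding their spreads gives the
    reducedness bound on \<open>cospread x y\<close>.\<close>
  have pm: "spread y \<le> spread (of_rat 0 + of_rat b * x + of_rat 1 * y)" if b: "b \<in> {1, -1}" for b
  proof (rule ymin)
    show "of_rat 0 + of_rat b * x + of_rat 1 * y \<in> \<O>"
      using b xO y by (auto intro: \<O>_add \<O>_diff)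
    show "of_rat 0 + of_rat b * x + of_rat 1 * y \<notin> line x"
    proof
      assume "of_rat 0 + of_rat b * x + of_rat 1 * y \<in> line x"
      then obtain p q where "of_rat b * x + y = of_rat p + of_rat q * x" by (auto simp: line_def)
      then have "y = of_rat p + of_rat (q - b) * x" by (simp add: of_rat_diff algebra_simps)
      then show False using lineI y(2) by metis
    qed
  qed
  show co: "2 * \<bar>cospread x y\<bar> \<le> spread x"
    using pm[of 1] pm[of "-1"] unfolding spread_lincomb[OF xK yK] by simp
  show "\<exists>a b c :: int. v = of_int a + of_int b * x + of_int c * y" if v: "v \<in> \<O>"
  proof -
    obtain c0 c1 c2 c3 where c: "c0 \<noteq> 0 \<or> c1 \<noteq> 0 \<or> c2 \<noteq> 0 \<or> c3 \<noteq> 0"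
      and rel: "of_rat c0 * 1 + of_rat c1 * x + of_rat c2 * y + of_rat c3 * v = 0"
      using dim[of 1 x y v] xK yK \<O>_K[OF v] int_in[of 1] by auto
    have c3: "c3 \<noteq> 0"
    proof
      assume "c3 = 0"
      then have rel': "of_rat c2 * y = - (of_rat c0 + of_rat c1 * x)"
        using rel by (simp add: eq_neg_iff_add_eq_0 algebra_simps)
      show False
      proof (cases "c2 = 0")
        case True
        then have "of_rat c0 + of_rat c1 * x = 0" using rel \<open>c3 = 0\<close> by simp
        then have "c1 = 0" using Rats_cancel[OF xO(2), of c0 c1] by simp
        then show False using True \<open>c3 = 0\<close> c \<open>of_rat c0 + of_rat c1 * x = 0\<close> by simp
      next
        case False
        then have "y = - (of_rat c0 + of_rat c1 * x) / of_rat c2"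
          using rel' by (simp add: field_simps)
        also have "\<dots> = of_rat (- c0 / c2) + of_rat (- c1 / c2) * x"
          using False by (simp add: of_rat_divide of_rat_minus field_simps)
        finally show False using y(2) lineI by metis
      qed
    qed
    define a b c where "a = - c0 / c3" and "b = - c1 / c3" and "c = - c2 / c3"
    have "of_rat c3 * v = - (of_rat c0 + of_rat c1 * x + of_rat c2 * y)"
      using rel by (simp add: eq_neg_iff_add_eq_0 algebra_simps)
    then have "v = - (of_rat c0 + of_rat c1 * x + of_rat c2 * y) / of_rat c3"
      using c3 by (simp add: eq_divide_eq mult.commute)
    then have vabc: "v = of_rat a + of_rat b * x + of_rat c * y"
      by (simp add: a_def b_def c_def of_rat_divide of_rat_minus add_divide_distrib diff_divide_distrib)
    obtain j where j: "\<bar>b - of_int j\<bar> \<le> 1 / 2" by (rule rat_round)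
    obtain k where k: "\<bar>c - of_int k\<bar> \<le> 1 / 2" by (rule rat_round)
    define b' c' where "b' = b - of_int j" and "c' = c - of_int k"
    \<comment> \<open>After rounding both coefficients the spread is at most 3/4 of
      \<open>spread y\<close>, so minimality of \<open>y\<close> puts \<open>v'\<close> on the line
      of \<open>x\<close>, where \<open>line_integral\<close> applies.\<close>
    define v' where "v' = v - of_int j * x - of_int k * y"
    have v': "v' = of_rat a + of_rat b' * x + of_rat c' * y"
      by (simp add: v'_def vabc b'_def c'_def of_rat_diff algebra_simps)
    have v'O: "v' \<in> \<O>" unfolding v'_def by (intro \<O>_diff \<O>_mult \<O>_of_int xO y v)
    define B C :: real where "B = of_rat b'" and "C = of_rat c'"
    have BC: "\<bar>B\<bar> \<le> 1 / 2" "\<bar>C\<bar> \<le> 1 / 2"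
      using j k of_rat_abs_le_half unfolding B_def C_def b'_def c'_def by auto
    have sq: "B\<^sup>2 \<le> 1 / 4" "C\<^sup>2 \<le> 1 / 4" "\<bar>B\<bar> * \<bar>C\<bar> \<le> 1 / 4"
      using BC abs_le_square_iff[of B "1 / 2"] abs_le_square_iff[of C "1 / 2"]
        mult_mono[of "\<bar>B\<bar>" "1 / 2" "\<bar>C\<bar>" "1 / 2"] by (simp_all add: power2_eq_square)
    have "2 * B * C * cospread x y \<le> \<bar>2 * B * C * cospread x y\<bar>" by simp
    also have "\<dots> = (\<bar>B\<bar> * \<bar>C\<bar>) * (2 * \<bar>cospread x y\<bar>)" by (simp add: abs_mult)
    also have "\<dots> \<le> (1 / 4) * spread x"
      using sq(3) co by (intro mult_mono) (auto simp: spread_nonneg)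
    finally have cross: "2 * B * C * cospread x y \<le> (1 / 4) * spread x" .
    have "spread v' = B\<^sup>2 * spread x + 2 * B * C * cospread x y + C\<^sup>2 * spread y"
      unfolding v' spread_lincomb[OF xK yK] B_def C_def ..
    also have "\<dots> \<le> (1 / 4) * spread x + (1 / 4) * spread x + (1 / 4) * spread y"
      using sq by (intro add_mono cross mult_right_mono spread_nonneg)
    also have "\<dots> < spread y" using le spread_pos[OF xK xO(2)] by simp
    finally have "v' \<in> line x" using ymin[OF v'O] by force
    then obtain p q where pq: "v' = of_rat p + of_rat q * x" by (auto simp: line_def)
    have "c' = 0"
    proof (rule ccontr)
      assume nz: "c' \<noteq> 0"
      have "of_rat c' * y = of_rat (p - a) + of_rat (q - b') * x"
        using pq v' by (simp add: of_rat_diff algebra_simps)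
      then have "y = (of_rat (p - a) + of_rat (q - b') * x) / of_rat c'"
        using nz by (simp add: field_simps)
      also have "\<dots> = of_rat ((p - a) / c') + of_rat ((q - b') / c') * x"
        using nz by (simp add: of_rat_divide add_divide_distrib)
      finally show False using y(2) lineI by metis
    qed
    obtain m n where "v' = of_int m + of_int n * x"
      by (rule line_integral[OF x v'O \<open>v' \<in> line x\<close>])
    then have "v = of_int m + of_int (n + j) * x + of_int k * y"
      by (simp add: v'_def algebra_simps)
    then show ?thesis by blast
  qed
qed

text \<open>If all entries lie on the line of \<open>x\<close>, then \<open>y = x\<close> is a
  placeholder with coefficients \<open>w2 = 0\<close>. Otherwise an entry off the line shows that a
  second minimum exists. Thus the rank of the ring of integers never has to be determined.\<close>

lemma common_coordinates:
  assumes x: "minimal x" and V: "\<And>i. i < r \<Longrightarrow> V i \<in> \<O>"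
  obtains y and w0 w1 w2 :: "nat \<Rightarrow> int" where "y \<in> \<O>"
    "\<And>i. i < r \<Longrightarrow> V i = of_int (w0 i) + of_int (w1 i) * x + of_int (w2 i) * y"
    "(\<forall>i. w2 i = 0) \<or> (spread x \<le> spread y \<and> 2 * \<bar>cospread x y\<bar> \<le> spread x)"
proof (cases "\<forall>i<r. V i \<in> line x")
  case True
  have "\<forall>i. \<exists>a b :: int. i < r \<longrightarrow> V i = of_int a + of_int b * x"
    using line_integral[OF x V] True by metis
  then obtain w0 w1 :: "nat \<Rightarrow> int" where "\<And>i. i < r \<Longrightarrow> V i = of_int (w0 i) + of_int (w1 i) * x"
    by metis
  then show ?thesis using x that[of x w0 w1 "\<lambda>_. 0"] by (simp add: minimal_def)
next
  case False
  then have "{y \<in> \<O>. y \<notin> line x} \<noteq> {}" using V by blast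
  then obtain y where y: "y \<in> {y \<in> \<O>. y \<notin> line x}" "\<And>y'. y' \<in> {y \<in> \<O>. y \<notin> line x} \<Longrightarrow> spread y \<le> spread y'"
    using minimal_spread[of "{y \<in> \<O>. y \<notin> line x}"] by blast
  then have y': "y \<in> \<O>" "y \<notin> line x" "\<And>y'. y' \<in> \<O> \<Longrightarrow> y' \<notin> line x \<Longrightarrow> spread y \<le> spread y'" by auto
  note L = lattice_integral[OF x y']
  have "\<forall>i. \<exists>a b c :: int. i < r \<longrightarrow> V i = of_int a + of_int b * x + of_int c * y"
    using L(3) V by blast
  then obtain w0 w1 w2 :: "nat \<Rightarrow> int" where
    "\<And>i. i < r \<Longrightarrow> V i = of_int (w0 i) + of_int (w1 i) * x + of_int (w2 i) * y"
    by metis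
  then show ?thesis using that[of y w0 w1 w2] y'(1) L(1,2) by blast
qed

text \<open>The three-point law applied to the conjugates of V. The first term is nonnegative and
  will be dropped; \<open>w0\<close> does not occur in the others.\<close>

lemma trace_qf_eval:
  assumes xK: "x \<in> K" and yK: "y \<in> K"
    and V: "\<And>i. i < r \<Longrightarrow> V i = of_int (w0 i) + of_int (w1 i) * x + of_int (w2 i) * y"
  shows "3 * Tr (qf_eval r F V) =
     qf_eval r F (\<lambda>i. 3 * of_int (w0 i) + of_int (w1 i) * Tr x + of_int (w2 i) * Tr y)
     + of_int (qf_eval r F w1) * spread x + of_int (qf_polar r F w1 w2) * cospread x y
     + of_int (qf_eval r F w2) * spread y"
proof -
  define u where "u \<sigma> i = of_int (w0 i) + of_int (w1 i) * \<sigma> x + of_int (w2 i) * \<sigma> y"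
    for \<sigma> :: "complex \<Rightarrow> real" and i
  have "\<sigma> (qf_eval r F V) = qf_eval r F (u \<sigma>)" if \<sigma>: "\<sigma> \<in> {\<sigma>1, \<sigma>2, \<sigma>3}" for \<sigma>
  proof -
    have "V i \<in> K" "\<sigma> (V i) = u \<sigma> i" if "i < r" for i
      using V[OF that] xK yK hom_add[OF \<sigma>] hom_mult[OF \<sigma>] hom_int[OF \<sigma>]
      by (simp_all add: u_def add_in mult_in int_in)
    then show ?thesis
      using hom_qf_eval[OF \<sigma>, of r V F] qf_eval_cong[of r "\<lambda>i. \<sigma> (V i)" "u \<sigma>" F] by simp
  qed
  note hom = this
  have diff: "qf_eval r F (\<lambda>i. u \<sigma> i - u \<tau> i) = (\<sigma> x - \<tau> x)\<^sup>2 * of_int (qf_eval r F w1)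
      + (\<sigma> x - \<tau> x) * (\<sigma> y - \<tau> y) * of_int (qf_polar r F w1 w2) + (\<sigma> y - \<tau> y)\<^sup>2 * of_int (qf_eval r F w2)"
    for \<sigma> \<tau> :: "complex \<Rightarrow> real"
  proof -
    have "(\<lambda>i. u \<sigma> i - u \<tau> i) = (\<lambda>i. (\<sigma> x - \<tau> x) * of_int (w1 i) + (\<sigma> y - \<tau> y) * of_int (w2 i))"
      by (auto simp: u_def algebra_simps)
    then show ?thesis by (simp only: qf_eval_lincomb2 qf_eval_of_int qf_polar_of_int)
  qed
  from hom have "3 * Tr (qf_eval r F V) = 3 * (qf_eval r F (u \<sigma>1) + qf_eval r F (u \<sigma>2) + qf_eval r F (u \<sigma>3))"
    by (simp add: Tr_def)
  also have "\<dots> = qf_eval r F (\<lambda>i. u \<sigma>1 i + u \<sigma>2 i + u \<sigma>3 i) + qf_eval r F (\<lambda>i. u \<sigma>1 i - u \<sigma>2 i)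
     + qf_eval r F (\<lambda>i. u \<sigma>1 i - u \<sigma>3 i) + qf_eval r F (\<lambda>i. u \<sigma>2 i - u \<sigma>3 i)"
    by (rule qf_eval_three_points)
  also have "(\<lambda>i. u \<sigma>1 i + u \<sigma>2 i + u \<sigma>3 i) = (\<lambda>i. 3 * of_int (w0 i) + of_int (w1 i) * Tr x + of_int (w2 i) * Tr y)"
    by (auto simp: u_def Tr_def algebra_simps)
  finally show ?thesis unfolding diff by (simp add: spread_def cospread_def algebra_simps)
qed


section \<open>Irrational values of the form with small trace\<close>

lemma qf_eval_rational:
  assumes "\<And>i. i < r \<Longrightarrow> V i \<in> \<rat>" shows "qf_eval r F V \<in> \<rat>"
  unfolding qf_eval_def using assms by (intro Rats_sum Rats_mult Rats_of_int) auto

text \<open>If \<open>w1\<close> and \<open>w2\<close> are both nonzero, reducedness gives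
  \<open>2 * T \<ge> (2 * g1 + 2 * g2 - \<bar>h\<bar>) * spread x\<close>, and
  \<open>\<bar>h\<bar> \<le> g1 + g2\<close> makes this factor at least 2. A factor below 3 leaves
  only configurations in which the nonrational part of V is an integer vector times a single
  irrational integer; the cases with one vanishing vector are of this kind directly.\<close>

lemma irrational_value_bounds:
  assumes Z: "Z_form r F" and x: "minimal x" and V: "\<And>i. i < r \<Longrightarrow> V i \<in> \<O>"
    and irr: "qf_eval r F V \<notin> \<rat>"
  shows "spread x \<le> 3 * Tr (qf_eval r F V)"
    and "2 * (3 * Tr (qf_eval r F V)) < 3 * spread x \<Longrightarrow>
      \<exists>y w0 w1 :: nat \<Rightarrow> int. y \<in> \<O> \<and> y \<notin> \<rat> \<and> (\<forall>i<r. V i = of_int (w0 i) + of_int (w1 i) * y) \<and> qf_eval r F w1 = 1"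
  (is "?small \<Longrightarrow> ?single")
proof -
  have xO: "x \<in> \<O>" "x \<notin> \<rat>" using x by (auto simp: minimal_def)
  note xK = \<O>_K[OF xO(1)]
  have pos: "spread x > 0" by (rule spread_pos[OF xK xO(2)])
  obtain y and w0 w1 w2 :: "nat \<Rightarrow> int" where yO: "y \<in> \<O>"
    and Vw: "\<And>i. i < r \<Longrightarrow> V i = of_int (w0 i) + of_int (w1 i) * x + of_int (w2 i) * y"
    and red: "(\<forall>i. w2 i = 0) \<or> (spread x \<le> spread y \<and> 2 * \<bar>cospread x y\<bar> \<le> spread x)"
    by (rule common_coordinates[OF x V]) blast+
  define g1 g2 h where "g1 = qf_eval r F w1" and "g2 = qf_eval r F w2" and "h = qf_polar r F w1 w2"
  define T where "T = 3 * Tr (qf_eval r F V)"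
  have T: "T \<ge> of_int g1 * spread x + of_int h * cospread x y + of_int g2 * spread y"
    using trace_qf_eval[OF xK \<O>_K[OF yO], of r V w0 w1 w2 F, OF Vw]
      qf_eval_nonneg[OF Z, of "\<lambda>i. 3 * of_int (w0 i) + of_int (w1 i) * Tr x + of_int (w2 i) * Tr y"]
    unfolding T_def g1_def g2_def h_def by linarith
  have g: "g1 \<ge> 0" "g2 \<ge> 0" unfolding g1_def g2_def by (rule qf_eval_int_nonneg[OF Z])+
  have zero: "w i = 0" if "qf_eval r F w = 0" "i < r" for w :: "nat \<Rightarrow> int" and i
    by (rule qf_eval_int_eq_0[OF Z that])
  have "spread x \<le> T \<and> (2 * T < 3 * spread x \<longrightarrow> ?single)"
  proof (cases "g2 = 0")
    case True
    then have w2: "\<And>i. i < r \<Longrightarrow> w2 i = 0" using zero by (simp add: g2_def)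
    then have h: "h = 0" unfolding h_def by (subst qf_polar_commute) (rule qf_polar_zero)
    have "g1 \<noteq> 0"
    proof
      assume "g1 = 0"
      then have "V i \<in> \<rat>" if "i < r" for i
        using Vw[OF that] zero[of w1 i] w2[OF that] that by (simp add: g1_def)
      then show False using qf_eval_rational irr by blast
    qed
    then have g1: "g1 \<ge> 1" using g by simp
    have T': "T \<ge> of_int g1 * spread x" using T True h by simp
    have "spread x \<le> of_int g1 * spread x" using g1 pos by simp
    moreover have ?single if "2 * T < 3 * spread x"
    proof -
      have "of_int (2 * g1) * spread x < of_int 3 * spread x" using that T' by simp
      then have "of_int (2 * g1) < (of_int 3 :: real)" using pos by (simp only: mult_less_cancel_right_pos)
      then have "g1 = 1" using g1 by simp
      then show ?thesis using Vw w2 xO by (intro exI[of _ x] exI[of _ w0] exI[of _ w1]) (simp add: g1_def)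
    qed
    ultimately show ?thesis using T' by (intro conjI impI; (linarith | blast))
  next
    case False
    then have g2: "g2 \<ge> 1" using g by simp
    have "\<not> (\<forall>i. w2 i = 0)"
      using False qf_eval_zero[of r w2 F] by (auto simp: g2_def)
    then have yx: "spread x \<le> spread y" "2 * \<bar>cospread x y\<bar> \<le> spread x" using red by auto
    have yirr: "y \<notin> \<rat>"
    proof
      assume "y \<in> \<rat>"
      then obtain q where "y = of_rat q" by (auto elim: Rats_cases)
      then have "spread y = 0" by (simp add: spread_def hom_simps)
      then show False using yx pos by simp
    qed
    show ?thesis
    proof (cases "g1 = 0")
      case True
      then have w1: "\<And>i. i < r \<Longrightarrow> w1 i = 0" using zero by (simp add: g1_def)
      then have h: "h = 0" unfolding h_def by (rule qf_polar_zero)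
      have T': "T \<ge> of_int g2 * spread y" using T True h by simp
      have *: "spread y \<le> of_int g2 * spread y" using g2 pos yx by simp
      moreover have ?single if "2 * T < 3 * spread x"
      proof -
        have "of_int (2 * g2) * spread y < of_int 3 * spread y" using that T' yx by simp
        moreover have "spread y > 0" using yx pos by simp
        ultimately have "of_int (2 * g2) < (of_int 3 :: real)" by (simp only: mult_less_cancel_right_pos)
        then have "g2 = 1" using g2 by simp
        then show ?thesis using Vw w1 yO yirr
          by (intro exI[of _ y] exI[of _ w0] exI[of _ w2]) (simp add: g2_def)
      qed
      ultimately show ?thesis using T' yx by (intro conjI impI; (linarith | blast))
    next
      case g1: False
      have h2: "h\<^sup>2 \<le> 4 * g1 * g2" unfolding h_def g1_def g2_def by (rule qf_polar_square_le[OF Z])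
      have "4 * g1 * g2 \<le> (g1 + g2)\<^sup>2"
        using zero_le_power2[of "g1 - g2"] by (simp add: power2_eq_square algebra_simps)
      then have habs: "\<bar>h\<bar> \<le> g1 + g2" using h2 g by (intro abs_le_square_iff[THEN iffD2, of h "g1 + g2", THEN order_trans]) auto
      have "of_int h * cospread x y \<ge> - (\<bar>of_int h\<bar> * \<bar>cospread x y\<bar>)"
        by (metis abs_ge_minus_self abs_mult minus_le_iff)
      moreover have "\<bar>of_int h\<bar> * (2 * \<bar>cospread x y\<bar>) \<le> \<bar>of_int h\<bar> * spread x"
        using yx(2) by (intro mult_left_mono) auto
      moreover have "of_int g2 * spread x \<le> of_int g2 * spread y"
        using yx(1) g by (intro mult_left_mono) auto
      ultimately have T': "2 * T \<ge> of_int (2 * g1 + 2 * g2 - \<bar>h\<bar>) * spread x"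
        using T by (simp add: algebra_simps)
      have "of_int 2 * spread x \<le> of_int (2 * g1 + 2 * g2 - \<bar>h\<bar>) * spread x"
        using habs g1 g2 g pos by (intro mult_right_mono) (simp_all only: of_int_le_iff)
      moreover have ?single if "2 * T < 3 * spread x"
      proof -
        have "of_int (2 * g1 + 2 * g2 - \<bar>h\<bar>) * spread x < of_int 3 * spread x" using that T' by simp
        then have "of_int (2 * g1 + 2 * g2 - \<bar>h\<bar>) < (of_int 3 :: real)"
          using pos by (simp only: mult_less_cancel_right_pos)
        then have "2 * g1 + 2 * g2 - \<bar>h\<bar> < 3" by (simp only: of_int_less_iff)
        then have gg: "g1 = 1" "g2 = 1" "\<bar>h\<bar> = 2" using habs g1 g2 g by auto
        \<comment> \<open>Equality in Cauchy-Schwarz: Q vanishes at \<open>w1 + e * w2\<close>, so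
          the vectors agree up to sign, and \<open>x\<close> and \<open>y\<close> merge into
          \<open>y - e * x\<close>.\<close>
        define e where "e = - sgn h"
        have e: "e = 1 \<or> e = - 1" "e * h = - 2" "e * e = 1" using gg(3) by (auto simp: e_def sgn_if abs_if split: if_splits)
        have "qf_eval r F (\<lambda>i. 1 * w1 i + e * w2 i) = g1 + e * h + e * e * g2"
          unfolding qf_eval_lincomb2 by (simp add: g1_def g2_def h_def power2_eq_square)
        then have "qf_eval r F (\<lambda>i. 1 * w1 i + e * w2 i) = 0" using gg e by simp
        then have w1: "w1 i = - e * w2 i" if "i < r" for i using zero[OF _ that] by force
        define y' where "y' = y - of_int e * x"
        have V': "V i = of_int (w0 i) + of_int (w2 i) * y'" if "i < r" for i
          using Vw[OF that] w1[OF that] by (simp add: y'_def algebra_simps)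
        have "y' \<notin> \<rat>"
        proof
          assume "y' \<in> \<rat>"
          then have "\<And>i. i < r \<Longrightarrow> V i \<in> \<rat>" using V' by (simp add: Rats_add Rats_mult)
          then show False using qf_eval_rational irr by blast
        qed
        moreover have "y' \<in> \<O>" unfolding y'_def by (intro \<O>_diff \<O>_mult \<O>_of_int yO xO)
        ultimately show ?thesis using V' gg(2) unfolding g2_def by blast
      qed
      ultimately show ?thesis using T' by (intro conjI impI; (linarith | blast))
    qed
  qed
  then show "spread x \<le> 3 * Tr (qf_eval r F V)" "?small \<Longrightarrow> ?single" by (simp_all add: T_def)
qed

text \<open>So small a trace gives V = w0 + w1 y with Q(w1) = 1. Once y is shifted to have trace
  \<tau> in {-1, 0, 1}, the trace identity leaves Q(3 w0 + \<tau> w1) at most 1. Hence 9 Q(w0) is at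
  most 4, so w0 = 0 and Q(V) = y^2.\<close>

lemma small_trace_square:
  assumes Z: "Z_form r F" and x: "minimal x" and V: "\<And>i. i < r \<Longrightarrow> V i \<in> \<O>"
    and irr: "qf_eval r F V \<notin> \<rat>"
    and small: "3 * Tr (qf_eval r F V) \<le> spread x + 1" and large: "spread x > 2"
  obtains y where "y \<in> \<O>" "qf_eval r F V = y * y"
proof -
  \<comment> \<open>\<open>large\<close> says exactly that
    \<open>2 * (spread x + 1) < 3 * spread x\<close>.\<close>
  have "2 * (3 * Tr (qf_eval r F V)) < 3 * spread x" using small large by simp
  then obtain y and w0 w1 :: "nat \<Rightarrow> int" where yO: "y \<in> \<O>" "y \<notin> \<rat>"
    and Vw: "\<And>i. i < r \<Longrightarrow> V i = of_int (w0 i) + of_int (w1 i) * y" and w1: "qf_eval r F w1 = 1"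
    using irrational_value_bounds(2)[OF Z x V irr] by blast
  obtain t where t: "Tr y = of_int t" by (rule Tr_int[OF yO(1)])
  define k where "k = (t + 1) div 3"
  define \<tau> where "\<tau> = t - 3 * k"
  have \<tau>: "\<tau> = -1 \<or> \<tau> = 0 \<or> \<tau> = 1" unfolding \<tau>_def k_def by presburger
  define y' where "y' = y + of_int (- k)"
  define w0' where "w0' i = w0 i + k * w1 i" for i
  have y': "y' \<in> \<O>" unfolding y'_def by (intro \<O>_add \<O>_of_int yO)
  have Try': "Tr y' = of_int \<tau>"
    using t \<O>_K[OF yO(1)] int_in[of k] by (simp add: y'_def Tr_def \<tau>_def hom_simps)
  have "spread x \<le> spread y'"
    unfolding y'_def spread_shift(1)[OF \<O>_K[OF yO(1)]] using x yO by (simp add: minimal_def)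
  have V': "V i = of_int (w0' i) + of_int (w1 i) * y' + of_int ((\<lambda>_. 0) i) * y'" if "i < r" for i
    using Vw[OF that] by (simp add: y'_def w0'_def algebra_simps)
  define s where "s i = 3 * w0' i + \<tau> * w1 i" for i
  have "3 * Tr (qf_eval r F V) = qf_eval r F (\<lambda>i. of_int (s i)) + spread y'"
    using trace_qf_eval[OF \<O>_K[OF y'] \<O>_K[OF y'], of r V w0' w1 "\<lambda>_. 0" F, OF V'] unfolding Try' w1
    by (simp add: s_def qf_polar_commute[of r F w1] qf_polar_zero qf_eval_zero mult.commute)
  then have "(of_int (qf_eval r F s) :: real) \<le> 1"
    using small \<open>spread x \<le> spread y'\<close> unfolding qf_eval_of_int by simp
  then have s1: "qf_eval r F s \<le> 1" by simp
  have "qf_eval r F (\<lambda>i. s i - \<tau> * w1 i) \<le> 2 * qf_eval r F s + 2 * qf_eval r F (\<lambda>i. \<tau> * w1 i)"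
    by (rule qf_eval_diff_le[OF Z])
  also have "(\<lambda>i. s i - \<tau> * w1 i) = (\<lambda>i. 3 * w0' i)" by (simp add: s_def)
  also have "2 * qf_eval r F s + 2 * qf_eval r F (\<lambda>i. \<tau> * w1 i) \<le> 4"
    using s1 \<tau> w1 unfolding qf_eval_scale by auto
  finally have "9 * qf_eval r F w0' \<le> 4" unfolding qf_eval_scale by simp
  then have "qf_eval r F w0' = 0" using qf_eval_int_nonneg[OF Z, of w0'] by simp
  then have "V i = y' * of_int (w1 i)" if "i < r" for i
    using qf_eval_int_eq_0[OF Z _ that] V'[OF that] by (simp add: mult.commute)
  then have "qf_eval r F V = qf_eval r F (\<lambda>i. y' * of_int (w1 i))" by (rule qf_eval_cong)
  also have "\<dots> = y' * y'" unfolding qf_eval_scale qf_eval_of_int w1 by (simp add: power2_eq_square)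
  finally show ?thesis using that y' by blast
qed

text \<open>Newton's identities express the elementary symmetric functions by traces of powers, so
  they are rational as well as integral.\<close>

lemma symmetric_functions:
  assumes y: "y \<in> \<O>"
  obtains e2 e3 :: int where
    "\<sigma>1 y * \<sigma>2 y + \<sigma>1 y * \<sigma>3 y + \<sigma>2 y * \<sigma>3 y = of_int e2" "\<sigma>1 y * \<sigma>2 y * \<sigma>3 y = of_int e3"
proof -
  have alg: "algebraic_int (\<sigma>1 y)" "algebraic_int (\<sigma>2 y)" "algebraic_int (\<sigma>3 y)"
    using y by (auto intro: hom_algebraic_int)
  have K: "y \<in> K" "y * y \<in> K" "y * y * y \<in> K" using \<O>_K[OF y] by (auto intro: mult_in)
  have T: "Tr y \<in> \<rat>" "Tr (y * y) \<in> \<rat>" "Tr (y * y * y) \<in> \<rat>" by (rule Tr_rat; rule K)+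
  have "\<sigma>1 y * \<sigma>2 y + \<sigma>1 y * \<sigma>3 y + \<sigma>2 y * \<sigma>3 y = (Tr y * Tr y - Tr (y * y)) / 2"
    using K by (simp add: Tr_def hom_simps algebra_simps)
  also have "\<dots> \<in> \<rat>" using T by (intro Rats_divide Rats_diff Rats_mult) auto
  finally have "\<sigma>1 y * \<sigma>2 y + \<sigma>1 y * \<sigma>3 y + \<sigma>2 y * \<sigma>3 y \<in> \<int>"
    by (intro rational_algebraic_int_is_int algebraic_int_add algebraic_int_mult alg)
  moreover have "\<sigma>1 y * \<sigma>2 y * \<sigma>3 y = (Tr y * Tr y * Tr y - 3 * Tr y * Tr (y * y) + 2 * Tr (y * y * y)) / 6"
    using K by (simp add: Tr_def hom_simps algebra_simps)
  then have "\<sigma>1 y * \<sigma>2 y * \<sigma>3 y \<in> \<rat>"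
    using T by (simp only:) (intro Rats_divide Rats_diff Rats_add Rats_mult; simp)
  then have "\<sigma>1 y * \<sigma>2 y * \<sigma>3 y \<in> \<int>"
    by (intro rational_algebraic_int_is_int algebraic_int_mult alg)
  ultimately show ?thesis using that by (auto elim!: Ints_cases)
qed

section \<open>Universality tested on shifts of a minimal element\<close>

lemma totally_positiveI:
  assumes "y \<in> \<O>" "\<sigma>1 y > 0" "\<sigma>2 y > 0" "\<sigma>3 y > 0"
  shows "totally_positive K y"
  using assms embeddings[OF _ \<O>_K[OF assms(1)]] unfolding totally_positive_def by fastforce


text \<open>Adding an integer changes the trace by a multiple of 3, negation changes its sign, and
  neither affects the spread.\<close>

lemma minimal_normalized:
  obtains x a where "minimal x" "Tr x = of_int a" "a = 0 \<or> a = 1"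
proof -
  obtain y where y: "minimal y" by (rule minimal_exists)
  have yO: "y \<in> \<O>" using y by (simp add: minimal_def)
  note yK = \<O>_K[OF yO]
  obtain t where t: "Tr y = of_int t" by (rule Tr_int[OF yO])
  define k where "k = (t + 1) div 3"
  have r: "t - 3 * k = -1 \<or> t - 3 * k = 0 \<or> t - 3 * k = 1" unfolding k_def by presburger
  define z where "z = y + of_int (- k)"
  have z: "minimal z"
    using y spread_shift(1)[OF yK, of "- k"] \<O>_add[OF yO \<O>_of_int[of "- k"]]
      Rats_add[of z "of_int k"] by (auto simp: minimal_def z_def)
  have Tz: "Tr z = of_int (t - 3 * k)"
    using t yK int_in[of k] by (simp add: z_def Tr_def hom_simps)
  have zO: "z \<in> \<O>" using z by (simp add: minimal_def)
  show ?thesis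
  proof (cases "t - 3 * k = -1")
    case True
    have "minimal (- z)"
      using z spread_shift(2)[OF \<O>_K[OF zO]] \<O>_uminus[OF zO] by (simp add: minimal_def)
    moreover have "Tr (- z) = of_int 1"
      using Tz \<O>_K[OF zO] unfolding True by (simp add: Tr_def hom_simps)
    ultimately show ?thesis using that by blast
  next
    case False
    then show ?thesis using that[OF z Tz] r by blast
  qed
qed

lemma Rats_shift: "x \<notin> \<rat> \<Longrightarrow> x + of_int k \<notin> \<rat>" "x \<notin> \<rat> \<Longrightarrow> of_int k - x \<notin> \<rat>"
  using Rats_diff[of "x + of_int k" "of_int k"] Rats_diff[of "of_int k" "of_int k - x"] by auto

lemma universal_constraints:
  assumes Z: "Z_form r F" and univ: "universal_over K r F" and x: "minimal x"
    and \<alpha>: "\<alpha> \<in> \<O>" "\<alpha> \<notin> \<rat>" "\<sigma>1 \<alpha> > 0" "\<sigma>2 \<alpha> > 0" "\<sigma>3 \<alpha> > 0"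
  shows "spread x \<le> 3 * Tr \<alpha>"
    and "3 * Tr \<alpha> \<le> spread x + 1 \<Longrightarrow> spread x > 2 \<Longrightarrow> \<exists>n :: int. \<sigma>1 \<alpha> * \<sigma>2 \<alpha> * \<sigma>3 \<alpha> = of_int (n * n)"
proof -
  obtain V where V: "\<And>i. i < r \<Longrightarrow> V i \<in> \<O>" and rep: "qf_eval r F V = \<alpha>"
    using univ totally_positiveI[OF \<alpha>(1,3-5)] unfolding universal_over_def by blast
  have irr: "qf_eval r F V \<notin> \<rat>" using \<alpha>(2) rep by simp
  show "spread x \<le> 3 * Tr \<alpha>"
    using irrational_value_bounds(1)[OF Z x V irr] rep by simp
  assume small: "3 * Tr \<alpha> \<le> spread x + 1" "spread x > 2"
  obtain y where y: "y \<in> \<O>" "\<alpha> = y * y"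
    using small_trace_square[OF Z x V irr] small rep by metis
  obtain e3 where "\<sigma>1 y * \<sigma>2 y * \<sigma>3 y = of_int e3" using symmetric_functions[OF y(1)] by metis
  then have "\<sigma>1 \<alpha> * \<sigma>2 \<alpha> * \<sigma>3 \<alpha> = of_int (e3 * e3)"
    using \<O>_K[OF y(1)] unfolding y(2) by (simp add: hom_simps flip: \<open>\<sigma>1 y * \<sigma>2 y * \<sigma>3 y = of_int e3\<close>)
  then show "\<exists>n :: int. \<sigma>1 \<alpha> * \<sigma>2 \<alpha> * \<sigma>3 \<alpha> = of_int (n * n)" by blast
qed

lemma not_square_3_5: "n * n \<noteq> 3" "n * n \<noteq> (5 :: int)"
proof -
  have "\<bar>n\<bar> * \<bar>n\<bar> = n * n" by (rule abs_mult_self_eq)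
  moreover have "\<bar>n\<bar> \<le> 1 \<or> \<bar>n\<bar> = 2 \<or> \<bar>n\<bar> \<ge> 3" by linarith
  moreover have "\<bar>n\<bar> \<ge> 3 \<Longrightarrow> \<bar>n\<bar> * \<bar>n\<bar> \<ge> 3 * 3" by (intro mult_mono) auto
  moreover have "\<bar>n\<bar> \<le> 1 \<Longrightarrow> \<bar>n\<bar> * \<bar>n\<bar> \<le> 1 * 1" by (intro mult_mono) auto
  moreover have "\<bar>n\<bar> = 2 \<Longrightarrow> \<bar>n\<bar> * \<bar>n\<bar> = 4" by simp
  ultimately show "n * n \<noteq> 3" "n * n \<noteq> (5 :: int)" by linarith+
qed

theorem universal_imp_root:
  assumes Z: "Z_form r F" and univ: "universal_over K r F"
  shows "\<exists>x\<in>K. x * x * x - x * x - 2 * x + 1 = 0"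
proof -
  obtain x a where x: "minimal x" and a: "Tr x = of_int a" "a = 0 \<or> a = 1"
    by (rule minimal_normalized)
  have xO: "x \<in> \<O>" "x \<notin> \<rat>" using x by (auto simp: minimal_def)
  note xK = \<O>_K[OF xO(1)]
  obtain e2 c where e: "\<sigma>1 x * \<sigma>2 x + \<sigma>1 x * \<sigma>3 x + \<sigma>2 x * \<sigma>3 x = of_int e2"
    "\<sigma>1 x * \<sigma>2 x * \<sigma>3 x = of_int c" using symmetric_functions[OF xO(1)] .
  define B where "B = - e2"
  define X Y Z' where "X = \<sigma>1 x" and "Y = \<sigma>2 x" and "Z' = \<sigma>3 x"
  have sum: "X + Y + Z' = of_int a" using a(1) by (simp add: Tr_def X_def Y_def Z'_def)
  have e2: "X * Y + X * Z' + Y * Z' = - of_int B" using e(1) by (simp add: B_def X_def Y_def Z'_def)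
  have e3: "X * Y * Z' = of_int c" using e(2) by (simp add: X_def Y_def Z'_def)
  have "spread x = 2 * (X + Y + Z')\<^sup>2 - 6 * (X * Y + X * Z' + Y * Z')"
    by (simp add: spread_def X_def Y_def Z'_def power2_eq_square algebra_simps)
  then have spread: "spread x = of_int (2 * a\<^sup>2 + 6 * B)" unfolding sum e2 by simp
  have factor: "(T - X) * (T - Y) * (T - Z') = T * T * T - of_int a * (T * T) - of_int B * T - of_int c" for T
  proof -
    have "(T - X) * (T - Y) * (T - Z') = T * T * T - (X + Y + Z') * (T * T)
        + (X * Y + X * Z' + Y * Z') * T - X * Y * Z'" by (simp add: algebra_simps)
    then show ?thesis unfolding sum e2 e3 by simp
  qed
  have roots: "T * T * T = of_int a * (T * T) + of_int B * T + of_int c" if "T \<in> {X, Y, Z'}" for T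
    using that factor[of T] by auto
  have plus: "x + of_int k \<in> \<O>" "x + of_int k \<notin> \<rat>" "\<sigma>1 (x + of_int k) = X + of_int k"
    "\<sigma>2 (x + of_int k) = Y + of_int k" "\<sigma>3 (x + of_int k) = Z' + of_int k" "Tr (x + of_int k) = of_int (a + 3 * k)" for k
    using xO Rats_shift(1)[OF xO(2)] a(1) xK int_in[of k]
    by (simp_all add: \<O>_add \<O>_of_int hom_simps Tr_def X_def Y_def Z'_def)
  have minus: "of_int k - x \<in> \<O>" "of_int k - x \<notin> \<rat>" "\<sigma>1 (of_int k - x) = of_int k - X"
    "\<sigma>2 (of_int k - x) = of_int k - Y" "\<sigma>3 (of_int k - x) = of_int k - Z'" "Tr (of_int k - x) = of_int (3 * k - a)" for k
    using xO Rats_shift(2)[OF xO(2)] a(1) xK int_in[of k]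
    by (simp_all add: \<O>_diff \<O>_of_int hom_simps Tr_def X_def Y_def Z'_def)
  have coeffs: "(a, B, c) \<in> {(0, 3, 1), (0, 3, -1), (1, 2, -1), (1, 3, -1)}"
  proof (rule cubic_coefficients[OF a(2) sum e2 e3])
    show "n * n * n - a * (n * n) - B * n - c \<noteq> 0" for n
    proof
      assume "n * n * n - a * (n * n) - B * n - c = 0"
      then have "of_int (n * n * n - a * (n * n) - B * n - c) = (0 :: real)" by simp
      then have "(of_int n - X) * (of_int n - Y) * (of_int n - Z') = 0" unfolding factor by simp
      then have "\<sigma>1 (of_int n - x) = 0 \<or> \<sigma>2 (of_int n - x) = 0 \<or> \<sigma>3 (of_int n - x) = 0"
        unfolding minus by simp
      then have "of_int n - x = 0" using inj homs \<O>_K[OF minus(1)] by metis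
      then show False using xO(2) by (metis Rats_of_int right_minus_eq)
    qed
    show "2 * a\<^sup>2 + 6 * B > 0"
      using spread_pos[OF xK xO(2)] unfolding spread by (simp only: of_int_0_less_iff)
    show "2 * a\<^sup>2 + 6 * B \<le> 3 * (a + 3 * k)" if "X + of_int k > 0" "Y + of_int k > 0" "Z' + of_int k > 0" for k
    proof -
      have "spread x \<le> 3 * Tr (x + of_int k)"
        by (rule universal_constraints(1)[OF Z univ x plus(1,2)]) (use that plus in simp_all)
      then have "of_int (2 * a\<^sup>2 + 6 * B) \<le> (of_int (3 * (a + 3 * k)) :: real)"
        unfolding spread plus by simp
      then show ?thesis by (simp only: of_int_le_iff)
    qed
    show "2 * a\<^sup>2 + 6 * B \<le> 3 * (3 * k - a)" if "of_int k - X > 0" "of_int k - Y > 0" "of_int k - Z' > 0" for k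
    proof -
      have "spread x \<le> 3 * Tr (of_int k - x)"
        by (rule universal_constraints(1)[OF Z univ x minus(1,2)]) (use that minus in simp_all)
      then have "of_int (2 * a\<^sup>2 + 6 * B) \<le> (of_int (3 * (3 * k - a)) :: real)"
        unfolding spread minus by simp
      then show ?thesis by (simp only: of_int_le_iff)
    qed
  qed
  \<comment> \<open>These locate the roots: a root \<open>T \<le> -2\<close> of
    \<open>T * T * T = 3 * T + 1\<close>, for example, would give \<open>1 \<le> T\<close>.\<close>
  have cube_le: "T * T * T - 3 * T \<le> T" if "T \<le> - 2" for T :: real
    using that mult_right_mono_neg[of T "-2" T] mult_right_mono_neg[of 4 "T * T" T] by simp
  have cube_ge: "T * T * T - 3 * T \<ge> T" if "T \<ge> 2" for T :: real
    using that mult_mono[of 2 T 2 T] mult_right_mono[of 4 "T * T" T] by simp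
  from coeffs consider "a = 0" "B = 3" "c = 1" | "a = 0" "B = 3" "c = -1" | "a = 1" "B = 2" "c = -1" | "a = 1" "B = 3" "c = -1"
    by auto
  then show ?thesis
  proof cases
    case 1
    have "T + 2 > 0" if "T \<in> {X, Y, Z'}" for T
      using roots[OF that] cube_le[of T] 1 by (cases "T \<le> -2") auto
    then have "\<sigma>1 (x + of_int 2) > 0" "\<sigma>2 (x + of_int 2) > 0" "\<sigma>3 (x + of_int 2) > 0"
      unfolding plus by simp_all
    from universal_constraints(2)[OF Z univ x plus(1,2) this]
    obtain n where "\<sigma>1 (x + of_int 2) * \<sigma>2 (x + of_int 2) * \<sigma>3 (x + of_int 2) = of_int (n * n)"
      unfolding spread plus 1 by auto
    moreover have "(X + 2) * (Y + 2) * (Z' + 2) = 3"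
      using factor[of "-2"] 1 by (simp add: algebra_simps)
    ultimately have "of_int (n * n) = (of_int 3 :: real)" unfolding plus by simp
    then show ?thesis using not_square_3_5 by (simp only: of_int_eq_iff)
  next
    case 2
    have "2 - T > 0" if "T \<in> {X, Y, Z'}" for T
      using roots[OF that] cube_ge[of T] 2 by (cases "T \<ge> 2") auto
    then have "\<sigma>1 (of_int 2 - x) > 0" "\<sigma>2 (of_int 2 - x) > 0" "\<sigma>3 (of_int 2 - x) > 0"
      unfolding minus by simp_all
    from universal_constraints(2)[OF Z univ x minus(1,2) this]
    obtain n where "\<sigma>1 (of_int 2 - x) * \<sigma>2 (of_int 2 - x) * \<sigma>3 (of_int 2 - x) = of_int (n * n)"
      unfolding spread minus 2 by auto
    moreover have "(2 - X) * (2 - Y) * (2 - Z') = 3"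
      using factor[of 2] 2 by simp
    ultimately have "of_int (n * n) = (of_int 3 :: real)" unfolding minus by simp
    then show ?thesis using not_square_3_5 by (simp only: of_int_eq_iff)
  next
    case 3
    \<comment> \<open>Discriminant 49. Here \<open>2 - x\<close> also has small trace, as 3 * 5 = 14
      + 1, but its norm is 1, a square; nothing is refuted, and the cubic equation itself is the
      conclusion.\<close>
    have "\<sigma>1 (x * x * x - x * x - of_int 2 * x + of_int 1) = X * X * X - X * X - of_int 2 * X + of_int 1"
      by (simp only: hom_simps mult_in diff_in add_in int_in xK X_def)
    also have "\<dots> = 0" using roots[of X] 3 by simp
    finally have "x * x * x - x * x - of_int 2 * x + of_int 1 = 0"
      by (intro inj[OF homs(1)] add_in diff_in mult_in int_in xK)
    then show ?thesis using xK by auto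
  next
    case 4
    \<comment> \<open>Here \<open>3 * Tr (x + of_int 2)\<close> is 21 and \<open>spread x\<close> is
      20: the case that needs the slack of 1 in \<open>small_trace_square\<close>.\<close>
    have "T + 2 > 0" if "T \<in> {X, Y, Z'}" for T
      using roots[OF that] cube_le[of T] 4 zero_le_square[of T] mult_right_mono_neg[of T "-2" T] by (cases "T \<le> -2") auto
    then have "\<sigma>1 (x + of_int 2) > 0" "\<sigma>2 (x + of_int 2) > 0" "\<sigma>3 (x + of_int 2) > 0"
      unfolding plus by simp_all
    from universal_constraints(2)[OF Z univ x plus(1,2) this]
    obtain n where "\<sigma>1 (x + of_int 2) * \<sigma>2 (x + of_int 2) * \<sigma>3 (x + of_int 2) = of_int (n * n)"
      unfolding spread plus 4 by auto
    moreover have "(X + 2) * (Y + 2) * (Z' + 2) = 5"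
      using factor[of "-2"] 4 by (simp add: algebra_simps)
    ultimately have "of_int (n * n) = (of_int 5 :: real)" unfolding plus by simp
    then show ?thesis using not_square_3_5 by (simp only: of_int_eq_iff)
  qed
qed

end

section \<open>Totally real cubic fields as subfields of the complex numbers\<close>

definition rpoly :: "rat poly \<Rightarrow> complex \<Rightarrow> complex" where
  "rpoly f t = poly (map_poly of_rat f) t"

lemma rpoly_0 [simp]: "rpoly 0 t = 0"
  and rpoly_pCons [simp]: "rpoly (pCons q f) t = of_rat q + t * rpoly f t"
  by (simp_all add: rpoly_def of_rat_hom.map_poly_pCons_hom)

lemma rpoly_1 [simp]: "rpoly 1 t = 1"
  by (simp add: one_pCons)

lemma rpoly_add [simp]: "rpoly (f + g) t = rpoly f t + rpoly g t"
proof (induction f g rule: poly_induct2)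
  case (pCons a p b q)
  then show ?case by (simp add: of_rat_add algebra_simps)
qed simp

lemma rpoly_smult [simp]: "rpoly (Polynomial.smult a f) t = of_rat a * rpoly f t"
  by (induction f) (simp_all add: of_rat_mult algebra_simps)

lemma rpoly_mult [simp]: "rpoly (f * g) t = rpoly f t * rpoly g t"
  by (induction f) (simp_all add: algebra_simps)

lemma rpoly_diff [simp]: "rpoly (f - g) t = rpoly f t - rpoly g t"
  using rpoly_add[of "f - g" g t] by (simp add: algebra_simps)

lemma rat_adjoin_altdef: "rat_adjoin \<theta> = range (\<lambda>f. rpoly f \<theta>)"
  by (auto simp: rat_adjoin_def rpoly_def)

text \<open>If \<open>p\<close> did not divide \<open>f\<close>, the two would be coprime, and a
  Bezout combination equal to 1 would vanish at their common root.\<close>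

lemma irreducible_dvd_iff_root:
  assumes "irreducible p" "rpoly p t = 0"
  shows "rpoly f t = 0 \<longleftrightarrow> p dvd f"
proof
  assume f: "rpoly f t = 0"
  show "p dvd f"
  proof (rule ccontr)
    assume "\<not> p dvd f"
    have "prime_elem p" by (rule irreducible_imp_prime_elem_gcd[OF assms(1)])
    then have "coprime p f" using \<open>\<not> p dvd f\<close> by (rule prime_elem_imp_coprime)
    then have "fst (bezout_coefficients p f) * p + snd (bezout_coefficients p f) * f = 1"
      by (simp add: bezout_coefficients_fst_snd)
    then have "rpoly (fst (bezout_coefficients p f) * p + snd (bezout_coefficients p f) * f) t = 1" by simp
    then show False using f assms(2) by simp
  qed
qed (use assms in \<open>auto elim!: dvdE\<close>)

lemma of_real_of_rat: "(of_real (of_rat q) :: complex) = of_rat q"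
proof -
  obtain n d where "q = of_int n / of_int d" by (cases q) (auto simp: Fract_of_int_quotient)
  then show ?thesis by (simp add: of_rat_divide)
qed

lemma cubic_multiple_algebraic_int:
  fixes \<theta> :: complex and r0 r1 r2 :: rat
  assumes "\<theta> * \<theta> * \<theta> + of_rat r2 * (\<theta> * \<theta>) + of_rat r1 * \<theta> + of_rat r0 = 0"
  obtains N :: int where "N \<noteq> 0" "algebraic_int (of_int N * \<theta>)"
proof -
  obtain n0 d0 where r0: "r0 = of_int n0 / of_int d0" "d0 > 0" by (cases r0) (auto simp: Fract_of_int_quotient)
  obtain n1 d1 where r1: "r1 = of_int n1 / of_int d1" "d1 > 0" by (cases r1) (auto simp: Fract_of_int_quotient)
  obtain n2 d2 where r2: "r2 = of_int n2 / of_int d2" "d2 > 0" by (cases r2) (auto simp: Fract_of_int_quotient)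
  define N where "N = d0 * d1 * d2"
  have N: "of_int N * r0 = of_int (n0 * d1 * d2)" "of_int N * r1 = of_int (n1 * d0 * d2)" "of_int N * r2 = of_int (n2 * d0 * d1)"
    using r0 r1 r2 by (simp_all add: N_def)
  have N': "of_int N * of_rat r0 = (of_int (n0 * d1 * d2) :: complex)"
     "of_int N * of_rat r1 = (of_int (n1 * d0 * d2) :: complex)" "of_int N * of_rat r2 = (of_int (n2 * d0 * d1) :: complex)"
    using N[THEN arg_cong[of _ _ "of_rat :: rat \<Rightarrow> complex"]] by (simp_all only: of_rat_mult of_rat_of_int_eq)
  let ?a = "of_int N * \<theta>"
  have "?a * ?a * ?a + (of_int N * of_rat r2) * (?a * ?a) + of_int N * (of_int N * of_rat r1) * ?a
      + of_int N * of_int N * (of_int N * of_rat r0)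
    = of_int N * of_int N * of_int N * (\<theta> * \<theta> * \<theta> + of_rat r2 * (\<theta> * \<theta>) + of_rat r1 * \<theta> + of_rat r0)"
    by (simp add: algebra_simps)
  then have "poly [:of_int (N * N * (n0 * d1 * d2)), of_int (N * (n1 * d0 * d2)), of_int (n2 * d0 * d1), 1:] ?a = 0"
    unfolding assms N' by (simp add: algebra_simps)
  then have "algebraic_int ?a"
    by (rule algebraic_int.intros[rotated 2]) (auto simp: coeff_pCons split: nat.splits)
  moreover have "N \<noteq> 0" using r0 r1 r2 by (simp add: N_def)
  ultimately show ?thesis using that by blast
qed

interpretation rat_complex: vector_space "\<lambda>(q :: rat) (z :: complex). of_rat q * z"
  by unfold_locales (simp_all add: of_rat_add of_rat_mult algebra_simps)

text \<open>Dependence concerns the set of values, whereas a relation is wanted for the family; a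
  repeated value supplies one with coefficients 1 and -1.\<close>

lemma four_dependent:
  fixes x :: "nat \<Rightarrow> complex"
  assumes "\<And>i. i < 4 \<Longrightarrow> x i \<in> rat_complex.span {1, \<theta>, \<theta> * \<theta>}"
  shows "\<exists>c :: nat \<Rightarrow> rat. (\<exists>i<4. c i \<noteq> 0) \<and> (\<Sum>i<4. of_rat (c i) * x i) = 0"
proof (cases "inj_on x {..<4}")
  case True
  have "rat_complex.dependent (x ` {..<4})"
  proof (rule ccontr)
    assume "\<not> ?thesis"
    then have "card (x ` {..<4}) \<le> card {1, \<theta>, \<theta> * \<theta>}"
      using rat_complex.independent_span_bound[of "{1, \<theta>, \<theta> * \<theta>}" "x ` {..<4}"] assms by auto
    also have "\<dots> \<le> 3" by (simp add: card_insert_if)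
    finally show False using card_image[OF True] by simp
  qed
  then obtain u where u: "\<exists>v\<in>x ` {..<4}. u v \<noteq> 0" "(\<Sum>v\<in>x ` {..<4}. of_rat (u v) * v) = 0"
    by (auto simp: rat_complex.dependent_finite)
  then have "(\<exists>i<4. u (x i) \<noteq> 0) \<and> (\<Sum>i<4. of_rat (u (x i)) * x i) = 0"
    by (auto simp: sum.reindex[OF True])
  then show ?thesis by (intro exI[of _ "\<lambda>i. u (x i)"])
next
  case False
  then obtain i j where ij: "i < 4" "j < 4" "i \<noteq> j" "x i = x j" by (auto simp: inj_on_def)
  define c :: "nat \<Rightarrow> rat" where "c k = (if k = i then 1 else if k = j then - 1 else 0)" for k
  have "(\<Sum>k<4. of_rat (c k) * x k) = (\<Sum>k\<in>{i, j}. of_rat (c k) * x k)"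
    using ij by (intro sum.mono_neutral_right) (auto simp: c_def)
  also have "\<dots> = 0" using ij by (simp add: c_def of_rat_minus)
  finally show ?thesis using ij(1) by (intro exI[of _ c]) (auto simp: c_def)
qed

lemma embedding_of_rat:
  assumes \<tau>: "embedding K \<tau>" and K: "\<And>q. of_rat q \<in> K"
  shows "\<tau> (of_rat q) = of_rat q"
proof -
  have K': "of_int k \<in> K" for k using K[of "of_int k"] by simp
  note int = embedding_of_int[OF \<tau> K']
  obtain n d where q: "q = of_int n / of_int d" "d > 0" by (cases q) (auto simp: Fract_of_int_quotient)
  have dq: "of_int d * of_rat q = (of_int n :: complex)"
    using q by (simp add: of_rat_divide)
  have "of_int d * \<tau> (of_rat q) = \<tau> (of_int d * of_rat q)"
    using \<tau> K K' int unfolding embedding_def by metis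
  also have "\<dots> = of_int d * of_rat q" unfolding dq int ..
  finally show ?thesis using q(2) by simp
qed

lemma totally_real_cubic_field_interpretation:
  assumes "totally_real_cubic_field K"
  obtains \<sigma>1 \<sigma>2 \<sigma>3 where "cubic_field K \<sigma>1 \<sigma>2 \<sigma>3"
proof -
  obtain \<theta> p where irr: "irreducible p" and deg: "degree p = 3" and p\<theta>: "rpoly p \<theta> = 0"
    and K: "K = range (\<lambda>f. rpoly f \<theta>)" and real: "totally_real K"
    using assms unfolding totally_real_cubic_field_def number_field_of_degree_def rat_adjoin_altdef rpoly_def by blast
  note dvd = irreducible_dvd_iff_root[OF irr]
  obtain as where as: "Polynomial.smult (coeff (map_poly of_rat p) 3) (\<Prod>a\<leftarrow>as. [:- a, 1:]) = (map_poly of_rat p :: complex poly)" "length as = 3"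
    using fundamental_theorem_algebra_factorized[of "map_poly of_rat p :: complex poly"] deg by auto
  obtain a1 a2 a3 where "as = [a1, a2, a3]"
    using as(2) by (metis length_0_conv length_Suc_conv numeral_3_eq_3)
  then have fac: "map_poly of_rat p = Polynomial.smult (of_rat (coeff p 3)) ([:- a1, 1:] * [:- a2, 1:] * [:- a3, 1:])"
    using as(1) by (simp add: coeff_map_poly algebra_simps)
  have roots: "rpoly p t = 0 \<longleftrightarrow> t \<in> {a1, a2, a3}" for t
  proof -
    have "coeff p 3 \<noteq> 0" using deg by (metis leading_coeff_0_iff degree_0 zero_neq_numeral)
    moreover have "rpoly p t = of_rat (coeff p 3) * ((t - a1) * (t - a2) * (t - a3))"
      unfolding rpoly_def fac poly_smult poly_mult by simp
    ultimately show ?thesis by simp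
  qed
  \<comment> \<open>The embedding sending \<theta> to the root \<open>t\<close>. The chosen
    polynomial does not matter, since two choices differ by a multiple of \<open>p\<close>, which
    vanishes at \<open>t\<close>.\<close>
  define \<sigma> where "\<sigma> t x = rpoly (SOME f. x = rpoly f \<theta>) t" for t x
  have ev: "\<sigma> t (rpoly f \<theta>) = rpoly f t" if t: "t \<in> {a1, a2, a3}" for f t
  proof -
    define g where "g = (SOME g. rpoly f \<theta> = rpoly g \<theta>)"
    have "rpoly f \<theta> = rpoly g \<theta>" unfolding g_def by (rule someI) (rule refl)
    then have "rpoly (g - f) \<theta> = 0" by simp
    then have "rpoly (g - f) t = 0" using dvd[OF p\<theta>] dvd[of t] roots t by blast
    then show ?thesis by (simp add: \<sigma>_def g_def[symmetric])
  qed
  have emb: "embedding K (\<sigma> t)" if "t \<in> {a1, a2, a3}" for t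
  proof -
    have "\<sigma> t 1 = 1" using ev[OF that, of 1] by simp
    moreover have "\<sigma> t (rpoly f \<theta> + rpoly g \<theta>) = \<sigma> t (rpoly f \<theta>) + \<sigma> t (rpoly g \<theta>)"
      "\<sigma> t (rpoly f \<theta> * rpoly g \<theta>) = \<sigma> t (rpoly f \<theta>) * \<sigma> t (rpoly g \<theta>)" for f g
      using ev[OF that, of "f + g"] ev[OF that, of "f * g"] ev[OF that] by simp_all
    ultimately show ?thesis unfolding embedding_def K by auto
  qed
  define \<rho> where "\<rho> t x = Re (\<sigma> t x)" for t x
  have \<rho>: "of_real (\<rho> t (rpoly f \<theta>)) = rpoly f t" if "t \<in> {a1, a2, a3}" for f t
  proof -
    have "\<sigma> t (rpoly f \<theta>) \<in> \<real>" using real emb[OF that] unfolding totally_real_def K by blast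
    then show ?thesis using ev[OF that] by (simp add: \<rho>_def of_real_Re)
  qed
  have rats: "rpoly [:q:] \<theta> = of_rat q" for q by simp
  define lc where "lc = coeff p 3"
  have lc: "lc \<noteq> 0" using deg unfolding lc_def by (metis leading_coeff_0_iff degree_0 zero_neq_numeral)
  have "coeff (map_poly of_rat p) n = coeff (Polynomial.smult (of_rat lc) ([:- a1, 1:] * [:- a2, 1:] * [:- a3, 1:])) n" for n
    unfolding fac lc_def ..
  from this[of 2] this[of 1] have coeffs:
    "of_rat (coeff p 2) = - of_rat lc * (a1 + a2 + a3)" "of_rat (coeff p 1) = of_rat lc * (a1 * a2 + a1 * a3 + a2 * a3)"
    by (simp_all add: coeff_map_poly numeral_2_eq_2 algebra_simps)
  have s1: "a1 + a2 + a3 = of_rat (- coeff p 2 / lc)"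
    unfolding of_rat_divide of_rat_minus coeffs using lc by simp
  have s2: "a1 * a2 + a1 * a3 + a2 * a3 = of_rat (coeff p 1 / lc)"
    unfolding of_rat_divide coeffs using lc by simp
  have s3: "a1 * a1 + a2 * a2 + a3 * a3 = of_rat ((- coeff p 2 / lc)\<^sup>2 - 2 * (coeff p 1 / lc))"
  proof -
    have "a1 * a1 + a2 * a2 + a3 * a3 = (a1 + a2 + a3)\<^sup>2 - 2 * (a1 * a2 + a1 * a3 + a2 * a3)"
      by (simp add: power2_eq_square algebra_simps)
    then show ?thesis unfolding s1 s2 by (simp only: of_rat_diff of_rat_mult of_rat_power of_rat_numeral_eq)
  qed
  \<comment> \<open>Division by \<open>p\<close> with remainder. The same rational coefficients
    serve \<theta> and all its conjugates, which yields both the rationality of traces and the bound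
    3 on the dimension.\<close>
  have reduce: "\<exists>q0 q1 q2. \<forall>t\<in>insert \<theta> {a1, a2, a3}. rpoly f t = of_rat q0 + of_rat q1 * t + of_rat q2 * (t * t)" for f
  proof -
    define s where "s = f mod p"
    have "p \<noteq> 0" using deg by auto
    then have "degree s < 3" using degree_mod_less[of p f] deg by (auto simp: s_def)
    then have s: "s = [:coeff s 0, coeff s 1, coeff s 2:]"
      by (intro poly_eqI) (auto simp: coeff_pCons coeff_eq_0 numeral_2_eq_2 split: nat.splits)
    have "rpoly f t = of_rat (coeff s 0) + of_rat (coeff s 1) * t + of_rat (coeff s 2) * (t * t)"
      if "t \<in> insert \<theta> {a1, a2, a3}" for t
    proof -
      have "f = f div p * p + s" by (simp add: s_def)
      then have "rpoly f t = rpoly (f div p * p + s) t" by simp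
      also have "\<dots> = rpoly s t" using that roots[of t] p\<theta> by auto
      also have "\<dots> = of_rat (coeff s 0) + of_rat (coeff s 1) * t + of_rat (coeff s 2) * (t * t)"
        by (subst s) (simp add: algebra_simps)
      finally show ?thesis .
    qed
    then show ?thesis by blast
  qed
  have "cubic_field K (\<rho> a1) (\<rho> a2) (\<rho> a3)"
  proof
    show rat: "of_rat q \<in> K" for q using rats[of q] unfolding K by (metis rangeI)
    fix x y assume "x \<in> K" "y \<in> K"
    then obtain f g where xy: "x = rpoly f \<theta>" "y = rpoly g \<theta>" unfolding K by blast
    have "x + y = rpoly (f + g) \<theta>" "x * y = rpoly (f * g) \<theta>" using xy by simp_all
    then show "x + y \<in> K" "x * y \<in> K" unfolding K by blast+
    fix h assume "h \<in> {\<rho> a1, \<rho> a2, \<rho> a3}"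
    then obtain t where h: "h = \<rho> t" and t: "t \<in> {a1, a2, a3}" by blast
    have "of_real (h (x + y)) = (of_real (h x + h y) :: complex)"
      using \<rho>[OF t, of "f + g"] \<rho>[OF t, of f] \<rho>[OF t, of g] by (simp add: h xy)
    then show "h (x + y) = h x + h y" by (simp only: of_real_eq_iff)
    have "of_real (h (x * y)) = (of_real (h x * h y) :: complex)"
      using \<rho>[OF t, of "f * g"] \<rho>[OF t, of f] \<rho>[OF t, of g] by (simp add: h xy)
    then show "h (x * y) = h x * h y" by (simp only: of_real_eq_iff)
  next
    fix h q assume "h \<in> {\<rho> a1, \<rho> a2, \<rho> a3}"
    then obtain t where h: "h = \<rho> t" and t: "t \<in> {a1, a2, a3}" by blast
    have "of_real (h (of_rat q)) = (of_real (of_rat q) :: complex)"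
      using \<rho>[OF t, of "[:q:]"] by (simp add: h of_real_of_rat)
    then show "h (of_rat q) = of_rat q" by (simp only: of_real_eq_iff)
  next
    fix h x assume "h \<in> {\<rho> a1, \<rho> a2, \<rho> a3}" and x: "x \<in> K" and hx: "h x = 0"
    then obtain t where h: "h = \<rho> t" and t: "t \<in> {a1, a2, a3}" by blast
    obtain f where f: "x = rpoly f \<theta>" using x unfolding K by blast
    have "rpoly f t = 0" using \<rho>[OF t, of f] hx by (simp add: h f)
    then show "x = 0" unfolding f using dvd[OF p\<theta>] dvd[of t] roots t by blast
  next
    fix x assume "x \<in> K"
    then obtain f where x: "x = rpoly f \<theta>" unfolding K by blast
    obtain q0 q1 q2 where q: "\<forall>t\<in>insert \<theta> {a1, a2, a3}. rpoly f t = of_rat q0 + of_rat q1 * t + of_rat q2 * (t * t)"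
      using reduce by blast
    have "of_real (\<rho> a1 x + \<rho> a2 x + \<rho> a3 x) = rpoly f a1 + rpoly f a2 + rpoly f a3"
      using \<rho>[of a1 f] \<rho>[of a2 f] \<rho>[of a3 f] by (simp add: x)
    also have "\<dots> = 3 * of_rat q0 + of_rat q1 * (a1 + a2 + a3) + of_rat q2 * (a1 * a1 + a2 * a2 + a3 * a3)"
      using q by (simp add: algebra_simps)
    also have "\<dots> \<in> \<rat>" unfolding s1 s3 by (intro Rats_add Rats_mult Rats_of_rat) auto
    finally obtain q where "of_real (\<rho> a1 x + \<rho> a2 x + \<rho> a3 x) = (of_rat q :: complex)"
      by (rule Rats_cases)
    then have "\<rho> a1 x + \<rho> a2 x + \<rho> a3 x = of_rat q"
      unfolding of_real_of_rat[symmetric] by (simp only: of_real_eq_iff)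
    then show "\<rho> a1 x + \<rho> a2 x + \<rho> a3 x \<in> \<rat>" by simp
  next
    fix \<tau> x assume \<tau>: "embedding K \<tau>" and "x \<in> K"
    then obtain f where x: "x = rpoly f \<theta>" unfolding K by blast
    have rat: "of_rat q \<in> K" for q using rats[of q] unfolding K by (metis rangeI)
    \<comment> \<open>An embedding is determined by the image of \<theta>, which must be a root of
      \<open>p\<close>.\<close>
    have \<tau>f: "\<tau> (rpoly f \<theta>) = rpoly f (\<tau> \<theta>)" for f
    proof (induction f)
      case 0
      show ?case using embedding_of_rat[OF \<tau> rat, of 0] by simp
    next
      case (pCons q f)
      have "\<theta> = rpoly [:0, 1:] \<theta>" by simp
      then have "\<theta> \<in> K" "rpoly f \<theta> \<in> K" "\<theta> * rpoly f \<theta> = rpoly ([:0, 1:] * f) \<theta>" unfolding K by (metis rangeI, blast, simp)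
      then have "\<theta> * rpoly f \<theta> \<in> K" unfolding K by blast
      then show ?case
        using \<tau> rat \<open>\<theta> \<in> K\<close> \<open>rpoly f \<theta> \<in> K\<close> embedding_of_rat[OF \<tau> rat] pCons
        unfolding embedding_def by simp
    qed
    have "rpoly p (\<tau> \<theta>) = 0" using \<tau>f[of p] p\<theta> embedding_of_rat[OF \<tau> rat, of 0] by simp
    then have "\<tau> \<theta> \<in> {a1, a2, a3}" unfolding roots .
    then show "\<tau> x \<in> {of_real (\<rho> a1 x), of_real (\<rho> a2 x), of_real (\<rho> a3 x)}"
      using \<tau>f[of f] \<rho>[of "\<tau> \<theta>" f] by (auto simp: x)
  next
    fix x0 x1 x2 x3 assume xs: "x0 \<in> K" "x1 \<in> K" "x2 \<in> K" "x3 \<in> K"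
    have span: "x \<in> rat_complex.span {1, \<theta>, \<theta> * \<theta>}" if "x \<in> K" for x
    proof -
      obtain f where "x = rpoly f \<theta>" using \<open>x \<in> K\<close> unfolding K by blast
      then obtain q0 q1 q2 where "x = of_rat q0 * 1 + of_rat q1 * \<theta> + of_rat q2 * (\<theta> * \<theta>)"
        using reduce[of f] by auto
      then show ?thesis
        by (auto intro!: rat_complex.span_add rat_complex.span_scale intro: rat_complex.span_base simp del: mult_1_right)
    qed
    define x where "x i = (if i = 0 then x0 else if i = 1 then x1 else if i = 2 then x2 else x3)" for i :: nat
    have xi: "x 0 = x0" "x 1 = x1" "x 2 = x2" "x 3 = x3" by (simp_all add: x_def)
    have four: "{..<4} = {0, 1, 2, 3 :: nat}" by auto
    have lt4: "i = 0 \<or> i = 1 \<or> i = 2 \<or> i = 3" if "i < 4" for i :: nat using that by linarith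
    have "x i \<in> rat_complex.span {1, \<theta>, \<theta> * \<theta>}" if "i < 4" for i
      using lt4[OF that] xs[THEN span] xi by metis
    then obtain c :: "nat \<Rightarrow> rat" where
      c: "\<exists>i<4. c i \<noteq> 0" "(\<Sum>i<4. of_rat (c i) * x i) = 0"
      using four_dependent[of x \<theta>] by force
    have "c 0 \<noteq> 0 \<or> c 1 \<noteq> 0 \<or> c 2 \<noteq> 0 \<or> c 3 \<noteq> 0"
      using c(1) lt4 by metis
    moreover have "of_rat (c 0) * x0 + of_rat (c 1) * x1 + of_rat (c 2) * x2 + of_rat (c 3) * x3 = 0"
      using c(2) unfolding four by (simp add: xi xi(2)[unfolded One_nat_def] add.assoc)
    ultimately show "\<exists>c0 c1 c2 c3. (c0 \<noteq> 0 \<or> c1 \<noteq> 0 \<or> c2 \<noteq> 0 \<or> c3 \<noteq> 0) \<and>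
          of_rat c0 * x0 + of_rat c1 * x1 + of_rat c2 * x2 + of_rat c3 * x3 = 0" by blast
  next
    have pp: "p = [:coeff p 0, coeff p 1, coeff p 2, lc:]"
      using deg unfolding lc_def
      by (intro poly_eqI) (auto simp: coeff_pCons coeff_eq_0 numeral_2_eq_2 numeral_3_eq_3 split: nat.splits)
    have "of_rat (coeff p 0) + \<theta> * (of_rat (coeff p 1) + \<theta> * (of_rat (coeff p 2) + \<theta> * of_rat lc)) = 0"
      using p\<theta> by (subst (asm) pp) simp
    then have "\<theta> * \<theta> * \<theta> + of_rat (coeff p 2 / lc) * (\<theta> * \<theta>) + of_rat (coeff p 1 / lc) * \<theta> + of_rat (coeff p 0 / lc) = 0"
      using lc by (simp add: of_rat_divide field_simps)
    then obtain N :: int where N: "N \<noteq> 0" "algebraic_int (of_int N * \<theta>)" by (rule cubic_multiple_algebraic_int)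
    have "of_int N * \<theta> \<notin> \<rat>"
    proof
      assume "of_int N * \<theta> \<in> \<rat>"
      then obtain q where "of_int N * \<theta> = of_rat q" by (auto elim: Rats_cases)
      then have "rpoly [:- q, of_int N:] \<theta> = 0" by (simp add: of_rat_minus algebra_simps)
      then have "p dvd [:- q, of_int N:]" using dvd[OF p\<theta>] by blast
      then have "degree p \<le> degree [:- q, of_int N:]" using N(1) by (intro dvd_imp_degree_le) auto
      then show False using deg N(1) by simp
    qed
    moreover have "of_int N * \<theta> = rpoly [:0, of_int N:] \<theta>" by simp
    then have "of_int N * \<theta> \<in> K" unfolding K by blast
    ultimately show "\<exists>x\<in>K. algebraic_int x \<and> x \<notin> \<rat>" using N(2) by blast
  qed
  then show ?thesis by (rule that)
qed


section \<open>The real cubic subfield of the seventh cyclotomic field\<close>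

lemma rat_adjoin_closed:
  shows "of_rat q \<in> rat_adjoin t" "t \<in> rat_adjoin t"
    and "x \<in> rat_adjoin t \<Longrightarrow> y \<in> rat_adjoin t \<Longrightarrow> x + y \<in> rat_adjoin t"
    and "x \<in> rat_adjoin t \<Longrightarrow> y \<in> rat_adjoin t \<Longrightarrow> x * y \<in> rat_adjoin t"
proof -
  have "of_rat q = rpoly [:q:] t" "t = rpoly [:0, 1:] t" by simp_all
  then show "of_rat q \<in> rat_adjoin t" "t \<in> rat_adjoin t" unfolding rat_adjoin_altdef by blast+
  assume "x \<in> rat_adjoin t" "y \<in> rat_adjoin t"
  then obtain f g where "x + y = rpoly (f + g) t" "x * y = rpoly (f * g) t" unfolding rat_adjoin_altdef by auto
  then show "x + y \<in> rat_adjoin t" "x * y \<in> rat_adjoin t" unfolding rat_adjoin_altdef by blast+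
qed

definition \<eta> :: complex where "\<eta> = cis (2 * pi / 7) + inverse (cis (2 * pi / 7))"

lemma \<eta>_root: "\<eta> * \<eta> * \<eta> + \<eta> * \<eta> - 2 * \<eta> - 1 = 0"
proof -
  define \<zeta> where "\<zeta> = cis (2 * pi / 7)"
  define w where "w = inverse \<zeta>"
  have "\<zeta> ^ 7 = cis (real 7 * (2 * pi / 7))" unfolding \<zeta>_def by (rule Complex.DeMoivre)
  also have "\<dots> = 1" by (simp add: complex_eq_iff)
  finally have \<zeta>7: "\<zeta> ^ 7 = 1" .
  have "sin (2 * pi / 7) > 0" using pi_gt_zero by (intro sin_gt_zero) (auto simp: field_simps)
  then have "\<zeta> \<noteq> 1" by (auto simp: \<zeta>_def complex_eq_iff)
  have "(\<zeta> - 1) * (1 + \<zeta> + \<zeta> ^ 2 + \<zeta> ^ 3 + \<zeta> ^ 4 + \<zeta> ^ 5 + \<zeta> ^ 6) = \<zeta> ^ 7 - 1"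
    by (simp add: eval_nat_numeral algebra_simps)
  then have S: "1 + \<zeta> + \<zeta> ^ 2 + \<zeta> ^ 3 + \<zeta> ^ 4 + \<zeta> ^ 5 + \<zeta> ^ 6 = 0"
    using \<open>\<zeta> \<noteq> 1\<close> \<zeta>7 by simp
  have \<zeta>0: "\<zeta> \<noteq> 0" by (simp add: \<zeta>_def)
  have w: "\<zeta> * w = 1" using \<zeta>0 by (simp add: w_def)
  have "\<zeta> * \<zeta> ^ 6 = \<zeta> * w" using \<zeta>7 w by (simp add: eval_nat_numeral)
  then have w6: "w = \<zeta> ^ 6" using \<zeta>0 by simp
  have \<eta>: "\<eta> = \<zeta> + w" by (simp add: \<eta>_def \<zeta>_def w_def)
  have w2: "w * w = \<zeta> ^ 5"
  proof -
    have "w * w = \<zeta> ^ 7 * \<zeta> ^ 5" unfolding w6 by (simp flip: power_add)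
    then show ?thesis using \<zeta>7 by simp
  qed
  have "\<zeta> ^ 5 * w = \<zeta> ^ 4 * (\<zeta> * w)" by (simp add: eval_nat_numeral)
  then have w3: "\<zeta> ^ 5 * w = \<zeta> ^ 4" using w by simp
  have "\<eta> * \<eta> * \<eta> + \<eta> * \<eta> - 2 * \<eta> - 1
      = \<zeta> ^ 3 + w * w * w + 3 * (\<zeta> * w) * (\<zeta> + w) + \<zeta> ^ 2 + 2 * (\<zeta> * w) + w * w - 2 * (\<zeta> + w) - 1"
    unfolding \<eta> by (simp add: eval_nat_numeral algebra_simps)
  also have "\<dots> = 1 + \<zeta> + \<zeta> ^ 2 + \<zeta> ^ 3 + \<zeta> ^ 4 + \<zeta> ^ 5 + \<zeta> ^ 6"
    unfolding w w2 w3 using w6 by simp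
  finally show ?thesis using S by simp
qed

text \<open>A rational root would be an integer, and parity excludes integer roots.\<close>

lemma monic_cubic_no_rational_root:
  fixes u :: rat and A B C :: int
  assumes odd: "\<And>n :: int. odd (n * n * n + A * (n * n) + B * n + C)"
  shows "u * u * u + of_int A * (u * u) + of_int B * u + of_int C \<noteq> 0"
proof
  assume u: "u * u * u + of_int A * (u * u) + of_int B * u + of_int C = 0"
  have "poly [:of_int C, of_int B, of_int A, 1:] U
      = U * U * U + of_int A * (U * U) + of_int B * U + of_int C" for U :: complex
    by (simp add: algebra_simps)
  then have "poly [:of_int C, of_int B, of_int A, 1:] (of_rat u :: complex)
      = of_rat (u * u * u + of_int A * (u * u) + of_int B * u + of_int C)"
    by (simp only: of_rat_add of_rat_mult of_rat_of_int_eq)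
  then have "poly [:of_int C, of_int B, of_int A, 1:] (of_rat u :: complex) = 0"
    unfolding u by simp
  then have "algebraic_int (of_rat u :: complex)"
    by (rule algebraic_int.intros[rotated 2]) (auto simp: coeff_pCons split: nat.splits)
  then obtain n where "u = of_int n" by (rule algebraic_int_of_rat_Ints)
  then have "of_int (n * n * n + A * (n * n) + B * n + C) = (0 :: rat)" using u by simp
  then have "n * n * n + A * (n * n) + B * n + C = 0" by (simp only: of_int_eq_0_iff)
  then show False using odd[of n] by simp
qed

text \<open>Negation carries the cubic of \<open>x\<close> to that of \<eta>. The map a -> a^2 - 2
  sends \<zeta>^i + \<zeta>^(-i) to \<zeta>^(2i) + \<zeta>^(-2i) and so permutes \<eta>, \<beta>,
  \<gamma> cyclically; hence each of the three generates the same field.\<close>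

lemma rat_adjoin_eq_of_root:
  assumes root: "x * x * x - x * x - 2 * x + 1 = 0"
  shows "rat_adjoin x = rat_adjoin \<eta>"
proof
  have sub: "rat_adjoin a \<subseteq> rat_adjoin b" if "a \<in> rat_adjoin b" for a b
  proof -
    have "rpoly f a \<in> rat_adjoin b" for f
    proof (induction f)
      case 0
      show ?case using rat_adjoin_closed(1)[of 0 b] by simp
    qed (auto intro: rat_adjoin_closed that)
    then show ?thesis unfolding rat_adjoin_altdef by blast
  qed
  have ints: "of_int k \<in> rat_adjoin b" for k b using rat_adjoin_closed(1)[of "of_int k" b] by simp
  have minus: "- a \<in> rat_adjoin b" if "a \<in> rat_adjoin b" for a b
    using rat_adjoin_closed(4)[OF ints[of "-1"] that] by simp
  have sq: "a * a - 2 \<in> rat_adjoin b" if "a \<in> rat_adjoin b" for a b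
    using rat_adjoin_closed(3)[OF rat_adjoin_closed(4)[OF that that] ints[of "-2"]] by simp
  define y \<beta> \<gamma> where "y = - x" and "\<beta> = \<eta> * \<eta> - 2" and "\<gamma> = 1 - \<eta> - \<eta> * \<eta>"
  let ?g = "\<eta> * \<eta> * \<eta> + \<eta> * \<eta> - 2 * \<eta> - 1"
  have "(y - \<eta>) * ((y - \<beta>) * (y - \<gamma>)) = - (x * x * x - x * x - 2 * x + 1) - (1 + (y - \<eta>) * \<eta>) * ?g"
    by (simp add: y_def \<beta>_def \<gamma>_def algebra_simps)
  then have cases: "y = \<eta> \<or> y = \<beta> \<or> y = \<gamma>" unfolding root \<eta>_root by simp
  have "\<beta> * \<beta> - 2 = \<gamma> + (\<eta> - 1) * ?g" "\<gamma> * \<gamma> - 2 = \<eta> + (\<eta> + 1) * ?g"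
    by (simp_all add: \<beta>_def \<gamma>_def algebra_simps)
  then have cycle: "\<eta> * \<eta> - 2 = \<beta>" "\<beta> * \<beta> - 2 = \<gamma>" "\<gamma> * \<gamma> - 2 = \<eta>"
    unfolding \<eta>_root by (simp_all add: \<beta>_def)
  have "y \<in> rat_adjoin \<eta>"
    using cases sq[of \<eta> \<eta>] sq[of \<beta> \<eta>] rat_adjoin_closed(2)[of \<eta>] unfolding cycle by auto
  then have "x \<in> rat_adjoin \<eta>" using minus[of y \<eta>] by (simp add: y_def)
  then show "rat_adjoin x \<subseteq> rat_adjoin \<eta>" by (rule sub)
  have y: "y \<in> rat_adjoin x" using minus[OF rat_adjoin_closed(2)] by (simp add: y_def)
  have "\<eta> \<in> rat_adjoin x"
    using cases y sq[of \<beta> x] sq[of \<gamma> x] unfolding cycle by auto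
  then show "rat_adjoin \<eta> \<subseteq> rat_adjoin x" by (rule sub)
qed

lemma (in cubic_field) eq_Q_zeta7_plus:
  assumes x: "x \<in> K" and root: "x * x * x - x * x - 2 * x + 1 = 0"
  shows "K = Q_zeta7_plus"
proof -
  have irr: "x \<noteq> of_rat q" for q
  proof
    assume "x = of_rat q"
    then have "of_rat (q * q * q + of_int (-1) * (q * q) + of_int (-2) * q + of_int 1)
        = x * x * x - x * x - 2 * x + 1"
      by (simp add: of_rat_add of_rat_diff of_rat_mult)
    then have "of_rat (q * q * q + of_int (-1) * (q * q) + of_int (-2) * q + of_int 1) = (0 :: complex)"
      unfolding root .
    then have "q * q * q + of_int (-1) * (q * q) + of_int (-2) * q + of_int 1 = 0"
      by (simp only: of_rat_eq_0_iff)
    moreover have "odd (n * n * n + (-1) * (n * n) + (-2) * n + 1)" for n :: int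
      by simp
    ultimately show False using monic_cubic_no_rational_root by blast
  qed
  have indep1: "a = 0 \<and> b = 0" if "of_rat a + of_rat b * x = 0" for a b
  proof (cases "b = 0")
    case False
    have bx: "of_rat b * x = - of_rat a" using that by (simp add: eq_neg_iff_add_eq_0 add.commute)
    have "x = (of_rat b * x) / of_rat b" using False by simp
    then have "x = of_rat (- a / b)" unfolding bx by (simp only: of_rat_divide of_rat_minus)
    then show ?thesis using irr by blast
  qed (use that in simp)
  \<comment> \<open>A relation \<open>x * x = u * x + w\<close> would split off a quadratic factor
    of the cubic and make 1 - u a rational root of it; written in \<open>u\<close>, this is the
    cubic excluded by parity below.\<close>
  have indep: "a = 0 \<and> b = 0 \<and> c = 0" if rel: "of_rat a + of_rat b * x + of_rat c * (x * x) = 0" for a b c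
  proof (cases "c = 0")
    case False
    define u w where "u = - b / c" and "w = - a / c"
    have "x * x = - (of_rat a + of_rat b * x) / of_rat c"
      using rel False by (simp add: eq_divide_eq eq_neg_iff_add_eq_0 algebra_simps)
    then have xx: "x * x = of_rat u * x + of_rat w"
      by (simp add: u_def w_def of_rat_divide of_rat_minus add_divide_distrib diff_divide_distrib)
    have "x * x * x = of_rat u * (x * x) + of_rat w * x" by (subst xx) (simp add: algebra_simps)
    then have "x * x * x = of_rat (u * u + w) * x + of_rat (u * w)"
      unfolding xx by (simp add: of_rat_add of_rat_mult algebra_simps)
    then have "of_rat (u * w - w + 1) + of_rat (u * u + w - u - 2) * x = 0"
      using root unfolding xx by (simp add: of_rat_add of_rat_diff of_rat_mult algebra_simps)
    then have "u * w - w + 1 = 0" "u * u + w - u - 2 = 0" using indep1 by blast+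
    then have w: "w = u + 2 - u * u" and "u * w - w + 1 = 0" by (simp_all add: algebra_simps)
    then have "u * (u + 2 - u * u) - (u + 2 - u * u) + 1 = 0" by simp
    then have "u * u * u + of_int (-2) * (u * u) + of_int (-1) * u + of_int 1 = 0"
      by (simp add: algebra_simps)
    moreover have "odd (n * n * n + (-2) * (n * n) + (-1) * n + 1)" for n :: int
      by simp
    ultimately show ?thesis using monic_cubic_no_rational_root by blast
  qed (use indep1[of a b] that in simp)
  have "K = rat_adjoin x"
  proof
    have "rpoly f x \<in> K" for f
    proof (induction f)
      case 0
      show ?case using rat_in[of 0] by simp
    qed (auto intro: rat_in add_in mult_in x)
    then show "rat_adjoin x \<subseteq> K" unfolding rat_adjoin_altdef by blast
    show "K \<subseteq> rat_adjoin x"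
    proof
      fix y assume "y \<in> K"
      then obtain c0 c1 c2 c3 where c: "c0 \<noteq> 0 \<or> c1 \<noteq> 0 \<or> c2 \<noteq> 0 \<or> c3 \<noteq> 0"
        and rel: "of_rat c0 * 1 + of_rat c1 * x + of_rat c2 * (x * x) + of_rat c3 * y = 0"
        using dim[of 1 x "x * x" y] x mult_in rat_in[of 1] by auto
      have c3: "c3 \<noteq> 0" using indep[of c0 c1 c2] c rel by auto
      then have "y = - (of_rat c0 + of_rat c1 * x + of_rat c2 * (x * x)) / of_rat c3"
        using rel by (simp add: eq_divide_eq eq_neg_iff_add_eq_0 algebra_simps)
      also have "\<dots> = rpoly [:- c0 / c3, - c1 / c3, - c2 / c3:] x"
        by (simp add: of_rat_divide of_rat_minus add_divide_distrib diff_divide_distrib algebra_simps)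
      finally show "y \<in> rat_adjoin x" unfolding rat_adjoin_altdef by blast
    qed
  qed
  then show ?thesis
    using rat_adjoin_eq_of_root[OF root] by (simp add: Q_zeta7_plus_def \<eta>_def)
qed

theorem cubic_not_universal:
  assumes "totally_real_cubic_field K" "K \<noteq> Q_zeta7_plus" "Z_form r F"
  shows "\<not> universal_over K r F"
proof
  assume univ: "universal_over K r F"
  obtain \<sigma>1 \<sigma>2 \<sigma>3 where "cubic_field K \<sigma>1 \<sigma>2 \<sigma>3"
    using totally_real_cubic_field_interpretation[OF assms(1)] .
  then interpret cubic_field K \<sigma>1 \<sigma>2 \<sigma>3 .
  show False using universal_imp_root[OF assms(3) univ] eq_Q_zeta7_plus assms(2) by blast
qed

theorem theorem1p2:
  fixes K :: "complex set"
  assumes "totally_real_cubic_field K \<or> real_biquadratic_field K"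
    and "K \<noteq> Q_zeta7_plus"
  shows "\<not> (\<exists>r a. Z_form r a \<and> universal_over K r a)"
  using assms cubic_not_universal biquadratic_not_universal by blast

end
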